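(* Let $1\le p<\infty$, $0<r<\infty$, $0<q\le\infty$, $\frac1s:=\left(\frac1r-\frac1p\right)_+$. Let $u,v,w\in\mathfrak M^+$ with $0<\int_t^\infty u<\infty$ for all $t>0$, and let $k$ be an Oinarov kernel with constant $D$. Let $C_{\mathcal S}\in[0,\infty]$ be the least constant such that $\|\mathcal Sf\|_{L^r_u}\le C_{\mathcal S}\|f\|_{L^p_v}$ for all $f\in\mathfrak M^+$, where $$(\mathcal Sf)(x)=\left(\int_0^x w(y)\left(\int_0^y k(y,z)f(z)\,dz\right)^q dy\right)^{1/q}\ (q<\infty),\qquad (\mathcal Sf)(x)=\operatorname*{ess\,sup}_{y\in(0,x)} w(y)\int_0^y k(y,z)f(z)\,dz\ (q=\infty).$$ If $q<\infty$, let $\mathbf A_0,\mathbf A_1\in[0,\infty]$ be the least constants such that for all $f\in\mathfrak M^+$ $$\left(\int_0^\infty u(x)\left(\int_{\zeta^{-2}(x)}^x w\right)^{\frac rq}\left(\int_0^{\zeta^{-2}(x)} k(\zeta^{-2}(x),z)f(z)\,dz\right)^r dx\right)^{\frac1r}\le \mathbf A_0\|f\|_{L^p_v},$$ $$\left(\int_0^\infty u(x)\left(\int_{\zeta^{-2}(x)}^x w(y)[k(y,\zeta^{-2}(x))]^q\,dy\right)^{\frac rq}\left(\int_0^{\zeta^{-2}(x)} f\right)^r dx\right)^{\frac1r}\le \mathbf A_1\|f\|_{L^p_v};$$ if $q=\infty$, let $\mathbf A_0,\mathbf A_1\in[0,\infty]$ be the least constants such that for all $f\in\mathfrak M^+$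 $$\left(\int_0^\infty u(x)\left[\operatorname*{ess\,sup}_{y\in(\zeta^{-2}(x),x)}w(y)\right]^r\left(\int_0^{\zeta^{-2}(x)} k(\zeta^{-2}(x),z)f(z)\,dz\right)^r dx\right)^{\frac1r}\le \mathbf A_0\|f\|_{L^p_v},$$ $$\left(\int_0^\infty u(x)\left[\operatorname*{ess\,sup}_{y\in(\zeta^{-2}(x),x)}w(y)k(y,\zeta^{-2}(x))\right]^r\left(\int_0^{\zeta^{-2}(x)} f\right)^r dx\right)^{\frac1r}\le \mathbf A_1\|f\|_{L^p_v}.$$ Let $$\mathbf A_2:=\begin{cases}\displaystyle\sup_{t\in(0,\infty)}\left(\int_t^\infty u\right)^{\frac1r}\|\mathcal H^*_t\|_{L^p_v\to L^q_w},& p\le r,\\[2mm] \displaystyle\left(\int_0^\infty u(x)\left(\int_x^\infty u\right)^{\frac sp}\|\mathcal H^*_{\zeta^{-1}(x),\zeta(x)}\|^s_{L^p_v\to L^q_w}\,dx\right)^{\frac1s},& r<p.\end{cases}$$ Then $C_{\mathcal S}<\infty$ if and only if $\mathbf A_0$, $\mathbf A_1$ and $\mathbf A_2$ are all finite. Moreover, $C_{\mathcal S}\approx \mathbf A_0+\mathbf A_1+\mathbf A_2$, i.e. each side is bounded by the other times a positive constant depending only on $p,q,r,D$.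
   Context: $\mathfrak M$ is the set of measurable functions on $[0,\infty)$, $\mathfrak M^+\subset\mathfrak M$ the non-negative ones. For $0<p<\infty$, $v\in\mathfrak M^+$: $\|f\|_{L^p_v}:=\left(\int_0^\infty|f|^pv\right)^{1/p}$; for $p=\infty$: $\|f\|_{L^\infty_v}:=\operatorname{ess\,sup}_{x\ge0}v(x)|f(x)|$. For a positive operator $H$ on $\mathfrak M^+$, $\|H\|_{L^p_v\to L^q_w}\in[0,\infty]$ is the least $C$ with $\|Hf\|_{L^q_w}\le C\|f\|_{L^p_v}$ for all $f\in\mathfrak M^+$. Expressions $0\cdot\infty$, $\frac\infty\infty$, $\frac00$ are taken to be $0$. $(a)_+=\max(a,0)$ ($s$ is used only when $r<p$). Oinarov kernel with constant $D\ge1$: a Borel function $k(x,y)\ge0$ on $[0,\infty)^2$ with $k(x,y)=0$ if $x<y$ and $\frac1D(k(x,z)+k(z,y))\le k(x,y)\le D(k(x,z)+k(z,y))$ for all $x\ge z\ge y\ge0$. The functions $\zeta,\zeta^{-1}:[0,\infty)\to[0,\infty)$ are defined (with $\sup\varnothing=0$) by $$\zeta(x):=\sup\left\{y>0:\int_y^\infty u\ge\tfrac12\int_x^\infty u\right\},\qquad \zeta^{-1}(x):=\sup\left\{y>0:\int_y^\infty u\ge2\int_x^\infty u\right\},$$ and $\zeta^{-2}:=\zeta^{-1}\circ\zeta^{-1}$. For $0\le c<d<\infty$ and $f\in\mathfrak M^+$: $$(\mathcal H^*_{c,d}f)(x):=\chi_{(c,d]}(x)\int_{\zeta^{-1}(c)}^x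 k(x,z)f(z)\,dz,\qquad (\mathcal H^*_df)(x):=\chi_{(0,d]}(x)\int_0^x k(x,z)f(z)\,dz.$$ *)

theory Defs
  imports "HOL-Analysis.Analysis" "HOL-Probability.Essential_Supremum"
begin

text \<open>
  Non-negative functions take values in \<^typ>\<open>ennreal\<close>, i.e. in the extended half-line: already
  the image of an integral operator may be infinite.  Functions on the half-line are represented by
  functions on \<^typ>\<open>real\<close>, of which only the values on \<^term>\<open>{0::real..}\<close> are ever used.  The
  product on \<^typ>\<open>ennreal\<close> satisfies the convention that zero times infinity is zero.
\<close>

definition measurable_nonneg :: "(real \<Rightarrow> ennreal) set" where
  "measurable_nonneg = borel_measurable (lebesgue_on {0..})"

text \<open>Real powers on the extended half-line; used for exponents \<open>a > 0\<close> only.\<close>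

definition epowr :: "ennreal \<Rightarrow> real \<Rightarrow> ennreal" (infixr \<open>epowr\<close> 80) where
  "x epowr a = (if x = \<infinity> then \<infinity> else ennreal (enn2real x powr a))"

text \<open>Essential supremum over a set of reals; it is \<open>0\<close> on a null set.\<close>

definition ess_sup_on :: "real set \<Rightarrow> (real \<Rightarrow> ennreal) \<Rightarrow> ennreal" where
  "ess_sup_on A f = esssup (lebesgue_on A) f"

definition lp_norm :: "ennreal \<Rightarrow> (real \<Rightarrow> ennreal) \<Rightarrow> (real \<Rightarrow> ennreal) \<Rightarrow> ennreal" where
  "lp_norm p v f =
    (if p = \<infinity> then ess_sup_on {0..} (\<lambda>x. v x * f x)
     else (\<integral>\<^sup>+x\<in>{0..}. (f x) epowr (enn2real p) * v x \<partial>lebesgue) epowr (1 / enn2real p))"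

text \<open>The least constant \<open>C\<close> with \<open>\<Phi> f \<le> C * lp_norm p v f\<close> for all non-negative measurable \<open>f\<close>;
  it is infinite if there is no such constant.\<close>

definition least_const ::
    "ennreal \<Rightarrow> (real \<Rightarrow> ennreal) \<Rightarrow> ((real \<Rightarrow> ennreal) \<Rightarrow> ennreal) \<Rightarrow> ennreal" where
  "least_const p v \<Phi> = Inf {C. \<forall>f\<in>measurable_nonneg. \<Phi> f \<le> C * lp_norm p v f}"

definition op_norm ::
    "ennreal \<Rightarrow> (real \<Rightarrow> ennreal) \<Rightarrow> ennreal \<Rightarrow> (real \<Rightarrow> ennreal)
      \<Rightarrow> ((real \<Rightarrow> ennreal) \<Rightarrow> (real \<Rightarrow> ennreal)) \<Rightarrow> ennreal" where
  "op_norm p v q w H = least_const p v (\<lambda>f. lp_norm q w (H f))"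

definition oinarov_kernel :: "real \<Rightarrow> (real \<Rightarrow> real \<Rightarrow> ennreal) \<Rightarrow> bool" where
  "oinarov_kernel D k \<longleftrightarrow>
    1 \<le> D \<and>
    (\<lambda>(x, y). k x y) \<in> borel_measurable (restrict_space borel ({0..} \<times> {0..})) \<and>
    (\<forall>x y. 0 \<le> x \<longrightarrow> x < y \<longrightarrow> k x y = 0) \<and>
    (\<forall>x y z. 0 \<le> y \<longrightarrow> y \<le> z \<longrightarrow> z \<le> x \<longrightarrow>
       ennreal (1 / D) * (k x z + k z y) \<le> k x y \<and> k x y \<le> ennreal D * (k x z + k z y))"

definition tail :: "(real \<Rightarrow> ennreal) \<Rightarrow> real \<Rightarrow> ennreal" where
  "tail u t = (\<integral>\<^sup>+x\<in>{t..}. u x \<partial>lebesgue)"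

text \<open>Adding the point \<open>0\<close> to the set of positive reals implements the convention that the supremum
  of the empty set is \<open>0\<close>.\<close>

definition zeta :: "(real \<Rightarrow> ennreal) \<Rightarrow> real \<Rightarrow> real" where
  "zeta u x = Sup (insert 0 {y. 0 < y \<and> tail u y \<ge> tail u x / 2})"

definition zeta_inv :: "(real \<Rightarrow> ennreal) \<Rightarrow> real \<Rightarrow> real" where
  "zeta_inv u x = Sup (insert 0 {y. 0 < y \<and> tail u y \<ge> 2 * tail u x})"

definition zeta_inv2 :: "(real \<Rightarrow> ennreal) \<Rightarrow> real \<Rightarrow> real" where
  "zeta_inv2 u = zeta_inv u \<circ> zeta_inv u"

definition kernel_int :: "(real \<Rightarrow> real \<Rightarrow> ennreal) \<Rightarrow> (real \<Rightarrow> ennreal) \<Rightarrow> real \<Rightarrow> ennreal" where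
  "kernel_int k f y = (\<integral>\<^sup>+z\<in>{0..y}. k y z * f z \<partial>lebesgue)"

definition H_star ::
    "(real \<Rightarrow> real \<Rightarrow> ennreal) \<Rightarrow> real \<Rightarrow> (real \<Rightarrow> ennreal) \<Rightarrow> (real \<Rightarrow> ennreal)" where
  "H_star k d f = (\<lambda>x. indicator {0<..d} x * kernel_int k f x)"

definition H_star2 ::
    "(real \<Rightarrow> ennreal) \<Rightarrow> (real \<Rightarrow> real \<Rightarrow> ennreal) \<Rightarrow> real \<Rightarrow> real
      \<Rightarrow> (real \<Rightarrow> ennreal) \<Rightarrow> (real \<Rightarrow> ennreal)" where
  "H_star2 u k c d f =
    (\<lambda>x. indicator {c<..d} x * (\<integral>\<^sup>+z\<in>{zeta_inv u c..x}. k x z * f z \<partial>lebesgue))"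

definition S_op ::
    "ennreal \<Rightarrow> (real \<Rightarrow> ennreal) \<Rightarrow> (real \<Rightarrow> real \<Rightarrow> ennreal)
      \<Rightarrow> (real \<Rightarrow> ennreal) \<Rightarrow> (real \<Rightarrow> ennreal)" where
  "S_op q w k f =
    (\<lambda>x. if q = \<infinity> then ess_sup_on {0<..<x} (\<lambda>y. w y * kernel_int k f y)
         else (\<integral>\<^sup>+y\<in>{0..x}. w y * (kernel_int k f y) epowr (enn2real q) \<partial>lebesgue)
                epowr (1 / enn2real q))"

definition C_S ::
    "real \<Rightarrow> real \<Rightarrow> ennreal \<Rightarrow> (real \<Rightarrow> ennreal) \<Rightarrow> (real \<Rightarrow> ennreal) \<Rightarrow> (real \<Rightarrow> ennreal)
      \<Rightarrow> (real \<Rightarrow> real \<Rightarrow> ennreal) \<Rightarrow> ennreal" where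
  "C_S p r q u v w k = op_norm (ennreal p) v (ennreal r) u (S_op q w k)"

definition A_0 ::
    "real \<Rightarrow> real \<Rightarrow> ennreal \<Rightarrow> (real \<Rightarrow> ennreal) \<Rightarrow> (real \<Rightarrow> ennreal) \<Rightarrow> (real \<Rightarrow> ennreal)
      \<Rightarrow> (real \<Rightarrow> real \<Rightarrow> ennreal) \<Rightarrow> ennreal" where
  "A_0 p r q u v w k = least_const (ennreal p) v (\<lambda>f.
    (if q = \<infinity> then
       (\<integral>\<^sup>+x\<in>{0..}. u x
          * (ess_sup_on {zeta_inv2 u x<..<x} w) epowr r
          * (kernel_int k f (zeta_inv2 u x)) epowr r \<partial>lebesgue) epowr (1 / r)
     else
       (\<integral>\<^sup>+x\<in>{0..}. u x
          * (\<integral>\<^sup>+y\<in>{zeta_inv2 u x..x}. w y \<partial>lebesgue) epowr (r / enn2real q)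
          * (kernel_int k f (zeta_inv2 u x)) epowr r \<partial>lebesgue) epowr (1 / r)))"

definition A_1 ::
    "real \<Rightarrow> real \<Rightarrow> ennreal \<Rightarrow> (real \<Rightarrow> ennreal) \<Rightarrow> (real \<Rightarrow> ennreal) \<Rightarrow> (real \<Rightarrow> ennreal)
      \<Rightarrow> (real \<Rightarrow> real \<Rightarrow> ennreal) \<Rightarrow> ennreal" where
  "A_1 p r q u v w k = least_const (ennreal p) v (\<lambda>f.
    (if q = \<infinity> then
       (\<integral>\<^sup>+x\<in>{0..}. u x
          * (ess_sup_on {zeta_inv2 u x<..<x} (\<lambda>y. w y * k y (zeta_inv2 u x))) epowr r
          * (\<integral>\<^sup>+z\<in>{0..zeta_inv2 u x}. f z \<partial>lebesgue) epowr r \<partial>lebesgue) epowr (1 / r)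
     else
       (\<integral>\<^sup>+x\<in>{0..}. u x
          * (\<integral>\<^sup>+y\<in>{zeta_inv2 u x..x}. w y * (k y (zeta_inv2 u x)) epowr (enn2real q) \<partial>lebesgue)
              epowr (r / enn2real q)
          * (\<integral>\<^sup>+z\<in>{0..zeta_inv2 u x}. f z \<partial>lebesgue) epowr r \<partial>lebesgue) epowr (1 / r)))"

text \<open>Meaningful for \<open>r < p\<close> only.\<close>

definition s_exp :: "real \<Rightarrow> real \<Rightarrow> real" where
  "s_exp p r = 1 / max (1 / r - 1 / p) 0"

definition A_2 ::
    "real \<Rightarrow> real \<Rightarrow> ennreal \<Rightarrow> (real \<Rightarrow> ennreal) \<Rightarrow> (real \<Rightarrow> ennreal) \<Rightarrow> (real \<Rightarrow> ennreal)
      \<Rightarrow> (real \<Rightarrow> real \<Rightarrow> ennreal) \<Rightarrow> ennreal" where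
  "A_2 p r q u v w k =
    (if p \<le> r then
       (SUP t\<in>{0<..}. (tail u t) epowr (1 / r) * op_norm (ennreal p) v q w (H_star k t))
     else
       (\<integral>\<^sup>+x\<in>{0..}. u x
          * (tail u x) epowr (s_exp p r / p)
          * (op_norm (ennreal p) v q w (H_star2 u k (zeta_inv u x) (zeta u x))) epowr (s_exp p r)
          \<partial>lebesgue) epowr (1 / s_exp p r))"

end

theory Submission
  imports Defs
begin

text \<open>
  Cut the half-line at the points \<open>grid j\<close> where the tail of \<open>u\<close> equals \<open>2^(-j/2)\<close>.  Each block
  between consecutive points carries \<open>u\<close>-mass comparable with the tail at its left end, so integrals
  against \<open>u\<close> are comparable with geometrically weighted sums over the blocks, and a map such as
  \<open>\<zeta>\<close> merely shifts the blocks by a bounded amount.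

  For the upper bound, \<open>S f\<close> on block \<open>k\<close> is estimated by geometrically weighted contributions of
  the blocks \<open>j \<le> k\<close>, which a Hardy inequality for geometric sums decouples.  On block \<open>j\<close> the
  Oinarov condition splits the kernel integral into a part controlled by \<open>A_1\<close>, a part controlled by
  \<open>A_0\<close>, and a local integral over three neighbouring blocks.  The local parts are bounded by the
  operator norms in \<open>A_2\<close> and summed by Hoelder's inequality (if \<open>r < p\<close>) or by the embedding of
  sequence spaces (if \<open>p \<le> r\<close>), since the pieces of \<open>f\<close> overlap boundedly.

  For the lower bound, the integrands of \<open>A_0\<close> and \<open>A_1\<close> are pointwise at most \<open>D\<close> times that of
  \<open>S f\<close>.  For \<open>A_2\<close> with \<open>p \<le> r\<close> only monotonicity of \<open>S f\<close> is used; for \<open>r < p\<close> one tests on a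
  weighted supremum of near-extremal functions of the operators \<open>H_star k (grid (j + 1))\<close>.
  The tails along the grid have ratio the square root of two rather than two: this leaves room to
  bound the integrands below by the required constants on a block without measurability in \<open>x\<close>.
\<close>

section \<open>Powers, least constants and weighted norms\<close>

lemma epowr_top [simp]: "top epowr a = top"
  by (simp add: epowr_def)

lemma epowr_zero [simp]: "0 epowr a = 0"
  by (simp add: epowr_def)

lemma epowr_one_left [simp]: "1 epowr a = 1"
  by (simp add: epowr_def)

lemma epowr_ennreal: "0 \<le> x \<Longrightarrow> ennreal x epowr a = ennreal (x powr a)"
  by (simp add: epowr_def)

lemma epowr_one [simp]: "x epowr 1 = x"
  by (cases x) (auto simp: epowr_ennreal)

lemma epowr_mono: "0 \<le> a \<Longrightarrow> x \<le> y \<Longrightarrow> x epowr a \<le> y epowr a"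
  by (cases x; cases y) (auto simp: epowr_ennreal powr_mono2 top_unique)

lemma epowr_epowr: "(x epowr a) epowr b = x epowr (a * b)"
  by (cases x) (auto simp: epowr_ennreal powr_powr)

lemma epowr_inverse [simp]: "0 < a \<Longrightarrow> (x epowr a) epowr (1 / a) = x"
    "0 < a \<Longrightarrow> (x epowr (1 / a)) epowr a = x"
  by (simp_all add: epowr_epowr)

lemma epowr_le_iff: "0 < a \<Longrightarrow> x epowr a \<le> y epowr a \<longleftrightarrow> x \<le> y"
  by (metis epowr_mono epowr_inverse(1) less_eq_real_def zero_less_divide_1_iff)

lemma epowr_eq_0_iff [simp]: "x epowr a = 0 \<longleftrightarrow> x = 0"
  by (cases x) (auto simp: epowr_ennreal ennreal_eq_0_iff)

lemma epowr_eq_top_iff [simp]: "x epowr a = top \<longleftrightarrow> x = top"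
  by (cases x) (auto simp: epowr_ennreal)

lemma epowr_less_top_iff [simp]: "x epowr a < top \<longleftrightarrow> x < top"
  by (simp add: less_top[symmetric])

lemma epowr_mult: "(x * y) epowr a = x epowr a * y epowr a"
proof (cases x; cases y)
  fix s t :: real assume "0 \<le> s" "x = ennreal s" "0 \<le> t" "y = ennreal t"
  then show ?thesis
    by (simp add: epowr_ennreal powr_mult flip: ennreal_mult)
qed (auto simp: ennreal_mult_top ennreal_top_mult)

text \<open>Exponents of either sign are allowed, because \<open>0 epowr a = 0\<close> and
  \<open>top epowr a = top\<close> for every \<open>a\<close>.\<close>

lemma epowr_add: "x epowr (a + b) = x epowr a * x epowr b"
  by (cases x) (auto simp: epowr_ennreal powr_add ennreal_mult)

text \<open>From \<open>x + y \<le> 2 * max x y\<close>; this crude constant serves exponents below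
  and above one alike.\<close>

lemma epowr_add_le:
  assumes "0 \<le> a"
  shows "(x + y) epowr a \<le> ennreal (2 powr a) * (x epowr a + y epowr a)"
proof -
  have "(x + y) epowr a \<le> (2 * max x y) epowr a"
    using assms by (intro epowr_mono) (auto simp: mult_2 intro!: add_mono)
  also have "\<dots> = ennreal (2 powr a) * (max x y epowr a)"
    by (simp add: epowr_mult epowr_ennreal flip: ennreal_numeral)
  also have "\<dots> \<le> ennreal (2 powr a) * (x epowr a + y epowr a)"
    by (intro mult_left_mono) (auto simp: max_def)
  finally show ?thesis .
qed

lemma borel_measurable_epowr [measurable (raw)]:
  assumes "f \<in> borel_measurable M"
  shows "(\<lambda>x. f x epowr a) \<in> borel_measurable M"
  using assms unfolding epowr_def by measurable

text \<open>Young's inequality without the weights \<open>1 / a\<close> and \<open>1 / b\<close>: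
  if, say, \<open>y epowr b \<le> x epowr a\<close>, then \<open>y \<le> x epowr (a / b)\<close>,
  and \<open>1 + a / b = a\<close> by conjugacy. No convexity enters.\<close>

lemma young_epowr:
  assumes "0 < a" "0 < b" "1 / a + 1 / b = 1"
  shows "x * y \<le> x epowr a + y epowr b"
proof -
  have *: "x * y \<le> x epowr a" if "0 < a" "0 < b" "1 / a + 1 / b = 1" "y epowr b \<le> x epowr a" for x y a b
  proof -
    have "y \<le> x epowr (a / b)"
      using epowr_mono[of "1 / b", OF _ that(4)] that by (simp add: epowr_epowr)
    then have "x * y \<le> x epowr 1 * x epowr (a / b)"
      by (simp add: mult_left_mono)
    also have "\<dots> = x epowr (1 + a / b)"
      by (simp only: epowr_add)
    also have "1 + a / b = a"
      using that by (simp add: field_simps)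
    finally show ?thesis .
  qed
  show ?thesis
  proof (cases "y epowr b \<le> x epowr a")
    case True
    with *[OF assms] show ?thesis by (auto intro: order_trans add_increasing2)
  next
    case False
    with *[of b a x y] assms have "y * x \<le> y epowr b" 
      by (simp add: add.commute)
    then show ?thesis by (auto simp: mult.commute intro: order_trans add_increasing)
  qed
qed

text \<open>The infimum is itself admissible on functions of finite norm. A positive norm is divided
  out; at norm zero any admissible constant forces \<open>\<Phi> f = 0\<close>. An infinite norm is
  excluded because the least constant may be \<open>0\<close>, and
  \<open>0 * top = 0\<close>.\<close>

lemma least_const_bound:
  assumes "least_const p v \<Phi> < top" "f \<in> measurable_nonneg" "lp_norm p v f < top"
  shows "\<Phi> f \<le> least_const p v \<Phi> * lp_norm p v f"
proof (cases "lp_norm p v f = 0")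
  case True
  obtain C where "\<forall>f\<in>measurable_nonneg. \<Phi> f \<le> C * lp_norm p v f" "C < top"
    using assms(1) unfolding least_const_def Inf_less_iff by auto
  with True assms show ?thesis by fastforce
next
  case False
  have "\<Phi> f / lp_norm p v f \<le> least_const p v \<Phi>"
    unfolding least_const_def
    using False assms by (intro Inf_greatest) (auto simp: divide_le_posI_ennreal mult.commute zero_less_iff_neq_zero)
  then have "\<Phi> f / lp_norm p v f * lp_norm p v f \<le> least_const p v \<Phi> * lp_norm p v f"
    by (rule mult_right_mono) simp
  then show ?thesis
    using False assms(3) by (simp add: ennreal_divide_times ennreal_times_divide mult_divide_eq_ennreal less_top)
qed

text \<open>Testing functions of finite norm suffices: every \<open>K' > K\<close> is positive, so
  \<open>K' * top = top\<close> settles the infinite norms, which \<open>K = 0\<close> would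
  not.\<close>

lemma least_const_le:
  assumes "\<And>f. f \<in> measurable_nonneg \<Longrightarrow> lp_norm p v f < top \<Longrightarrow> \<Phi> f \<le> K * lp_norm p v f"
  shows "least_const p v \<Phi> \<le> K"
proof (rule dense_ge)
  fix K' assume "K < K'"
  have "\<Phi> f \<le> K' * lp_norm p v f" if "f \<in> measurable_nonneg" for f
  proof (cases "lp_norm p v f < top")
    case True
    then show ?thesis
      using assms[OF that] \<open>K < K'\<close> by (meson less_imp_le mult_right_mono order_trans zero_le)
  next
    case False
    then show ?thesis using \<open>K < K'\<close> by (auto simp: less_top[symmetric] ennreal_mult_top)
  qed
  then show "least_const p v \<Phi> \<le> K'"
    unfolding least_const_def by (intro Inf_lower) simp
qed

lemma least_const_mono:
  assumes "\<And>f. f \<in> measurable_nonneg \<Longrightarrow> \<Phi> f \<le> \<Psi> f"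
  shows "least_const p v \<Phi> \<le> least_const p v \<Psi>"
  unfolding least_const_def using assms by (intro Inf_superset_mono) (auto intro: order_trans)

section \<open>The half-line as a measure space, and weighted norms on it\<close>

abbreviation hl :: "real measure" where
  "hl \<equiv> lebesgue_on {0..}"

lemma measurable_nonnegD [measurable_dest]: "f \<in> measurable_nonneg \<Longrightarrow> f \<in> borel_measurable hl"
  by (simp add: measurable_nonneg_def)

lemma measurable_nonneg_iff: "f \<in> measurable_nonneg \<longleftrightarrow> f \<in> borel_measurable hl"
  by (simp add: measurable_nonneg_def)

lemma borel_measurable_hl: "f \<in> borel_measurable borel \<Longrightarrow> f \<in> borel_measurable hl"
  by (intro measurable_restrict_space1 measurable_completion) simp

lemma indicator_hl [measurable]:
  "A \<in> sets borel \<Longrightarrow> (indicator A :: real \<Rightarrow> ennreal) \<in> borel_measurable hl"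
  by (rule borel_measurable_hl) simp

lemma nn_set_integral_hl: 
  "A \<subseteq> {0..} \<Longrightarrow> (\<integral>\<^sup>+x\<in>A. f x \<partial>lebesgue) = (\<integral>\<^sup>+x. f x * indicator A x \<partial>hl)"
  by (subst nn_integral_restrict_space) (auto intro!: nn_integral_cong simp: indicator_def)

lemma nn_set_integral_hl_0: "(\<integral>\<^sup>+x\<in>{0..}. f x \<partial>lebesgue) = (\<integral>\<^sup>+x. f x \<partial>hl)"
  by (subst nn_integral_restrict_space) simp_all

lemma lp_norm_top: "lp_norm top v f = esssup hl (\<lambda>x. v x * f x)"
  by (simp add: lp_norm_def ess_sup_on_def)

lemma lp_norm_ennreal:
  "0 \<le> p \<Longrightarrow> lp_norm (ennreal p) v f = (\<integral>\<^sup>+x. f x epowr p * v x \<partial>hl) epowr (1 / p)"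
  by (simp add: lp_norm_def nn_set_integral_hl_0)

lemma lp_norm_epowr:
  "0 < p \<Longrightarrow> lp_norm (ennreal p) v f epowr p = (\<integral>\<^sup>+x. f x epowr p * v x \<partial>hl)"
  by (simp add: lp_norm_ennreal)

lemma exponent_cases:
  assumes "0 < (q::ennreal)"
  obtains "q = top" | q' where "q = ennreal q'" "0 < q'"
  using assms by (cases q) auto

context
  fixes q :: ennreal and w :: "real \<Rightarrow> ennreal"
  assumes q: "0 < q" and w [measurable]: "w \<in> measurable_nonneg"
begin

text \<open>Measurability is asked of the smaller function alone: \<open>esssup\<close> of a
  non-measurable function is \<open>top\<close>, and the nonnegative integral is monotone for
  arbitrary functions.\<close>

lemma lp_norm_mono_AE:
  assumes [measurable]: "f \<in> measurable_nonneg" and "AE x in hl. f x \<le> g x"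
  shows "lp_norm q w f \<le> lp_norm q w g"
  using q
proof (cases rule: exponent_cases)
  case 1
  then show ?thesis using assms(2)
    by (auto simp: lp_norm_top intro!: esssup_AE_mono mult_left_mono)
next
  case (2 q')
  have "AE x in hl. f x epowr q' * w x \<le> g x epowr q' * w x"
    using assms(2) by eventually_elim (use 2 in \<open>auto intro!: mult_right_mono epowr_mono\<close>)
  with 2 show ?thesis
    by (auto simp: lp_norm_ennreal intro!: epowr_mono nn_integral_mono_AE)
qed

lemma lp_norm_mono:
  assumes "f \<in> measurable_nonneg" and "\<And>x. 0 \<le> x \<Longrightarrow> f x \<le> g x"
  shows "lp_norm q w f \<le> lp_norm q w g"
  using assms by (intro lp_norm_mono_AE) (auto intro!: AE_I2)

lemma lp_norm_cong_AE:
  assumes "f \<in> measurable_nonneg" "g \<in> measurable_nonneg" "AE x in hl. f x = g x"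
  shows "lp_norm q w f = lp_norm q w g"
  using assms by (intro antisym lp_norm_mono_AE) (auto elim: eventually_mono)

lemma lp_norm_zero: "lp_norm q w (\<lambda>x. 0) = 0"
  using q
proof (cases rule: exponent_cases)
  case 1
  have "esssup hl (\<lambda>x. 0::ennreal) \<le> 0" by (intro esssup_I) auto
  then show ?thesis by (simp add: 1 lp_norm_top)
next
  case (2 q')
  then show ?thesis by (simp add: lp_norm_ennreal)
qed

lemma lp_norm_cmult:
  assumes [measurable]: "f \<in> measurable_nonneg"
  shows "lp_norm q w (\<lambda>x. c * f x) = c * lp_norm q w f"
  using q
proof (cases rule: exponent_cases)
  case 1
  let ?E = "esssup hl (\<lambda>x. w x * (c * f x))"
  have *: "AE x in hl. w x * (c * f x) \<le> ?E"
    by (rule esssup_AE)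
  have "c * esssup hl (\<lambda>x. w x * f x) \<le> ?E"
  proof (cases "c = 0 \<or> ?E = top")
    case False
    show ?thesis
    proof (cases "c = top")
      case c: False
      with False have c: "0 < c" "c < top" by (auto simp: zero_less_iff_neq_zero less_top)
      have "AE x in hl. w x * f x \<le> ?E / c"
        using *
      proof eventually_elim
        case (elim x)
        then have "w x * f x * c / c \<le> ?E / c"
          by (intro divide_right_mono_ennreal) (simp add: mult_ac)
        then show ?case using c by (simp add: ennreal_mult_divide_eq)
      qed
      then have "esssup hl (\<lambda>x. w x * f x) \<le> ?E / c"
        by (auto intro!: esssup_I)
      then have "c * esssup hl (\<lambda>x. w x * f x) \<le> c * (?E / c)"
        by (intro mult_left_mono) auto
      also have "c * (?E / c) = ?E * c / c"
        by (simp only: ennreal_times_divide mult.commute)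
      also have "\<dots> = ?E"
        using c by (intro ennreal_mult_divide_eq) auto
      finally show ?thesis .
    next
      \<comment> \<open>For \<open>c = top\<close> the finiteness of \<open>?E\<close> forces
        \<open>w x * f x = 0\<close> almost everywhere.\<close>
      case True
      have "AE x in hl. w x * f x \<le> 0"
        using * by eventually_elim
          (use True False in \<open>auto simp: ennreal_mult_top ennreal_top_mult top_unique split: if_splits\<close>)
      then have "esssup hl (\<lambda>x. w x * f x) \<le> 0"
        by (intro esssup_I) auto
      then show ?thesis by simp
    qed
  qed auto
  moreover have "AE x in hl. w x * f x \<le> esssup hl (\<lambda>x. w x * f x)"
    by (rule esssup_AE)
  then have "AE x in hl. w x * (c * f x) \<le> c * esssup hl (\<lambda>x. w x * f x)"
    by eventually_elim (simp add: mult.left_commute mult_left_mono)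
  then have "?E \<le> c * esssup hl (\<lambda>x. w x * f x)"
    by (auto intro!: esssup_I)
  ultimately show ?thesis by (simp add: 1 lp_norm_top)
next
  case (2 q')
  then show ?thesis
    by (simp add: lp_norm_ennreal epowr_mult mult.assoc nn_integral_cmult)
qed

text \<open>The two factors come from \<open>epowr_add_le\<close> at the exponents \<open>q\<close>
  and \<open>1 / q\<close>, so that \<open>q < 1\<close> is covered. For \<open>q = top\<close> one
  has \<open>enn2real q = 0\<close>, and division by zero yields the constant
  \<open>2\<close>.\<close>

lemma lp_norm_add_le:
  assumes [measurable]: "f \<in> measurable_nonneg" "g \<in> measurable_nonneg"
  shows "lp_norm q w (\<lambda>x. f x + g x)
      \<le> ennreal (2 * 2 powr (1 / enn2real q)) * (lp_norm q w f + lp_norm q w g)"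
  using q
proof (cases rule: exponent_cases)
  case 1
  have "AE x in hl. w x * (f x + g x) \<le> esssup hl (\<lambda>x. w x * f x) + esssup hl (\<lambda>x. w x * g x)"
    using esssup_AE[of "\<lambda>x. w x * f x" hl] esssup_AE[of "\<lambda>x. w x * g x" hl]
    by eventually_elim (auto simp: distrib_left intro!: add_mono)
  then have "lp_norm q w (\<lambda>x. f x + g x) \<le> 1 * (lp_norm q w f + lp_norm q w g)"
    by (auto simp: 1 lp_norm_top intro!: esssup_I)
  also have "\<dots> \<le> 2 * (lp_norm q w f + lp_norm q w g)"
    by (intro mult_right_mono) auto
  finally show ?thesis by (simp add: 1)
next
  case (2 q')
  let ?I = "\<lambda>f. \<integral>\<^sup>+x. f x epowr q' * w x \<partial>hl"
  have "?I (\<lambda>x. f x + g x) \<le> (\<integral>\<^sup>+x. ennreal (2 powr q') * (f x epowr q' * w x + g x epowr q' * w x) \<partial>hl)"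
    using epowr_add_le[of q'] 2
    by (intro nn_integral_mono)
       (auto simp: mult.assoc[symmetric] distrib_right[symmetric] intro!: mult_right_mono)
  also have "\<dots> = ennreal (2 powr q') * (?I f + ?I g)"
    by (simp add: nn_integral_cmult nn_integral_add)
  finally have "?I (\<lambda>x. f x + g x) epowr (1 / q') \<le> (ennreal (2 powr q') * (?I f + ?I g)) epowr (1 / q')"
    using 2 by (intro epowr_mono) auto
  also have "\<dots> = 2 * (?I f + ?I g) epowr (1 / q')"
    using 2 by (simp add: epowr_mult epowr_ennreal powr_powr)
  also have "\<dots> \<le> 2 * (ennreal (2 powr (1 / q')) * (?I f epowr (1 / q') + ?I g epowr (1 / q')))"
    using 2 by (intro mult_left_mono epowr_add_le) auto
  finally show ?thesis
    using 2 by (simp add: lp_norm_ennreal ennreal_mult mult.assoc)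
qed

text \<open>For finite \<open>q\<close> the \<open>q\<close>-th powers of the pieces are dominated
  by a geometric series; for \<open>q = top\<close> each of the countably many pieces is bounded by
  \<open>B\<close>. The summand \<open>+ 1\<close> is all that remains of the constant at
  \<open>q = top\<close>, where \<open>enn2real q = 0\<close> turns the first term into
  \<open>0 powr 0 = 0\<close>.\<close>

lemma lp_norm_UN_le:
  fixes E :: "nat \<Rightarrow> real set"
  assumes [measurable]: "g \<in> measurable_nonneg" "\<And>i. E i \<in> sets borel" and "0 < \<epsilon>"
    and le: "\<And>i. lp_norm q w (\<lambda>x. indicator (E i) x * g x) \<le> ennreal (2 powr (- \<epsilon> * i)) * B"
  shows "lp_norm q w (\<lambda>x. indicator (\<Union>i. E i) x * g x)
    \<le> ennreal ((1 / (1 - 2 powr (- \<epsilon> * enn2real q))) powr (1 / enn2real q) + 1) * B"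
  using q
proof (cases rule: exponent_cases)
  case 1
  have "AE x in hl. w x * (indicator (E i) x * g x) \<le> B" for i
  proof -
    have "AE x in hl. w x * (indicator (E i) x * g x) \<le> lp_norm q w (\<lambda>x. indicator (E i) x * g x)"
      using esssup_AE[of _ hl] by (simp add: 1 lp_norm_top)
    moreover have "ennreal (2 powr (- \<epsilon> * i)) * B \<le> 1 * B"
      using \<open>0 < \<epsilon>\<close> powr_mono[of "- \<epsilon> * i" 0 2] by (intro mult_right_mono) auto
    then have "lp_norm q w (\<lambda>x. indicator (E i) x * g x) \<le> B"
      using le[of i] by simp
    ultimately show ?thesis by (auto elim: eventually_mono)
  qed
  then have "AE x in hl. \<forall>i. w x * (indicator (E i) x * g x) \<le> B"
    by (simp only: AE_all_countable) auto
  then have "AE x in hl. w x * (indicator (\<Union>i. E i) x * g x) \<le> B"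
  proof eventually_elim
    case (elim x)
    then show ?case
    proof (cases "x \<in> (\<Union>i. E i)")
      case True
      then obtain i where "x \<in> E i" by auto
      with elim[rule_format, of i] True show ?thesis by (simp add: indicator_def)
    qed simp
  qed
  then have "lp_norm q w (\<lambda>x. indicator (\<Union>i. E i) x * g x) \<le> 1 * B"
    by (auto simp: 1 lp_norm_top intro!: esssup_I)
  also have "\<dots> \<le> ennreal ((1 / (1 - 2 powr (- \<epsilon> * enn2real q))) powr (1 / enn2real q) + 1) * B"
    by (intro mult_right_mono) auto
  finally show ?thesis .
next
  case (2 q')
  let ?I = "\<lambda>A. \<integral>\<^sup>+x. (indicator A x * g x) epowr q' * w x \<partial>hl"
  have c: "2 powr (- \<epsilon> * q') < 1" using 2 \<open>0 < \<epsilon>\<close> powr_less_mono[of "- \<epsilon> * q'" 0 2] by simp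
  have "?I (\<Union>i. E i) \<le> (\<integral>\<^sup>+x. (\<Sum>i. (indicator (E i) x * g x) epowr q' * w x) \<partial>hl)"
  proof (intro nn_integral_mono)
    fix x
    show "(indicator (\<Union>i. E i) x * g x) epowr q' * w x \<le> (\<Sum>i. (indicator (E i) x * g x) epowr q' * w x)"
    proof (cases "x \<in> (\<Union>i. E i)")
      case True
      then obtain i where "x \<in> E i" by auto
      then have "(indicator (\<Union>i. E i) x * g x) epowr q' * w x = (\<Sum>i\<in>{i}. (indicator (E i) x * g x) epowr q' * w x)"
        by (auto simp: indicator_def)
      also have "\<dots> \<le> (\<Sum>i. (indicator (E i) x * g x) epowr q' * w x)"
        by (intro sum_le_suminf) auto
      finally show ?thesis .
    qed simp
  qed
  also have "\<dots> = (\<Sum>i. ?I (E i))"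
    by (intro nn_integral_suminf) measurable
  also have "\<dots> \<le> (\<Sum>i. ennreal ((2 powr (- \<epsilon> * q')) ^ i) * B epowr q')"
  proof (intro suminf_le)
    fix i
    have "?I (E i) \<le> (ennreal (2 powr (- \<epsilon> * i)) * B) epowr q'"
      using epowr_mono[OF _ le[of i], of q'] 2 by (simp add: lp_norm_ennreal)
    moreover have "(2 powr (- \<epsilon> * i)) powr q' = (2 powr (- \<epsilon> * q')) ^ i"
      by (simp add: powr_powr powr_power mult_ac)
    ultimately show "?I (E i) \<le> ennreal ((2 powr (- \<epsilon> * q')) ^ i) * B epowr q'"
      by (simp add: epowr_mult epowr_ennreal)
  qed auto
  also have "\<dots> = ennreal (1 / (1 - 2 powr (- \<epsilon> * q'))) * B epowr q'"
  proof -
    have "(\<lambda>i. (2 powr (- \<epsilon> * q')) ^ i) sums (1 / (1 - 2 powr (- \<epsilon> * q')))"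
      by (rule geometric_sums) (use c in simp)
    then have "(\<Sum>i. ennreal ((2 powr (- \<epsilon> * q')) ^ i)) = ennreal (1 / (1 - 2 powr (- \<epsilon> * q')))"
      by (intro suminf_ennreal_eq) (rule zero_le_power, simp)
    then show ?thesis
      by (simp only: ennreal_suminf_multc)
  qed
  finally have "?I (\<Union>i. E i) epowr (1 / q') \<le> (ennreal (1 / (1 - 2 powr (- \<epsilon> * q'))) * B epowr q') epowr (1 / q')"
    using 2 by (intro epowr_mono) auto
  also have "\<dots> = ennreal ((1 / (1 - 2 powr (- \<epsilon> * q'))) powr (1 / q')) * B"
    using 2 c by (simp add: epowr_mult epowr_ennreal)
  also have "\<dots> \<le> ennreal ((1 / (1 - 2 powr (- \<epsilon> * q'))) powr (1 / q') + 1) * B"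
    by (intro mult_right_mono) auto
  finally show ?thesis
    using 2 by (simp add: lp_norm_ennreal)
qed

end

section \<open>Oinarov kernels\<close>

lemma AE_hl_neq: "AE x in hl. x \<noteq> (a :: real)"
proof -
  have "AE x in lebesgue. x \<noteq> a"
    by (intro AE_completion AE_lborel_singleton)
  then show ?thesis
    by (subst AE_restrict_space_iff) (auto elim: eventually_mono)
qed

locale oinarov =
  fixes D :: real and k :: "real \<Rightarrow> real \<Rightarrow> ennreal"
  assumes oinarov: "oinarov_kernel D k"
begin

lemma D_ge_1: "1 \<le> D"
  using oinarov by (simp add: oinarov_kernel_def)

lemma kernel_upper:
  "0 \<le> y \<Longrightarrow> y \<le> z \<Longrightarrow> z \<le> x \<Longrightarrow> k x y \<le> ennreal D * (k x z + k z y)"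
  using oinarov by (simp add: oinarov_kernel_def)

lemma kernel_lower:
  assumes "0 \<le> y" "y \<le> z" "z \<le> x"
  shows "k x z + k z y \<le> ennreal D * k x y"
proof -
  have "ennreal D * (ennreal (1 / D) * (k x z + k z y)) \<le> ennreal D * k x y"
    using oinarov assms by (intro mult_left_mono) (auto simp: oinarov_kernel_def)
  moreover have "ennreal D * ennreal (1 / D) = 1"
    using D_ge_1 by (simp flip: ennreal_mult)
  ultimately show ?thesis
    by (simp flip: mult.assoc)
qed

text \<open>One summand of \<open>kernel_lower\<close> is dropped. Together with the next lemma this
  is the monotonicity, up to the factor \<open>D\<close>, of an Oinarov kernel in each
  variable.\<close>

lemma kernel_antimono_right: "0 \<le> y \<Longrightarrow> y \<le> z \<Longrightarrow> z \<le> x \<Longrightarrow> k x z \<le> ennreal D * k x y"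
  using kernel_lower[of y z x] by (rule order_trans[rotated]) auto

lemma kernel_mono_left: "0 \<le> y \<Longrightarrow> y \<le> z \<Longrightarrow> z \<le> x \<Longrightarrow> k z y \<le> ennreal D * k x y"
  using kernel_lower[of y z x] by (rule order_trans[rotated]) auto

text \<open>Cutting off outside the quadrant gives a function that is Borel on the whole plane, as
  Tonelli's theorem and the passage to sections require.\<close>

lemma kernel_borel:
  "(\<lambda>(x, y). k x y * indicator ({0..} \<times> {0..}) (x, y)) \<in> borel_measurable (borel \<Otimes>\<^sub>M borel)"
proof -
  have "(\<lambda>x. (case x of (x, y) \<Rightarrow> k x y) * indicator ({0..} \<times> {0..}) x) \<in> borel_measurable (borel :: (real \<times> real) measure)"
    using oinarov
    by (subst borel_measurable_restrict_space_iff_ennreal[symmetric])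
       (auto simp: oinarov_kernel_def intro!: borel_closed closed_Times)
  then show ?thesis
    by (simp add: borel_prod case_prod_unfold)
qed

lemma kernel_section_measurable:
  assumes "0 \<le> b"
  shows "(\<lambda>y. k y b) \<in> measurable_nonneg"
proof -
  have "(\<lambda>y. k y b * indicator ({0..} \<times> {0..}) (y, b)) \<in> borel_measurable borel"
    using measurable_compose[OF _ kernel_borel, of "\<lambda>y. (y, b)" borel] by simp
  then have "(\<lambda>y. k y b * indicator ({0..} \<times> {0..}) (y, b)) \<in> borel_measurable hl"
    by (rule borel_measurable_hl)
  then show ?thesis
    unfolding measurable_nonneg_iff
    by (rule measurable_cong[THEN iffD1, rotated]) (use assms in auto)
qed

lemma kernel_section_measurable':
  assumes "0 \<le> b"
  shows "(\<lambda>z. k b z) \<in> borel_measurable hl"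
proof -
  have "(\<lambda>y. k b y * indicator ({0..} \<times> {0..}) (b, y)) \<in> borel_measurable borel"
    using measurable_compose[OF _ kernel_borel, of "\<lambda>y. (b, y)" borel] by simp
  then have "(\<lambda>y. k b y * indicator ({0..} \<times> {0..}) (b, y)) \<in> borel_measurable hl"
    by (rule borel_measurable_hl)
  then show ?thesis
    by (rule measurable_cong[THEN iffD1, rotated]) (use assms in auto)
qed

lemma kernel_int_hl: "kernel_int k f y = (\<integral>\<^sup>+z. k y z * f z * indicator {0..y} z \<partial>hl)"
  unfolding kernel_int_def by (rule nn_set_integral_hl) auto

text \<open>Measurability of a parameter integral needs a jointly measurable integrand on a product
  space, whereas \<open>f\<close> is only Lebesgue measurable. A Borel function \<open>f'\<close>
  equal to \<open>f\<close> almost everywhere gives the same integral for each fixed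
  \<open>y\<close>.\<close>

lemma kernel_int_measurable:
  assumes "f \<in> measurable_nonneg"
  shows "kernel_int k f \<in> measurable_nonneg"
proof -
  have "(\<lambda>z. f z * indicator {0..} z) \<in> borel_measurable lebesgue"
    using assms unfolding measurable_nonneg_def
    by (subst borel_measurable_restrict_space_iff_ennreal[symmetric]) auto
  then obtain f' where f'[measurable]: "f' \<in> borel_measurable lborel"
    and eq: "AE z in lborel. f z * indicator {0..} z = f' z"
    using completion_ex_borel_measurable by blast
  note kernel_borel[measurable]
  have f'': "f' \<in> borel_measurable borel" using f' by simp
  note f''[measurable]
  have "(\<lambda>y. \<integral>\<^sup>+z. (k y z * indicator ({0..} \<times> {0..}) (y, z)) * f' z * (if z \<le> y then 1 else 0) \<partial>lborel)
      \<in> borel_measurable borel"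
    by measurable
  then have "(\<lambda>y. \<integral>\<^sup>+z. (k y z * indicator ({0..} \<times> {0..}) (y, z)) * f' z * (if z \<le> y then 1 else 0) \<partial>lborel)
      \<in> borel_measurable hl"
    by (rule borel_measurable_hl)
  then show ?thesis
    unfolding measurable_nonneg_iff
  proof (rule measurable_cong[THEN iffD1, rotated])
    fix y :: real assume "y \<in> space hl"
    then have "0 \<le> y" by simp
    have "kernel_int k f y = (\<integral>\<^sup>+z. k y z * f z * indicator {0..y} z \<partial>lborel)"
      by (simp add: kernel_int_def nn_integral_completion)
    also have "\<dots> = (\<integral>\<^sup>+z. (k y z * indicator ({0..} \<times> {0..}) (y, z)) * f' z * (if z \<le> y then 1 else 0) \<partial>lborel)"
      using eq \<open>0 \<le> y\<close>
      by (intro nn_integral_cong_AE) (auto elim!: eventually_mono simp: indicator_def split: if_splits)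
    finally show "(\<integral>\<^sup>+z. (k y z * indicator ({0..} \<times> {0..}) (y, z)) * f' z * (if z \<le> y then 1 else 0) \<partial>lborel) = kernel_int k f y"
      by simp
  qed
qed

lemma kernel_int_mono_arg:
  "(\<And>z. 0 \<le> z \<Longrightarrow> f z \<le> g z) \<Longrightarrow> kernel_int k f y \<le> kernel_int k g y"
  unfolding kernel_int_hl by (intro nn_integral_mono) (auto intro!: mult_mono)

lemma kernel_int_cmult:
  assumes [measurable]: "f \<in> measurable_nonneg"
  shows "kernel_int k (\<lambda>z. c * f z) y = c * kernel_int k f y"
proof (cases "0 \<le> y")
  case True
  note kernel_section_measurable'[OF True, measurable]
  show ?thesis
    unfolding kernel_int_hl by (subst nn_integral_cmult[symmetric]) (auto simp: mult_ac)
qed (simp add: kernel_int_hl)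

lemma kernel_int_mono:
  assumes [measurable]: "f \<in> measurable_nonneg" and "0 \<le> y" "y \<le> t"
  shows "kernel_int k f y \<le> ennreal D * kernel_int k f t"
proof -
  have [measurable]: "(\<lambda>z. k t z) \<in> borel_measurable hl"
    using assms by (intro kernel_section_measurable') auto
  have "kernel_int k f y \<le> (\<integral>\<^sup>+z. ennreal D * (k t z * f z * indicator {0..t} z) \<partial>hl)"
    unfolding kernel_int_hl
  proof (intro nn_integral_mono)
    fix z assume "z \<in> space hl"
    then show "k y z * f z * indicator {0..y} z \<le> ennreal D * (k t z * f z * indicator {0..t} z)"
      using kernel_mono_left[of z y t] assms
      by (auto simp: indicator_def mult.assoc[symmetric] intro!: mult_right_mono)
  qed
  also have "\<dots> = ennreal D * kernel_int k f t"
    unfolding kernel_int_hl by (intro nn_integral_cmult) measurable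
  finally show ?thesis .
qed

text \<open>For \<open>z \<le> t\<close> the value \<open>k y t\<close> is at most
  \<open>D * k y z\<close>. This is the pointwise comparison behind the bound of \<open>A_1\<close>,
  as \<open>kernel_int_mono\<close> is behind that of \<open>A_0\<close>.\<close>

lemma kernel_mult_integral_le:
  assumes [measurable]: "f \<in> measurable_nonneg" and "0 \<le> t" "t \<le> y"
  shows "k y t * (\<integral>\<^sup>+z. f z * indicator {0..t} z \<partial>hl) \<le> ennreal D * kernel_int k f y"
proof -
  have [measurable]: "(\<lambda>z. k y z) \<in> borel_measurable hl"
    using assms by (intro kernel_section_measurable') auto
  have "k y t * (\<integral>\<^sup>+z. f z * indicator {0..t} z \<partial>hl) = (\<integral>\<^sup>+z. k y t * (f z * indicator {0..t} z) \<partial>hl)"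
    by (intro nn_integral_cmult[symmetric]) measurable
  also have "\<dots> \<le> (\<integral>\<^sup>+z. ennreal D * (k y z * f z * indicator {0..y} z) \<partial>hl)"
  proof (intro nn_integral_mono)
    fix z assume "z \<in> space hl"
    then show "k y t * (f z * indicator {0..t} z) \<le> ennreal D * (k y z * f z * indicator {0..y} z)"
      using kernel_antimono_right[of z t y] assms
      by (auto simp: indicator_def mult.assoc[symmetric] intro!: mult_right_mono)
  qed
  also have "\<dots> = ennreal D * kernel_int k f y"
    unfolding kernel_int_hl by (intro nn_integral_cmult) measurable
  finally show ?thesis .
qed

text \<open>For \<open>z \<le> a\<close> the Oinarov condition at \<open>b\<close> splits
  \<open>k y z\<close> into \<open>k y b\<close>, which leaves a plain integral of \<open>f\<close>,
  and \<open>k b z\<close>, which is absorbed in the integral at \<open>b\<close>; the range above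
  \<open>a\<close> stays whole. Two points are used because the point \<open>zeta_inv2 u x\<close>
  will only be located between neighbouring grid points, and the \<open>A_1\<close> part needs one
  of them on either side of it.\<close>

lemma kernel_int_split_le:
  assumes f[measurable]: "f \<in> measurable_nonneg" and "0 \<le> a" "a \<le> b" "b \<le> y"
  shows "kernel_int k f y \<le> ennreal D * (k y b * (\<integral>\<^sup>+z. f z * indicator {0..a} z \<partial>hl) + kernel_int k f b)
    + kernel_int k (\<lambda>z. indicator {a<..y} z * f z) y"
proof -
  have [measurable]: "(\<lambda>z. k y z) \<in> borel_measurable hl" "(\<lambda>z. k b z) \<in> borel_measurable hl"
    using assms by (intro kernel_section_measurable'; simp)+
  have "kernel_int k f y \<le> (\<integral>\<^sup>+z. ennreal D * (k y b * (f z * indicator {0..a} z) + k b z * f z * indicator {0..b} z)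
     + k y z * (indicator {a<..y} z * f z) * indicator {0..y} z \<partial>hl)"
    unfolding kernel_int_hl
  proof (intro nn_integral_mono)
    fix z assume z: "z \<in> space hl"
    show "k y z * f z * indicator {0..y} z \<le> ennreal D * (k y b * (f z * indicator {0..a} z) + k b z * f z * indicator {0..b} z)
     + k y z * (indicator {a<..y} z * f z) * indicator {0..y} z"
    proof (cases "z \<le> a")
      case True
      then have "k y z * f z \<le> ennreal D * (k y b + k b z) * f z"
        using z assms by (intro mult_right_mono kernel_upper) auto
      then show ?thesis using True z assms by (simp add: indicator_def distrib_right mult.assoc)
    next
      case False
      then show ?thesis using z by (simp add: indicator_def)
    qed
  qed
  also have "\<dots> = ennreal D * (k y b * (\<integral>\<^sup>+z. f z * indicator {0..a} z \<partial>hl) + kernel_int k f b)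
    + kernel_int k (\<lambda>z. indicator {a<..y} z * f z) y"
    unfolding kernel_int_hl by (simp add: nn_integral_add nn_integral_cmult)
  finally show ?thesis .
qed

end

section \<open>Discretisation\<close>

text \<open>The generalised inverse of the tail, of which \<open>zeta\<close>,
  \<open>zeta_inv\<close> and the grid are all instances.\<close>

definition tau :: "(real \<Rightarrow> ennreal) \<Rightarrow> ennreal \<Rightarrow> real" where
  "tau u a = Sup (insert 0 {y. 0 < y \<and> a \<le> tail u y})"

lemma zeta_eq_tau: "zeta u x = tau u (tail u x / 2)"
  by (simp add: zeta_def tau_def)

lemma zeta_inv_eq_tau: "zeta_inv u x = tau u (2 * tail u x)"
  by (simp add: zeta_inv_def tau_def)

section \<open>Geometric levels and two-sided series\<close>

definition rho :: "int \<Rightarrow> ennreal" where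
  "rho j = ennreal (2 powr (- j / 2))"

lemma rho_pos [simp]: "0 < rho j" "rho j \<noteq> 0" and rho_less_top [simp]: "rho j < top" "rho j \<noteq> top"
  by (auto simp: rho_def)

lemma rho_mono: "i \<le> j \<Longrightarrow> rho j \<le> rho i"
  by (auto simp: rho_def intro!: ennreal_leI)

lemma rho_add: "rho (i + j) = rho i * rho j"
  by (simp add: rho_def powr_add[symmetric] field_simps flip: ennreal_mult)

text \<open>Two steps of ratio square root of two make one factor of two, so doubling, quadrupling
  and halving are index shifts.\<close>

lemma rho_numeral: "2 * rho j = rho (j - 2)" "4 * rho j = rho (j - 4)" "rho j / 2 = rho (j + 2)"
proof -
  have 2: "rho (-2) = 2" "rho (-4) = 4" by (simp_all add: rho_def)
  show *: "2 * rho j = rho (j - 2)" for j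
    using rho_add[of j "-2"] 2 by (simp add: mult.commute)
  show "4 * rho j = rho (j - 4)"
    using rho_add[of j "-4"] 2 by (simp add: mult.commute)
  have "rho j = rho (j + 2) * 2" using *[of "j + 2"] by (simp add: mult.commute)
  also have "\<dots> / 2 = rho (j + 2)" by (intro ennreal_mult_divide_eq) auto
  finally show "rho j / 2 = rho (j + 2)" .
qed

lemma rho_ex:
  assumes "0 < a" "a < top"
  obtains j where "rho (j + 1) \<le> a" "a < rho j"
proof -
  obtain c where c: "a = ennreal c" "0 < c" using assms by (cases a) auto
  define j where "j = \<lceil>- 2 * log 2 c\<rceil> - 1"
  have j: "real_of_int j < - 2 * log 2 c" "- 2 * log 2 c \<le> real_of_int j + 1"
    unfolding j_def by linarith+
  have "2 powr (- (j + 1) / 2) \<le> 2 powr (log 2 c)" "2 powr (log 2 c) < 2 powr (- j / 2)"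
    using j by (auto simp: field_simps)
  then show thesis
    using c by (intro that[of j]) (auto simp: rho_def ennreal_less_iff)
qed

text \<open>Series over the integers as integrals for the counting measure: no order of summation is
  involved, index shifts are bijections, and the exchange with another integral is Tonelli's
  theorem.\<close>

abbreviation zsum :: "(int \<Rightarrow> ennreal) \<Rightarrow> ennreal" where
  "zsum f \<equiv> integral\<^sup>N (count_space UNIV) f"

lemma zsum_shift: "zsum (\<lambda>j. f (j + n)) = zsum f"
proof -
  have "bij (\<lambda>j::int. j + n)" by (rule bij_betw_byWitness[of _ "\<lambda>j. j - n"]) auto
  then show ?thesis by (rule nn_integral_bij_count_space)
qed

lemma zsum_mono: "(\<And>j. f j \<le> g j) \<Longrightarrow> zsum f \<le> zsum g"
  by (rule nn_integral_mono) simp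

lemma zsum_cmult: "zsum (\<lambda>j. c * f j) = c * zsum f"
  by (rule nn_integral_cmult) simp

lemma zsum_add: "zsum (\<lambda>j. f j + g j) = zsum f + zsum g"
  by (rule nn_integral_add) simp_all

lemma zsum_single: "zsum (\<lambda>j. f j * indicator {a} j) = f a"
  by (subst nn_integral_indicator_singleton) simp_all

lemma zsum_le: "f j \<le> zsum f"
proof -
  have "f j = zsum (\<lambda>i. f i * indicator {j} i)" by (rule zsum_single[symmetric])
  also have "\<dots> \<le> zsum f" by (intro zsum_mono) (auto simp: indicator_def)
  finally show ?thesis .
qed

lemma zsum_nn_integral:
  "(\<And>j. (\<lambda>x. f j x) \<in> borel_measurable M) \<Longrightarrow> (\<integral>\<^sup>+x. zsum (\<lambda>j. f j x) \<partial>M) = zsum (\<lambda>j. \<integral>\<^sup>+x. f j x \<partial>M)"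
  by (rule nn_integral_count_space_nn_integral) auto

text \<open>Monotone convergence along the symmetric intervals, which exhaust the integers.\<close>

lemma zsum_least:
  assumes "\<And>J. finite J \<Longrightarrow> sum f J \<le> B"
  shows "zsum f \<le> B"
proof -
  have "zsum f = zsum (\<lambda>j. SUP n::nat. f j * indicator {- int n..int n} j)"
  proof (intro nn_integral_cong antisym)
    fix j :: int
    have "f j = f j * indicator {- int (nat \<bar>j\<bar>)..int (nat \<bar>j\<bar>)} j"
      by (simp add: indicator_def) linarith
    also have "\<dots> \<le> (SUP n::nat. f j * indicator {- int n..int n} j)" by (rule SUP_upper) simp
    finally show "f j \<le> (SUP n::nat. f j * indicator {- int n..int n} j)" .
  qed (auto intro!: SUP_least simp: indicator_def)
  also have "\<dots> = (SUP n::nat. zsum (\<lambda>j. f j * indicator {- int n..int n} j))"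
    by (intro nn_integral_monotone_convergence_SUP)
       (auto simp: incseq_def le_fun_def indicator_def)
  also have "\<dots> \<le> B"
  proof (intro SUP_least)
    fix n :: nat
    have "zsum (\<lambda>j. f j * indicator {- int n..int n} j) = sum f {- int n..int n}"
      by (subst nn_integral_indicator_finite) auto
    then show "zsum (\<lambda>j. f j * indicator {- int n..int n} j) \<le> B"
      using assms by simp
  qed
  finally show ?thesis .
qed

section \<open>The tail of \<open>u\<close>, its generalised inverse and the grid\<close>

locale decay_weight =
  fixes u :: "real \<Rightarrow> ennreal"
  assumes u [measurable]: "u \<in> measurable_nonneg"
    and tail_pos_finite: "\<And>t. 0 < t \<Longrightarrow> 0 < tail u t \<and> tail u t < \<infinity>"
begin

lemma tail_hl: "0 \<le> t \<Longrightarrow> tail u t = (\<integral>\<^sup>+x. u x * indicator {t..} x \<partial>hl)"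
  unfolding tail_def by (rule nn_set_integral_hl) auto

lemma tail_measure: "0 \<le> t \<Longrightarrow> tail u t = emeasure (density hl u) ({0..} \<inter> {t..})"
  by (subst emeasure_density)
     (auto simp: tail_hl sets_restrict_space intro!: nn_integral_cong split: split_indicator)

lemma tail_antimono: "s \<le> t \<Longrightarrow> tail u t \<le> tail u s"
  unfolding tail_def by (intro nn_integral_mono) (auto simp: indicator_def)

lemma tail_pos: "0 < tail u t"
  using tail_pos_finite[of "max t 1"] tail_antimono[of t "max t 1"] by (auto simp: less_max_iff_disj intro: less_le_trans)

lemma tail_finite: "0 < t \<Longrightarrow> tail u t < top"
  using tail_pos_finite by simp

lemma sets_hl_I: "A \<in> sets borel \<Longrightarrow> {0..} \<inter> A \<in> sets hl"
  by (auto simp: sets_restrict_space)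

text \<open>Left-continuity of the tail: continuity of the measure from above, available since the
  tails at the positive points \<open>s n\<close> are finite.\<close>

lemma tail_limit_left:
  assumes "incseq s" "\<And>n. 0 < s n" "s \<longlonglongrightarrow> t" "\<And>n. a \<le> tail u (s n)"
  shows "a \<le> tail u t"
proof -
  have st: "s n \<le> t" for n using assms by (intro incseq_le)
  then have "0 \<le> t" using assms(2) by (meson less_imp_le order_trans)
  have "(INF n. emeasure (density hl u) ({0..} \<inter> {s n..})) = emeasure (density hl u) (\<Inter>n. {0..} \<inter> {s n..})"
  proof (rule INF_emeasure_decseq)
    show "emeasure (density hl u) ({0..} \<inter> {s n..}) \<noteq> \<infinity>" for n
      using tail_finite[OF assms(2)[of n]] tail_measure[of "s n"] assms(2)[of n] by simp
    show "decseq (\<lambda>n. {0..} \<inter> {s n..})"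
      using assms(1) by (auto simp: decseq_def incseq_def intro: order_trans)
    show "range (\<lambda>n. {0..} \<inter> {s n..}) \<subseteq> sets (density hl u)"
      by (intro image_subsetI) (simp only: sets_density, rule sets_hl_I, simp)
  qed
  also have "(\<Inter>n. {0..} \<inter> {s n..}) = {0..} \<inter> {t..}"
    using assms(3) st by (auto intro: LIMSEQ_le_const2 order_trans)
  finally have "(INF n. tail u (s n)) = tail u t"
    using assms(2) \<open>0 \<le> t\<close> by (simp add: tail_measure less_imp_le)
  moreover have "a \<le> (INF n. tail u (s n))" using assms(4) by (rule INF_greatest)
  ultimately show ?thesis by simp
qed

text \<open>Monotone convergence, the point \<open>t\<close> being a null set. No finiteness is
  used, so \<open>t = 0\<close> is allowed although the tail may be infinite there.\<close>

lemma tail_limit_right: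
  assumes "decseq s" "s \<longlonglongrightarrow> t" "\<And>n. t < s n" "\<And>n. tail u (s n) \<le> a" "0 \<le> t"
  shows "tail u t \<le> a"
proof -
  have "tail u t = (\<integral>\<^sup>+x. u x * indicator {t..} x \<partial>hl)" using \<open>0 \<le> t\<close> by (rule tail_hl)
  also have "\<dots> = (\<integral>\<^sup>+x. (SUP n. u x * indicator {s n..} x) \<partial>hl)"
  proof (rule nn_integral_cong_AE)
    show "AE x in hl. u x * indicator {t..} x = (SUP n. u x * indicator {s n..} x)"
      using AE_hl_neq[of t]
    proof eventually_elim
      case (elim x)
      show ?case
      proof (cases "t < x")
        case True
        then obtain n where "s n < x"
          using order_tendstoD(2)[OF assms(2), of x] by (auto simp: eventually_sequentially)
        then have "u x * indicator {t..} x \<le> u x * indicator {s n..} x" by (simp add: indicator_def)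
        also have "\<dots> \<le> (SUP n. u x * indicator {s n..} x)" by (rule SUP_upper) simp
        finally show ?thesis
          using True by (intro antisym SUP_least) (auto simp: indicator_def)
      next
        case False
        then have "x < s n" for n using elim assms(3)[of n] by auto
        then have "\<not> s n \<le> x" for n by (simp add: not_le)
        with False elim show ?thesis by (simp add: indicator_def)
      qed
    qed
  qed
  also have "\<dots> = (SUP n. \<integral>\<^sup>+x. u x * indicator {s n..} x \<partial>hl)"
  proof (rule nn_integral_monotone_convergence_SUP)
    show "incseq (\<lambda>n x. u x * indicator {s n..} x)"
      using assms(1) by (auto simp: incseq_def decseq_def le_fun_def indicator_def intro: order_trans)
  qed measurable
  also have "\<dots> \<le> a"
    using assms(3-5) by (intro SUP_least) (metis less_imp_le order_trans tail_hl)
  finally show ?thesis .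
qed

lemma tail_small: 
  assumes "0 < a"
  shows "\<exists>B. \<forall>y\<ge>B. tail u y < a"
proof -
  have "(INF n. emeasure (density hl u) ({0..} \<inter> {1 + real n..})) = emeasure (density hl u) (\<Inter>n. {0..} \<inter> {1 + real n..})"
  proof (rule INF_emeasure_decseq)
    show "emeasure (density hl u) ({0..} \<inter> {1 + real n..}) \<noteq> \<infinity>" for n
      using tail_finite[of "1 + real n"] tail_measure[of "1 + real n"] by simp
    show "decseq (\<lambda>n. {0..} \<inter> {1 + real n..})"
      by (auto simp: decseq_def)
    show "range (\<lambda>n. {0..} \<inter> {1 + real n..}) \<subseteq> sets (density hl u)"
      by (intro image_subsetI) (simp only: sets_density, rule sets_hl_I, simp)
  qed
  also have "(\<Inter>n. {0..} \<inter> {1 + real n..}) = {}"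
  proof safe
    fix x assume x: "x \<in> (\<Inter>n. {0..} \<inter> {1 + real n..})"
    obtain n where "x < real n" using reals_Archimedean2 by auto
    with x show "x \<in> {}" by (auto dest!: spec[of _ n])
  qed
  finally have "(INF n. tail u (1 + real n)) < a"
    using assms by (simp add: tail_measure)
  then obtain n where "tail u (1 + real n) < a" by (auto simp: INF_less_iff)
  then show ?thesis by (meson tail_antimono le_less_trans)
qed

lemma tau_bdd:
  assumes "0 < a"
  shows "bdd_above (insert 0 {y. 0 < y \<and> a \<le> tail u y})"
proof -
  obtain B where "\<And>y. B \<le> y \<Longrightarrow> tail u y < a"
    using tail_small[OF assms] by auto
  then have "y \<le> max B 0" if "y \<in> insert 0 {y. 0 < y \<and> a \<le> tail u y}" for y
    using that by (cases "B \<le> y") (auto simp: not_less[symmetric])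
  then show ?thesis by (rule bdd_aboveI)
qed

lemma tau_nonneg: "0 < a \<Longrightarrow> 0 \<le> tau u a"
  unfolding tau_def by (rule cSup_upper) (auto dest: tau_bdd)

text \<open>The supremum defining \<open>tau\<close> is attained when positive, because the tail is
  left-continuous. Hence \<open>tau u\<close> and the tail form a Galois connection, through which
  all later facts on the grid and on \<open>zeta\<close> are read off.\<close>

lemma le_tau_iff:
  assumes "0 < a" "0 < y"
  shows "y \<le> tau u a \<longleftrightarrow> a \<le> tail u y"
proof
  assume "a \<le> tail u y"
  then show "y \<le> tau u a"
    unfolding tau_def using assms by (intro cSup_upper) (auto dest: tau_bdd)
next
  assume "y \<le> tau u a"
  let ?A = "insert 0 {y. 0 < y \<and> a \<le> tail u y}"
  have pos: "0 < tau u a" using \<open>y \<le> tau u a\<close> \<open>0 < y\<close> by simp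
  have *: "a \<le> tail u t" if t: "0 < t" "t < tau u a" for t
  proof -
    have "?A \<noteq> {}" by simp
    then obtain z where "t < z" "z \<in> ?A"
      using less_cSup_iff[OF _ tau_bdd[OF assms(1)], of t] t(2) unfolding tau_def by metis
    then have "a \<le> tail u z" "t \<le> z" using t(1) by auto
    then show ?thesis using tail_antimono[of t z] by (simp add: order_trans)
  qed
  have "a \<le> tail u (tau u a)"
  proof (rule tail_limit_left)
    \<comment> \<open>The factor \<open>1 / 2\<close> keeps the whole sequence in the open interval
      between \<open>0\<close> and \<open>tau u a\<close>.\<close>
    let ?s = "\<lambda>n. tau u a - tau u a / 2 * (1 / 2) ^ n"
    show "incseq ?s"
      using pos by (auto simp: incseq_def intro!: mult_left_mono power_decreasing)
    show "?s \<longlonglongrightarrow> tau u a"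
      by (auto intro!: tendsto_eq_intros LIMSEQ_power_zero)
    show "0 < ?s n" for n
    proof -
      have "(1 / 2) ^ n \<le> (1::real)" by (simp add: power_le_one)
      then have "tau u a / 2 * (1 / 2) ^ n \<le> tau u a / 2 * 1" using pos by (intro mult_left_mono) auto
      then show ?thesis using pos by simp
    qed
    then show "a \<le> tail u (?s n)" for n using pos by (intro *) auto
  qed
  then show "a \<le> tail u y" using tail_antimono[OF \<open>y \<le> tau u a\<close>] by (rule order_trans)
qed

lemma tau_le_iff:
  assumes "0 < a" "0 < y"
  shows "tau u a < y \<longleftrightarrow> tail u y < a"
  using le_tau_iff[OF assms] by auto

lemma tau_antimono:
  assumes "0 < a" "a \<le> b"
  shows "tau u b \<le> tau u a"
  unfolding tau_def using assms tau_bdd[OF assms(1)]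
  by (intro cSup_subset_mono) (auto intro: order_trans)

text \<open>Approach from the right, where the Galois connection bounds the tail by
  \<open>a\<close>. At \<open>tau u a = 0\<close> the inequality may be strict: the total mass may
  be below \<open>a\<close>.\<close>

lemma tail_tau_le: 
  assumes "0 < a"
  shows "tail u (tau u a) \<le> a"
proof (rule tail_limit_right)
  let ?s = "\<lambda>n. tau u a + (1 / 2) ^ n"
  show "decseq ?s" by (auto simp: decseq_def intro!: power_decreasing)
  show "?s \<longlonglongrightarrow> tau u a" by (auto intro!: tendsto_eq_intros LIMSEQ_power_zero)
  show "tau u a < ?s n" for n by simp
  have "0 < ?s n" for n using tau_nonneg[OF assms] by (intro add_nonneg_pos) auto
  then show "tail u (?s n) \<le> a" for n 
    using tau_le_iff[OF assms, of "?s n"] by simp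
  show "0 \<le> tau u a" using assms by (rule tau_nonneg)
qed

lemma tail_tau:
  assumes "0 < a" "0 < tau u a"
  shows "tail u (tau u a) = a"
  using tail_tau_le[OF assms(1)] le_tau_iff[OF assms] by simp

text \<open>If the total mass of \<open>u\<close> is finite, then \<open>grid j = 0\<close> as soon
  as \<open>rho j\<close> exceeds it. Blocks with \<open>grid (j + 1) = 0\<close> are then empty,
  which is why this case recurs below.\<close>

definition grid :: "int \<Rightarrow> real" where
  "grid j = tau u (rho j)"

definition block :: "int \<Rightarrow> real set" where
  "block j = {grid j<..grid (j + 1)}"

lemma grid_nonneg: "0 \<le> grid j"
  unfolding grid_def by (rule tau_nonneg) simp

lemma grid_mono: "i \<le> j \<Longrightarrow> grid i \<le> grid j"
  unfolding grid_def by (intro tau_antimono rho_mono) auto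

lemma tail_grid: "0 < grid j \<Longrightarrow> tail u (grid j) = rho j"
  unfolding grid_def by (rule tail_tau) auto

lemma tail_grid_le: "tail u (grid j) \<le> rho j"
  unfolding grid_def by (rule tail_tau_le) auto

lemma block_pos: "y \<in> block j \<Longrightarrow> 0 < y"
  using grid_nonneg[of j] by (auto simp: block_def)

lemma block_iff: "0 < y \<Longrightarrow> y \<in> block j \<longleftrightarrow> rho (j + 1) \<le> tail u y \<and> tail u y < rho j"
  by (auto simp: block_def grid_def le_tau_iff tau_le_iff)

lemma blockD: "y \<in> block j \<Longrightarrow> rho (j + 1) \<le> tail u y \<and> tail u y < rho j"
  using block_iff block_pos by blast

lemma block_ex: "0 < y \<Longrightarrow> \<exists>j. y \<in> block j"
  using rho_ex[OF tail_pos tail_finite] block_iff by metis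

lemma block_inj: "y \<in> block i \<Longrightarrow> y \<in> block j \<Longrightarrow> i = j"
proof (induction i j rule: linorder_wlog)
  case (le i j)
  show ?case
  proof (rule ccontr)
    assume "i \<noteq> j"
    then have "grid (i + 1) \<le> grid j" using le(1) by (intro grid_mono) auto
    with le(2,3) show False by (auto simp: block_def)
  qed
qed auto

lemma block_measurable [measurable, simp]: "block j \<in> sets borel"
  by (simp add: block_def)

lemma zeta_inv_nonneg: "0 \<le> zeta_inv u x"
  unfolding zeta_inv_eq_tau using tail_pos[of x] by (intro tau_nonneg) (simp add: ennreal_zero_less_mult_iff)

text \<open>Where \<open>zeta_inv\<close> is positive it doubles the tail exactly, so applying it
  twice quadruples the tail. Where it is \<open>0\<close>, it stays \<open>0\<close> at the second
  application, and the right-hand side is \<open>0\<close> by monotonicity of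
  \<open>tau\<close>.\<close>

lemma zeta_inv2_eq:
  assumes "0 < y"
  shows "zeta_inv2 u y = tau u (4 * tail u y)"
proof (cases "0 < zeta_inv u y")
  case True
  have "tail u (zeta_inv u y) = 2 * tail u y"
    unfolding zeta_inv_eq_tau
    by (rule tail_tau) (use True tail_pos[of y] in \<open>auto simp: zeta_inv_eq_tau ennreal_zero_less_mult_iff\<close>)
  then show ?thesis by (simp add: zeta_inv2_def zeta_inv_eq_tau[of u "zeta_inv u y"] mult.assoc[symmetric])
next
  case False
  then have 0: "zeta_inv u y = 0" using zeta_inv_nonneg[of y] by simp
  have p: "0 < 2 * tail u y" "0 < 2 * tail u 0" 
    using tail_pos[of y] tail_pos[of 0] by (auto simp: ennreal_zero_less_mult_iff)
  \<comment> \<open>A positive value would be a point whose tail is finite and twice the total mass,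
    while being at most the total mass.\<close>
  have "tau u (2 * tail u 0) = 0"
  proof (rule ccontr)
    assume "tau u (2 * tail u 0) \<noteq> 0"
    then have pos: "0 < tau u (2 * tail u 0)" using tau_nonneg[OF p(2)] by simp
    define z where "z = tau u (2 * tail u 0)"
    have z: "0 < z" "tail u z = 2 * tail u 0" unfolding z_def by (auto intro!: tail_tau pos p)
    have "tail u z \<le> tail u 0" using z by (intro tail_antimono) auto
    then have le: "2 * tail u 0 \<le> tail u 0" using z(2) by simp
    have "tail u 0 < top"
      using z(2) tail_finite[OF z(1)] by (auto simp: ennreal_mult_less_top)
    then obtain t where "tail u 0 = ennreal t" "0 \<le> t" by (cases "tail u 0") auto
    with le have "2 * t \<le> t" "0 < t"
      using tail_pos[of 0] by (simp_all flip: ennreal_numeral ennreal_mult)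
    then show False by simp
  qed
  moreover have "tau u (4 * tail u y) \<le> tau u (2 * tail u y)"
    using p by (intro tau_antimono) (auto intro!: mult_right_mono)
  moreover have "0 \<le> tau u (4 * tail u y)"
    using tail_pos[of y] by (intro tau_nonneg) (auto simp: ennreal_zero_less_mult_iff)
  ultimately show ?thesis
    using 0 by (simp add: zeta_inv2_def zeta_inv_eq_tau)
qed

text \<open>Doubling the tail moves two grid steps and quadrupling four; the uncertainty of one step
  inside a block accounts for the odd shifts here and in the bounds on \<open>zeta_inv\<close>,
  \<open>zeta_inv2\<close> and \<open>zeta\<close> that follow.\<close>

lemma block_scaled:
  assumes "y \<in> block j"
  shows "rho (j - 1) \<le> 2 * tail u y" "rho (j - 3) \<le> 4 * tail u y" "4 * tail u y \<le> rho (j - 4)"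
    "rho (j + 3) \<le> tail u y / 2" "0 < 4 * tail u y"
proof -
  have b: "rho (j + 1) \<le> tail u y" "tail u y \<le> rho j"
    using blockD[OF assms] by auto
  show "rho (j - 1) \<le> 2 * tail u y"
    using mult_left_mono[OF b(1), of 2] rho_numeral(1)[of "j + 1"] by simp
  show "rho (j - 3) \<le> 4 * tail u y"
    using mult_left_mono[OF b(1), of 4] rho_numeral(2)[of "j + 1"] by simp
  show "4 * tail u y \<le> rho (j - 4)"
    using mult_left_mono[OF b(2), of 4] rho_numeral(2)[of j] by simp
  show "rho (j + 3) \<le> tail u y / 2"
    using divide_right_mono_ennreal[OF b(1), of 2] rho_numeral(3)[of "j + 1"] by (simp add: add.commute)
  show "0 < 4 * tail u y"
    using tail_pos[of y] by (simp add: ennreal_zero_less_mult_iff)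
qed

lemma zeta_inv_le: "y \<in> block j \<Longrightarrow> zeta_inv u y \<le> grid (j - 1)"
  unfolding zeta_inv_eq_tau grid_def by (intro tau_antimono block_scaled) simp

lemma zeta_inv2_le: "y \<in> block j \<Longrightarrow> zeta_inv2 u y \<le> grid (j - 3)"
  unfolding zeta_inv2_eq[OF block_pos] grid_def by (intro tau_antimono block_scaled) simp

lemma zeta_inv2_ge: "y \<in> block j \<Longrightarrow> grid (j - 4) \<le> zeta_inv2 u y"
  unfolding zeta_inv2_eq[OF block_pos] grid_def by (intro tau_antimono block_scaled(3,5))

lemma zeta_le: "y \<in> block j \<Longrightarrow> zeta u y \<le> grid (j + 3)"
  unfolding zeta_eq_tau grid_def by (intro tau_antimono block_scaled) simp

lemma zeta_ge:
  assumes "0 < y"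
  shows "y \<le> zeta u y"
proof -
  have "tail u y / 2 \<le> tail u y"
    by (intro divide_le_posI_ennreal) (auto simp: mult_2_right mult.commute[of 2])
  moreover have "0 < tail u y / 2"
    using tail_pos[of y] by (simp add: ennreal_zero_less_divide)
  ultimately show ?thesis
    unfolding zeta_eq_tau using assms by (subst le_tau_iff) auto
qed

section \<open>Mass of the blocks, and integrals against \<open>u\<close> as weighted sums\<close>

lemma block_mass_le: "(\<integral>\<^sup>+x. u x * indicator (block j) x \<partial>hl) \<le> rho j"
proof -
  have "(\<integral>\<^sup>+x. u x * indicator (block j) x \<partial>hl) \<le> tail u (grid j)"
    by (subst tail_hl[OF grid_nonneg]) (auto intro!: nn_integral_mono simp: block_def indicator_def)
  then show ?thesis using tail_grid_le by (rule order_trans)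
qed

text \<open>The block carries at least the difference of the levels \<open>rho j\<close> and
  \<open>rho (j + 1)\<close>. Their ratio, one over the square root of two, is at most
  \<open>3/4\<close> because \<open>(4/3)\<^sup>2 \<le> 2\<close>, and this yields the factor
  \<open>4\<close>.\<close>

lemma block_mass_ge:
  assumes "0 < grid j"
  shows "rho j \<le> 4 * (\<integral>\<^sup>+x. u x * indicator (block j) x \<partial>hl)"
proof -
  let ?m = "\<integral>\<^sup>+x. u x * indicator (block j) x \<partial>hl"
  have "rho j = (\<integral>\<^sup>+x. u x * indicator {grid j..} x \<partial>hl)"
    using assms tail_hl[OF grid_nonneg, of j] by (simp add: tail_grid)
  also have "\<dots> \<le> (\<integral>\<^sup>+x. u x * indicator (block j) x + u x * indicator {grid (j + 1)..} x \<partial>hl)"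
    using AE_hl_neq[of "grid j"]
    by (intro nn_integral_mono_AE) (auto elim!: eventually_mono simp: block_def indicator_def)
  also have "\<dots> = ?m + tail u (grid (j + 1))"
    by (subst nn_integral_add) (auto simp: tail_hl[OF grid_nonneg])
  also have "\<dots> \<le> ?m + rho (j + 1)"
    by (intro add_left_mono tail_grid_le)
  finally have *: "rho j \<le> ?m + rho (j + 1)" .
  have "2 powr (- 1 / 2) \<le> (3/4 :: real)"
    using real_le_rsqrt[of "4/3" 2] by (simp add: powr_minus powr_half_sqrt real_sqrt_divide field_simps power2_eq_square)
  moreover have "2 powr (- real_of_int (j + 1) / 2) = 2 powr (- 1 / 2) * 2 powr (- real_of_int j / 2)"
    by (simp add: powr_add[symmetric] field_simps)
  ultimately have le: "2 powr (- real_of_int (j + 1) / 2) \<le> 3/4 * 2 powr (- real_of_int j / 2)"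
    by (simp add: mult_right_mono)
  obtain m where m: "?m = ennreal m" "0 \<le> m"
    using block_mass_le[of j] by (cases ?m) (auto simp: top_unique)
  have "2 powr (- real_of_int j / 2) \<le> m + 2 powr (- real_of_int (j + 1) / 2)"
    using * m by (simp add: rho_def ennreal_plus[symmetric] del: ennreal_plus)
  then have "2 powr (- real_of_int j / 2) \<le> 4 * m" using le by linarith
  then show ?thesis
    using m by (simp add: rho_def ennreal_leI flip: ennreal_numeral ennreal_mult)
qed

text \<open>On block \<open>j + n\<close> the step with value \<open>c j\<close> lies below
  \<open>g\<close>, so \<open>g\<close> may be non-measurable, as befits the operator norms in
  \<open>A_2\<close>. The factor \<open>4\<close> is that of \<open>block_mass_ge\<close>, and
  \<open>2 powr (n / 2)\<close> pays for the shift. If \<open>grid (j + 1) > 0\<close>, then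
  \<open>n \<ge> 1\<close> makes \<open>grid (j + n)\<close> positive, as the mass bound
  requires.\<close>

lemma step_sum_le:
  assumes "1 \<le> n" "\<And>j y. y \<in> block (j + n) \<Longrightarrow> c j \<le> g y" "\<And>j. grid (j + 1) = 0 \<Longrightarrow> c j = 0"
  shows "zsum (\<lambda>j. rho j * c j) \<le> ennreal (4 * 2 powr (n / 2)) * (\<integral>\<^sup>+y. u y * g y \<partial>hl)"
proof -
  have rn: "rho j = ennreal (2 powr (n / 2)) * rho (j + n)" for j
    by (simp add: rho_def powr_add[symmetric] add_divide_distrib diff_divide_distrib flip: ennreal_mult)
  let ?K = "ennreal (4 * 2 powr (n / 2))"
  have "zsum (\<lambda>j. rho j * c j) \<le> zsum (\<lambda>j. ?K * (\<integral>\<^sup>+y. c j * (u y * indicator (block (j + n)) y) \<partial>hl))"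
  proof (intro zsum_mono)
    fix j
    show "rho j * c j \<le> ?K * (\<integral>\<^sup>+y. c j * (u y * indicator (block (j + n)) y) \<partial>hl)"
    proof (cases "grid (j + 1) = 0")
      case False
      then have "0 < grid (j + n)"
        using grid_nonneg[of "j + 1"] grid_mono[of "j + 1" "j + n"] assms(1) by auto
      then have "rho j * c j \<le> ennreal (2 powr (n / 2)) * (4 * (\<integral>\<^sup>+x. u x * indicator (block (j + n)) x \<partial>hl)) * c j"
        unfolding rn[of j] by (intro mult_right_mono mult_left_mono block_mass_ge) auto
      also have "\<dots> = ?K * (\<integral>\<^sup>+y. c j * (u y * indicator (block (j + n)) y) \<partial>hl)"
        by (subst nn_integral_cmult) (auto simp: ennreal_mult mult_ac)
      finally show ?thesis .
    qed (simp add: assms(3))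
  qed
  also have "\<dots> = ?K * zsum (\<lambda>j. \<integral>\<^sup>+y. c j * (u y * indicator (block (j + n)) y) \<partial>hl)"
    by (rule zsum_cmult)
  also have "zsum (\<lambda>j. \<integral>\<^sup>+y. c j * (u y * indicator (block (j + n)) y) \<partial>hl)
      = (\<integral>\<^sup>+y. zsum (\<lambda>j. c j * (u y * indicator (block (j + n)) y)) \<partial>hl)"
    by (rule zsum_nn_integral[symmetric]) measurable
  also have "\<dots> \<le> (\<integral>\<^sup>+y. u y * g y \<partial>hl)"
  proof (intro nn_integral_mono)
    fix y assume "y \<in> space hl"
    show "zsum (\<lambda>j. c j * (u y * indicator (block (j + n)) y)) \<le> u y * g y"
    proof (cases "\<exists>m. y \<in> block m")
      case True
      then obtain m where m: "y \<in> block m" by auto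
      have "zsum (\<lambda>j. c j * (u y * indicator (block (j + n)) y)) \<le> zsum (\<lambda>j. (u y * g y) * indicator {m - n} j)"
      proof (intro zsum_mono)
        fix j show "c j * (u y * indicator (block (j + n)) y) \<le> (u y * g y) * indicator {m - n} j"
        proof (cases "y \<in> block (j + n)")
          case True
          then have "j = m - n" "c j * u y \<le> u y * g y"
            using block_inj[OF m True] assms(2)[of y j] by (auto simp: mult.commute[of "c j"] mult_left_mono)
          then show ?thesis using True by simp
        qed simp
      qed
      also have "\<dots> = u y * g y" by (rule zsum_single)
      finally show ?thesis .
    next
      case False
      then show ?thesis by simp
    qed
  qed
  finally show ?thesis by (simp add: mult_left_mono)
qed

text \<open>The converse comparison: the blocks cover all positive points and have mass at most
  \<open>rho j\<close>.\<close>

lemma step_sum_ge: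
  assumes "\<And>j y. y \<in> block j \<Longrightarrow> g y \<le> c j"
  shows "(\<integral>\<^sup>+y. u y * g y \<partial>hl) \<le> zsum (\<lambda>j. rho j * c j)"
proof -
  have "(\<integral>\<^sup>+y. u y * g y \<partial>hl) \<le> (\<integral>\<^sup>+y. zsum (\<lambda>j. c j * (u y * indicator (block j) y)) \<partial>hl)"
  proof (rule nn_integral_mono_AE)
    show "AE y in hl. u y * g y \<le> zsum (\<lambda>j. c j * (u y * indicator (block j) y))"
      using AE_hl_neq[of 0] AE_space
    proof eventually_elim
      case (elim y)
      then obtain j where j: "y \<in> block j" using block_ex[of y] by auto
      then have "u y * g y \<le> c j * (u y * indicator (block j) y)"
        using assms[OF j] by (simp add: mult.commute mult_right_mono)
      also have "\<dots> \<le> zsum (\<lambda>j. c j * (u y * indicator (block j) y))" by (rule zsum_le)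
      finally show ?case .
    qed
  qed
  also have "\<dots> = zsum (\<lambda>j. \<integral>\<^sup>+y. c j * (u y * indicator (block j) y) \<partial>hl)"
    by (rule zsum_nn_integral) measurable
  also have "\<dots> \<le> zsum (\<lambda>j. rho j * c j)"
  proof (intro zsum_mono)
    fix j
    have "(\<integral>\<^sup>+y. c j * (u y * indicator (block j) y) \<partial>hl) = c j * (\<integral>\<^sup>+y. u y * indicator (block j) y \<partial>hl)"
      by (rule nn_integral_cmult) measurable
    also have "\<dots> \<le> c j * rho j" by (intro mult_left_mono block_mass_le) simp
    finally show "(\<integral>\<^sup>+y. c j * (u y * indicator (block j) y) \<partial>hl) \<le> rho j * c j" by (simp add: mult.commute)
  qed
  finally show ?thesis .
qed

lemma zsum_block_le:
  assumes [measurable]: "g \<in> borel_measurable hl"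
  shows "zsum (\<lambda>j. \<integral>\<^sup>+y. g y * indicator (block j) y \<partial>hl) \<le> (\<integral>\<^sup>+y. g y \<partial>hl)"
proof -
  have "zsum (\<lambda>j. \<integral>\<^sup>+y. g y * indicator (block j) y \<partial>hl) = (\<integral>\<^sup>+y. zsum (\<lambda>j. g y * indicator (block j) y) \<partial>hl)"
    by (rule zsum_nn_integral[symmetric]) measurable
  also have "\<dots> \<le> (\<integral>\<^sup>+y. g y \<partial>hl)"
  proof (intro nn_integral_mono)
    fix y
    show "zsum (\<lambda>j. g y * indicator (block j) y) \<le> g y"
    proof (cases "\<exists>m. y \<in> block m")
      case True
      then obtain m where m: "y \<in> block m" by auto
      have "zsum (\<lambda>j. g y * indicator (block j) y) \<le> zsum (\<lambda>j. g y * indicator {m} j)"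
      proof (intro zsum_mono)
        fix j show "g y * indicator (block j) y \<le> g y * indicator {m} j"
        proof (cases "y \<in> block j")
          case True
          then have "j = m" using block_inj[OF m True] by simp
          then show ?thesis by (simp add: indicator_def)
        qed simp
      qed
      also have "\<dots> = g y" by (rule zsum_single)
      finally show ?thesis .
    qed simp
  qed
  finally show ?thesis .
qed

text \<open>Each interval is a union of three consecutive blocks, so the overlap is at most
  three.\<close>

lemma zsum_wide_block_le:
  assumes [measurable]: "g \<in> borel_measurable hl"
  shows "zsum (\<lambda>j. \<integral>\<^sup>+y. g y * indicator {grid (j - 2)<..grid (j + 1)} y \<partial>hl) \<le> 3 * (\<integral>\<^sup>+y. g y \<partial>hl)"
proof -
  let ?b = "\<lambda>j. \<integral>\<^sup>+y. g y * indicator (block j) y \<partial>hl"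
  have "zsum (\<lambda>j. \<integral>\<^sup>+y. g y * indicator {grid (j - 2)<..grid (j + 1)} y \<partial>hl) \<le> zsum (\<lambda>j. ?b (j + -2) + (?b (j + -1) + ?b j))"
  proof (intro zsum_mono)
    fix j
    have "(\<integral>\<^sup>+y. g y * indicator {grid (j - 2)<..grid (j + 1)} y \<partial>hl)
      \<le> (\<integral>\<^sup>+y. g y * indicator (block (j + -2)) y + (g y * indicator (block (j + -1)) y + g y * indicator (block j) y) \<partial>hl)"
      by (intro nn_integral_mono) (auto simp: block_def indicator_def)
    then show "(\<integral>\<^sup>+y. g y * indicator {grid (j - 2)<..grid (j + 1)} y \<partial>hl) \<le> ?b (j + -2) + (?b (j + -1) + ?b j)"
      by (subst (asm) nn_integral_add, measurable, subst (asm) nn_integral_add, measurable)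
  qed
  also have "\<dots> = zsum ?b + (zsum ?b + zsum ?b)"
    using zsum_shift[of ?b "-2"] zsum_shift[of ?b "-1"] by (simp add: zsum_add)
  also have "\<dots> = (1 + (1 + 1)) * zsum ?b" by (simp only: distrib_right mult_1)
  also have "\<dots> = 3 * zsum ?b" by simp
  also have "\<dots> \<le> 3 * (\<integral>\<^sup>+y. g y \<partial>hl)"
    by (intro mult_left_mono zsum_block_le) auto
  finally show ?thesis .
qed

end

section \<open>Lower bounds\<close>

text \<open>Superlevel sets of a monotone function are intervals. This serves to make
  \<open>Sf f\<close> measurable.\<close>

lemma borel_measurable_mono_ennreal:
  fixes f :: "real \<Rightarrow> ennreal"
  assumes "mono f"
  shows "f \<in> borel_measurable borel"
proof (rule borel_measurableI_greater)
  fix a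
  have "is_interval {x. a < f x}"
    unfolding is_interval_1 using assms by (auto simp: mono_def intro: less_le_trans)
  then show "{x \<in> space borel. a < f x} \<in> sets borel"
    by (simp add: real_interval_borel_measurable)
qed

lemma least_const_cong:
  assumes "\<And>f. f \<in> measurable_nonneg \<Longrightarrow> \<Phi> f = \<Psi> f"
  shows "least_const p v \<Phi> = least_const p v \<Psi>"
  using assms by (intro antisym least_const_mono) auto

lemma nn_integral_epowr_cmult:
  assumes [measurable]: "u \<in> borel_measurable hl" "g \<in> borel_measurable hl" and "0 < r"
  shows "(\<integral>\<^sup>+x. u x * (c * g x) epowr r \<partial>hl) epowr (1 / r) = c * (\<integral>\<^sup>+x. u x * g x epowr r \<partial>hl) epowr (1 / r)"
proof -
  have "(\<integral>\<^sup>+x. u x * (c * g x) epowr r \<partial>hl) = (\<integral>\<^sup>+x. c epowr r * (u x * g x epowr r) \<partial>hl)"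
    by (intro nn_integral_cong) (simp add: epowr_mult mult_ac)
  also have "\<dots> = c epowr r * (\<integral>\<^sup>+x. u x * g x epowr r \<partial>hl)"
    by (rule nn_integral_cmult) measurable
  finally show ?thesis using \<open>0 < r\<close> by (simp add: epowr_mult)
qed

text \<open>For nonnegative functions, extension by zero outside \<open>A\<close> does not change
  the essential supremum.\<close>

lemma ess_sup_on_eq:
  assumes A: "A \<in> sets borel" "A \<subseteq> {0..}" and g [measurable]: "g \<in> borel_measurable hl"
  shows "ess_sup_on A g = esssup hl (\<lambda>y. indicator A y * g y)"
proof -
  have A'[simp]: "A \<in> sets lebesgue" using A by auto
  have [measurable]: "(\<lambda>y. indicator A y * g y) \<in> borel_measurable hl"
    using indicator_hl[OF A(1)] by measurable
  have gA: "g \<in> borel_measurable (lebesgue_on A)"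
    by (rule measurable_restrict_mono[OF g A(2)])
  show ?thesis
    unfolding ess_sup_on_def
  proof (intro antisym esssup_I gA)
    have "AE y in hl. indicator A y * g y \<le> esssup hl (\<lambda>y. indicator A y * g y)"
      by (rule esssup_AE)
    then show "AE x in lebesgue_on A. g x \<le> esssup hl (\<lambda>y. indicator A y * g y)"
      using A by (auto simp: AE_restrict_space_iff elim!: eventually_mono)
    have "AE y in lebesgue_on A. g y \<le> esssup (lebesgue_on A) g"
      by (rule esssup_AE)
    then show "AE y in hl. indicator A y * g y \<le> esssup (lebesgue_on A) g"
      by (auto simp: AE_restrict_space_iff indicator_def elim!: eventually_mono)
  qed measurable
qed

section \<open>The quantities of the theorem, rewritten through one norm for all
  \<open>q\<close>\<close>

locale iterated_hardy = oinarov D k + decay_weight u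
  for D :: real and k :: "real \<Rightarrow> real \<Rightarrow> ennreal" and u :: "real \<Rightarrow> ennreal" +
  fixes p r :: real and q :: ennreal and v w :: "real \<Rightarrow> ennreal"
  assumes p: "1 \<le> p" and r: "0 < r" and q: "0 < q"
    and v [measurable]: "v \<in> measurable_nonneg" and w [measurable]: "w \<in> measurable_nonneg"
begin

lemma p_pos: "0 < p" "0 < ennreal p" "ennreal p \<noteq> top"
  using p by auto

abbreviation N :: "(real \<Rightarrow> ennreal) \<Rightarrow> ennreal" where
  "N \<equiv> lp_norm q w"

abbreviation nrm :: "(real \<Rightarrow> ennreal) \<Rightarrow> ennreal" where
  "nrm \<equiv> lp_norm (ennreal p) v"

lemmas N_mono = lp_norm_mono[OF q w] and N_cmult = lp_norm_cmult[OF q w]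

lemma kernel_int_meas [measurable]: "f \<in> measurable_nonneg \<Longrightarrow> kernel_int k f \<in> borel_measurable hl"
  using kernel_int_measurable by (simp add: measurable_nonneg_iff)

lemma kernel_int_section [measurable]: "0 \<le> b \<Longrightarrow> (\<lambda>y. k y b) \<in> borel_measurable hl"
  using kernel_section_measurable by (simp add: measurable_nonneg_iff)

text \<open>The two definitions of the inner functionals, for finite and for infinite \<open>q\<close>, are
  instances of one: the norm in \<open>L^q_w\<close> of a truncated function.\<close>

lemma N_top_eq:
  assumes "g \<in> borel_measurable hl" "0 \<le> a" "q = top"
  shows "ess_sup_on {a<..<b} (\<lambda>y. w y * g y) = N (\<lambda>y. indicator {a<..<b} y * g y)"
proof -
  note assms(1)[measurable]
  have "ess_sup_on {a<..<b} (\<lambda>y. w y * g y) = esssup hl (\<lambda>y. indicator {a<..<b} y * (w y * g y))"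
    using assms(2) by (intro ess_sup_on_eq) auto
  then show ?thesis using assms(3) by (simp add: lp_norm_top mult_ac)
qed

lemma N_finite_eq:
  assumes "g \<in> borel_measurable hl" "0 \<le> a" "q = ennreal q'" "0 < q'"
  shows "(\<integral>\<^sup>+y\<in>{a..b}. w y * g y epowr q' \<partial>lebesgue) = N (\<lambda>y. indicator {a<..<b} y * g y) epowr q'"
proof -
  note assms(1)[measurable]
  have "(\<integral>\<^sup>+y\<in>{a..b}. w y * g y epowr q' \<partial>lebesgue) = (\<integral>\<^sup>+y. w y * g y epowr q' * indicator {a..b} y \<partial>hl)"
    using assms(2) by (intro nn_set_integral_hl) auto
  also have "\<dots> = (\<integral>\<^sup>+y. (indicator {a<..<b} y * g y) epowr q' * w y \<partial>hl)"
  proof (intro nn_integral_cong_AE)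
    show "AE y in hl. w y * g y epowr q' * indicator {a..b} y = (indicator {a<..<b} y * g y) epowr q' * w y"
      using AE_hl_neq[of a] AE_hl_neq[of b]
      by eventually_elim (auto simp: indicator_def mult.commute)
  qed
  finally show ?thesis using assms(3,4) by (simp add: lp_norm_epowr)
qed

definition Sf :: "(real \<Rightarrow> ennreal) \<Rightarrow> real \<Rightarrow> ennreal" where
  "Sf f x = N (\<lambda>y. indicator {0<..<x} y * kernel_int k f y)"

definition W0 :: "real \<Rightarrow> real \<Rightarrow> ennreal" where
  "W0 t x = N (indicator {t<..<x})"

definition W1 :: "real \<Rightarrow> real \<Rightarrow> ennreal" where
  "W1 t x = N (\<lambda>y. indicator {t<..<x} y * k y t)"

definition opn :: "real \<Rightarrow> ennreal" where
  "opn d = op_norm (ennreal p) v q w (H_star k d)"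

abbreviation Z :: "real \<Rightarrow> real" where "Z \<equiv> zeta_inv2 u"

abbreviation CS :: ennreal where "CS \<equiv> C_S p r q u v w k"

lemma Z_nonneg: "0 \<le> Z x"
  by (simp add: zeta_inv2_def zeta_inv_nonneg)

lemma S_op_eq:
  assumes "f \<in> measurable_nonneg"
  shows "S_op q w k f x = Sf f x"
  using q
proof (cases rule: exponent_cases)
  case 1
  then show ?thesis
    unfolding S_op_def Sf_def using N_top_eq[of "kernel_int k f" 0 x] assms by simp
next
  case (2 q')
  then show ?thesis
    unfolding S_op_def Sf_def using N_finite_eq[of "kernel_int k f" 0 q' x] assms by simp
qed

lemma C_S_eq: "CS = least_const (ennreal p) v (\<lambda>f. (\<integral>\<^sup>+x. u x * Sf f x epowr r \<partial>hl) epowr (1 / r))"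
  unfolding C_S_def op_norm_def
  using r by (intro least_const_cong) (simp add: lp_norm_ennreal S_op_eq mult.commute)

lemma A_0_eq: "A_0 p r q u v w k = least_const (ennreal p) v
    (\<lambda>f. (\<integral>\<^sup>+x. u x * (W0 (Z x) x * kernel_int k f (Z x)) epowr r \<partial>hl) epowr (1 / r))"
  using q
proof (cases rule: exponent_cases)
  case 1
  then have "ess_sup_on {Z x<..<x} w = W0 (Z x) x" for x
    unfolding W0_def using N_top_eq[of "\<lambda>_. 1" "Z x" x] Z_nonneg by simp
  with 1 show ?thesis
    unfolding A_0_def nn_set_integral_hl_0 by (simp add: epowr_mult mult.assoc)
next
  case (2 q')
  then have "(\<integral>\<^sup>+y\<in>{Z x..x}. w y \<partial>lebesgue) epowr (r / q') = W0 (Z x) x epowr r" for x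
    unfolding W0_def using N_finite_eq[of "\<lambda>_. 1" "Z x" q' x] Z_nonneg by (simp add: epowr_epowr)
  with 2 show ?thesis
    unfolding A_0_def nn_set_integral_hl_0 by (simp add: epowr_mult mult.assoc)
qed

lemma A_1_eq: "A_1 p r q u v w k = least_const (ennreal p) v
    (\<lambda>f. (\<integral>\<^sup>+x. u x * (W1 (Z x) x * (\<integral>\<^sup>+z. f z * indicator {0..Z x} z \<partial>hl)) epowr r \<partial>hl) epowr (1 / r))"
proof -
  have *: "(\<integral>\<^sup>+z\<in>{0..Z x}. f z \<partial>lebesgue) = (\<integral>\<^sup>+z. f z * indicator {0..Z x} z \<partial>hl)" for f x
    by (rule nn_set_integral_hl) auto
  show ?thesis
    using q
  proof (cases rule: exponent_cases)
    case 1
    then have "ess_sup_on {Z x<..<x} (\<lambda>y. w y * k y (Z x)) = W1 (Z x) x" for x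
      unfolding W1_def using N_top_eq[of "\<lambda>y. k y (Z x)" "Z x" x] Z_nonneg by simp
    with 1 show ?thesis
      unfolding A_1_def nn_set_integral_hl_0 by (simp add: epowr_mult mult.assoc *)
  next
    case (2 q')
    then have "(\<integral>\<^sup>+y\<in>{Z x..x}. w y * k y (Z x) epowr q' \<partial>lebesgue) epowr (r / q') = W1 (Z x) x epowr r" for x
      unfolding W1_def using N_finite_eq[of "\<lambda>y. k y (Z x)" "Z x" q' x] Z_nonneg by (simp add: epowr_epowr)
    with 2 show ?thesis
      unfolding A_1_def nn_set_integral_hl_0 by (simp add: epowr_mult mult.assoc *)
  qed
qed

lemma Sf_mono: 
  assumes [measurable]: "f \<in> measurable_nonneg"
  shows "x \<le> y \<Longrightarrow> Sf f x \<le> Sf f y"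
  unfolding Sf_def by (intro N_mono) (auto simp: measurable_nonneg_iff split: split_indicator)

lemma Sf_measurable [measurable]:
  assumes "f \<in> measurable_nonneg"
  shows "Sf f \<in> borel_measurable hl"
  using Sf_mono[OF assms] by (intro borel_measurable_hl borel_measurable_mono_ennreal) (auto simp: mono_def)

lemma C_S_bound:
  assumes "CS < top" "f \<in> measurable_nonneg" "nrm f < top"
  shows "(\<integral>\<^sup>+x. u x * Sf f x epowr r \<partial>hl) epowr (1 / r) \<le> CS * nrm f"
  using least_const_bound assms unfolding C_S_eq by blast

text \<open>The constant is pulled out of the integral on the side of \<open>Sf f\<close>, which is
  measurable; \<open>G f\<close> may be arbitrary. An infinite \<open>CS\<close> makes the
  right-hand side infinite because \<open>D \<ge> 1\<close>.\<close>

lemma least_const_le_C_S: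
  assumes "\<And>f x. f \<in> measurable_nonneg \<Longrightarrow> 0 \<le> x \<Longrightarrow> G f x \<le> ennreal D * Sf f x"
  shows "least_const (ennreal p) v (\<lambda>f. (\<integral>\<^sup>+x. u x * G f x epowr r \<partial>hl) epowr (1 / r)) \<le> ennreal D * CS"
proof (cases "CS < top")
  case True
  show ?thesis
  proof (rule least_const_le)
    fix f assume f: "f \<in> measurable_nonneg" "nrm f < top"
    note f(1)[measurable]
    have "(\<integral>\<^sup>+x. u x * G f x epowr r \<partial>hl) epowr (1 / r)
        \<le> (\<integral>\<^sup>+x. u x * (ennreal D * Sf f x) epowr r \<partial>hl) epowr (1 / r)"
      using assms[OF f(1)] r by (intro epowr_mono nn_integral_mono mult_left_mono) auto
    also have "\<dots> = ennreal D * (\<integral>\<^sup>+x. u x * Sf f x epowr r \<partial>hl) epowr (1 / r)"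
      using r by (intro nn_integral_epowr_cmult) measurable
    also have "\<dots> \<le> ennreal D * (CS * nrm f)"
      by (intro mult_left_mono C_S_bound True f) simp
    finally show "(\<integral>\<^sup>+x. u x * G f x epowr r \<partial>hl) epowr (1 / r) \<le> ennreal D * CS * nrm f"
      by (simp add: mult.assoc)
  qed
next
  case False
  then have "CS = top" by (simp add: less_top[symmetric])
  then show ?thesis using D_ge_1 by (simp add: ennreal_mult_top)
qed

section \<open>Lower bounds through \<open>A_0\<close>, \<open>A_1\<close>, and \<open>A_2\<close>
  for \<open>p \<le> r\<close>\<close>

lemma A_0_le: "A_0 p r q u v w k \<le> ennreal D * CS"
  unfolding A_0_eq
proof (rule least_const_le_C_S)
  fix f :: "real \<Rightarrow> ennreal" and x :: real assume f[measurable]: "f \<in> measurable_nonneg" and "0 \<le> x"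
  have "W0 (Z x) x * kernel_int k f (Z x) = N (\<lambda>y. kernel_int k f (Z x) * indicator {Z x<..<x} y)"
    unfolding W0_def by (subst N_cmult) (auto simp: measurable_nonneg_iff mult.commute)
  also have "\<dots> \<le> N (\<lambda>y. ennreal D * (indicator {0<..<x} y * kernel_int k f y))"
    using Z_nonneg[of x] kernel_int_mono[OF f Z_nonneg[of x]]
    by (intro N_mono) (auto simp: measurable_nonneg_iff split: split_indicator)
  also have "\<dots> = ennreal D * Sf f x"
    unfolding Sf_def by (intro N_cmult) (auto simp: measurable_nonneg_iff)
  finally show "W0 (Z x) x * kernel_int k f (Z x) \<le> ennreal D * Sf f x" .
qed

lemma A_1_le: "A_1 p r q u v w k \<le> ennreal D * CS"
  unfolding A_1_eq
proof (rule least_const_le_C_S)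
  fix f :: "real \<Rightarrow> ennreal" and x :: real assume f[measurable]: "f \<in> measurable_nonneg" and "0 \<le> x"
  let ?I = "\<integral>\<^sup>+z. f z * indicator {0..Z x} z \<partial>hl"
  note kernel_int_section[OF Z_nonneg[of x], measurable]
  have "W1 (Z x) x * ?I = N (\<lambda>y. ?I * (indicator {Z x<..<x} y * k y (Z x)))"
    unfolding W1_def by (subst N_cmult) (auto simp: measurable_nonneg_iff mult.commute)
  also have "\<dots> \<le> N (\<lambda>y. ennreal D * (indicator {0<..<x} y * kernel_int k f y))"
    using Z_nonneg[of x] kernel_mult_integral_le[OF f Z_nonneg[of x]]
    by (intro N_mono) (auto simp: measurable_nonneg_iff mult.commute split: split_indicator)
  also have "\<dots> = ennreal D * Sf f x"
    unfolding Sf_def by (intro N_cmult) (auto simp: measurable_nonneg_iff)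
  finally show "W1 (Z x) x * ?I \<le> ennreal D * Sf f x" .
qed

lemma H_star_measurable [measurable]:
  "f \<in> measurable_nonneg \<Longrightarrow> H_star k d f \<in> borel_measurable hl"
  unfolding H_star_def by measurable

text \<open>The truncations at \<open>d\<close>, closed in one and open in the other, differ by a
  null set. Hence the operator norm at \<open>d\<close> is the least constant for the single value
  \<open>Sf f d\<close>.\<close>

lemma N_H_star:
  assumes [measurable]: "f \<in> measurable_nonneg"
  shows "N (H_star k d f) = Sf f d"
  unfolding Sf_def
proof (rule lp_norm_cong_AE[OF q w])
  show "AE y in hl. H_star k d f y = indicator {0<..<d} y * kernel_int k f y"
    using AE_hl_neq[of d] by eventually_elim (auto simp: H_star_def indicator_def)
qed (auto simp: measurable_nonneg_iff)

lemma opn_eq: "opn d = least_const (ennreal p) v (\<lambda>f. Sf f d)"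
  unfolding opn_def op_norm_def by (rule least_const_cong) (rule N_H_star)

lemma opn_mono: "c \<le> d \<Longrightarrow> opn c \<le> opn d"
  unfolding opn_eq by (intro least_const_mono Sf_mono)

lemma Sf_zero: "Sf f 0 = 0"
  unfolding Sf_def using lp_norm_zero[OF q w] by simp

lemma opn_zero: "opn 0 = 0"
proof -
  have "opn 0 \<le> 0" unfolding opn_eq by (rule least_const_le) (simp add: Sf_zero)
  then show ?thesis by simp
qed

text \<open>By monotonicity \<open>Sf f x \<ge> Sf f t\<close> for \<open>x \<ge> t\<close>;
  integrating against \<open>u\<close> over this half-line produces the tail.\<close>

lemma tail_opn_le:
  assumes "0 < t"
  shows "tail u t epowr (1 / r) * opn t \<le> CS"
proof (cases "CS < top")
  case True
  let ?a = "tail u t epowr (1 / r)"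
  have a: "0 < ?a" "?a \<noteq> 0" "?a < top" "?a \<noteq> top"
    using tail_pos[of t] tail_finite[OF assms] by (auto simp: zero_less_iff_neq_zero)
  have "opn t \<le> CS / ?a"
    unfolding opn_eq
  proof (rule least_const_le)
    fix f assume f: "f \<in> measurable_nonneg" "nrm f < top"
    have "Sf f t epowr r * tail u t = (\<integral>\<^sup>+x. Sf f t epowr r * (u x * indicator {t..} x) \<partial>hl)"
      using assms by (subst nn_integral_cmult) (auto simp: tail_hl)
    also have "\<dots> \<le> (\<integral>\<^sup>+x. u x * Sf f x epowr r \<partial>hl)"
      using Sf_mono[OF f(1), of t] r
      by (intro nn_integral_mono) (auto simp: indicator_def mult.commute intro!: mult_left_mono epowr_mono)
    finally have "(Sf f t epowr r * tail u t) epowr (1 / r) \<le> (\<integral>\<^sup>+x. u x * Sf f x epowr r \<partial>hl) epowr (1 / r)"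
      using r by (intro epowr_mono) auto
    also have "\<dots> \<le> CS * nrm f"
      by (intro C_S_bound True f)
    finally have "Sf f t * ?a \<le> CS * nrm f"
      using r by (simp add: epowr_mult)
    then have "Sf f t * ?a / ?a \<le> CS * nrm f / ?a"
      by (rule divide_right_mono_ennreal)
    then show "Sf f t \<le> CS / ?a * nrm f"
      using a by (simp add: ennreal_mult_divide_eq ennreal_divide_times ennreal_times_divide mult.commute)
  qed
  then have "?a * opn t \<le> ?a * (CS / ?a)"
    by (rule mult_left_mono) simp
  also have "\<dots> = CS * ?a / ?a"
    by (simp only: ennreal_times_divide mult.commute)
  also have "\<dots> = CS"
    using a by (intro ennreal_mult_divide_eq) auto
  finally show ?thesis .
next
  case False
  then show ?thesis by (simp add: less_top[symmetric])
qed

lemma A_2_le_of_le: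
  assumes "p \<le> r"
  shows "A_2 p r q u v w k \<le> CS"
  using assms tail_opn_le unfolding A_2_def opn_def[symmetric] by (auto intro!: SUP_least)

lemma opn_finite:
  assumes "CS < top" "0 \<le> d"
  shows "opn d < top"
proof (cases "d = 0")
  case False
  then have "tail u d epowr (1 / r) * opn d < top" "tail u d epowr (1 / r) \<noteq> 0"
    using tail_opn_le[of d] assms tail_pos[of d] by auto
  then show ?thesis by (auto simp: less_top[symmetric] ennreal_mult_eq_top_iff)
qed (simp add: opn_zero)

lemma nrm_zero: "nrm (\<lambda>x. 0) = 0"
  by (rule lp_norm_zero[OF p_pos(2) v])

text \<open>If \<open>opn d\<close> is positive and finite, then \<open>opn d / 2\<close> is not
  admissible; a function violating it has positive finite norm and can be normalised. If
  \<open>opn d = 0\<close>, the zero function serves.\<close>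

lemma near_extremal:
  assumes "CS < top" "0 \<le> d"
  shows "\<exists>f\<in>measurable_nonneg. nrm f \<le> 1 \<and> opn d \<le> 2 * Sf f d"
proof (cases "opn d = 0")
  case True
  then show ?thesis
    by (intro bexI[of _ "\<lambda>_. 0"]) (auto simp: nrm_zero measurable_nonneg_iff)
next
  case False
  have fin: "opn d < top" using assms by (rule opn_finite)
  then obtain h where h: "opn d = ennreal h" "0 < h"
    using False by (cases "opn d") (auto simp: less_le)
  have "\<not> (\<forall>f\<in>measurable_nonneg. Sf f d \<le> opn d / 2 * nrm f)"
  proof
    assume "\<forall>f\<in>measurable_nonneg. Sf f d \<le> opn d / 2 * nrm f"
    then have "opn d \<le> opn d / 2"
      unfolding opn_eq[of d] by (intro least_const_le) auto
    then show False using h by (simp add: divide_ennreal flip: ennreal_numeral)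
  qed
  then obtain f where f: "f \<in> measurable_nonneg" and gt: "opn d / 2 * nrm f < Sf f d"
    by (auto simp: not_le)
  have "opn d / 2 \<noteq> 0" using False by simp
  then have n1: "nrm f < top"
    using gt by (auto simp: less_top[symmetric] ennreal_mult_top)
  have "Sf f d \<le> opn d * nrm f"
    using fin f n1 unfolding opn_eq by (rule least_const_bound)
  then have n0: "nrm f \<noteq> 0" using gt by auto
  define c where "c = 1 / nrm f"
  have c: "c * nrm f = 1"
    unfolding c_def using n0 n1
    by (metis ennreal_divide_times ennreal_divide_self less_top mult.commute mult_1 one_neq_zero)
  let ?f = "\<lambda>x. c * f x"
  have [measurable]: "f \<in> borel_measurable hl" using f by measurable
  have m: "?f \<in> measurable_nonneg" unfolding measurable_nonneg_iff by measurable
  have "nrm ?f = 1"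
    using lp_norm_cmult[OF p_pos(2) v f, of c] c by simp
  moreover have "Sf ?f d = c * Sf f d"
    unfolding Sf_def using f by (subst N_cmult[symmetric])
      (auto simp: measurable_nonneg_iff kernel_int_cmult[OF f] mult.left_commute)
  moreover have "opn d / 2 \<le> c * Sf f d"
  proof -
    have "opn d / 2 = opn d / 2 * nrm f * c"
      by (simp only: mult.assoc mult.commute[of "nrm f" c] c mult_1_right)
    also have "\<dots> \<le> Sf f d * c"
      using gt by (intro mult_right_mono) auto
    finally show ?thesis by (simp only: mult.commute)
  qed
  then have "2 * (opn d / 2) \<le> 2 * (c * Sf f d)"
    by (rule mult_left_mono) simp
  then have "opn d \<le> 2 * (c * Sf f d)"
    using h by (simp add: divide_ennreal flip: ennreal_numeral ennreal_mult)
  ultimately show ?thesis using m by (intro bexI[of _ ?f]) auto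
qed

end

section \<open>Lower bound through \<open>A_2\<close> for \<open>r < p\<close>\<close>

lemma sum_le_zsum:
  assumes "finite J"
  shows "sum f J \<le> zsum f"
proof -
  have "sum f J = zsum (\<lambda>j. f j * indicator J j)"
    using assms by (subst nn_integral_indicator_finite) auto
  also have "\<dots> \<le> zsum f" by (intro zsum_mono) (auto split: split_indicator)
  finally show ?thesis .
qed

lemma SUP_epowr_le_sum:
  fixes g :: "'a \<Rightarrow> ennreal"
  assumes "finite J" "0 < p"
  shows "(SUP j\<in>J. g j) epowr p \<le> (\<Sum>j\<in>J. g j epowr p)"
proof -
  have "(SUP j\<in>J. g j) \<le> (\<Sum>j\<in>J. g j epowr p) epowr (1 / p)"
  proof (rule SUP_least)
    fix j assume "j \<in> J"
    have "g j = (g j epowr p) epowr (1 / p)" using assms by simp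
    also have "\<dots> \<le> (\<Sum>j\<in>J. g j epowr p) epowr (1 / p)"
      using assms \<open>j \<in> J\<close> by (intro epowr_mono member_le_sum) auto
    finally show "g j \<le> (\<Sum>j\<in>J. g j epowr p) epowr (1 / p)" .
  qed
  then have "(SUP j\<in>J. g j) epowr p \<le> ((\<Sum>j\<in>J. g j epowr p) epowr (1 / p)) epowr p"
    using assms by (intro epowr_mono) auto
  then show ?thesis using assms by simp
qed

context iterated_hardy
begin

text \<open>Testing on the supremum of near-extremal functions, rather than on their sum, makes bounds on
  the overlap of their supports unnecessary.\<close>

lemma C_S_test_family:
  assumes CS: "CS < top" and "finite J"
    and f: "\<And>j. f j \<in> measurable_nonneg" "\<And>j. nrm (f j) \<le> 1"
    and \<alpha>: "\<And>j. \<alpha> j < top"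
  shows "(\<Sum>j\<in>J. rho j * (\<alpha> j * Sf (f j) (grid (j + 1))) epowr r)
    \<le> ennreal (4 * 2 powr (1 / 2)) * (CS * (\<Sum>j\<in>J. \<alpha> j epowr p) epowr (1 / p)) epowr r"
proof -
  note f(1)[measurable]
  define F where "F = (\<lambda>x. SUP j\<in>J. \<alpha> j * f j x)"
  have [measurable]: "f j \<in> borel_measurable hl" for j using f(1) by measurable
  have F: "F \<in> measurable_nonneg"
    unfolding F_def measurable_nonneg_iff using \<open>finite J\<close>
    by (intro borel_measurable_SUP countable_finite) auto
  note F[measurable]
  have "nrm F epowr p \<le> (\<integral>\<^sup>+x. (\<Sum>j\<in>J. (\<alpha> j * f j x) epowr p * v x) \<partial>hl)"
    unfolding lp_norm_epowr[OF p_pos(1)] F_def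
    using SUP_epowr_le_sum[OF \<open>finite J\<close> p_pos(1), of "\<lambda>j. \<alpha> j * f j _"]
    by (intro nn_integral_mono) (simp add: sum_distrib_right[symmetric] mult_right_mono)
  also have "\<dots> = (\<Sum>j\<in>J. \<integral>\<^sup>+x. \<alpha> j epowr p * (f j x epowr p * v x) \<partial>hl)"
    by (subst nn_integral_sum) (auto simp: epowr_mult mult.assoc)
  also have "\<dots> = (\<Sum>j\<in>J. \<alpha> j epowr p * nrm (f j) epowr p)"
    unfolding lp_norm_epowr[OF p_pos(1)]
    by (intro sum.cong refl nn_integral_cmult) measurable
  also have "\<dots> \<le> (\<Sum>j\<in>J. \<alpha> j epowr p * 1)"
  proof (intro sum_mono mult_left_mono)
    show "nrm (f j) epowr p \<le> 1" for j
      using epowr_mono[OF less_imp_le[OF p_pos(1)] f(2)[of j]] by simp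
  qed simp
  finally have le: "nrm F epowr p \<le> (\<Sum>j\<in>J. \<alpha> j epowr p)" by simp
  then have nF: "nrm F \<le> (\<Sum>j\<in>J. \<alpha> j epowr p) epowr (1 / p)"
    using epowr_mono[OF _ le, of "1 / p"] p_pos(1) by simp
  \<comment> \<open>Finiteness of \<open>J\<close> and of the coefficients makes the norm of
    \<open>F\<close> finite, as \<open>C_S_bound\<close> requires.\<close>
  have "(\<Sum>j\<in>J. \<alpha> j epowr p) < top"
    using \<alpha> by (simp add: \<open>finite J\<close>)
  with nF have fin: "nrm F < top"
    using epowr_less_top_iff le_less_trans by blast
  have "(\<Sum>j\<in>J. rho j * (\<alpha> j * Sf (f j) (grid (j + 1))) epowr r)
      \<le> (\<Sum>j\<in>J. rho j * Sf F (grid (j + 1)) epowr r)"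
  proof (intro sum_mono mult_left_mono epowr_mono)
    fix j assume "j \<in> J"
    have "\<alpha> j * Sf (f j) (grid (j + 1)) = N (\<lambda>y. indicator {0<..<grid (j + 1)} y * kernel_int k (\<lambda>z. \<alpha> j * f j z) y)"
      unfolding Sf_def by (subst N_cmult[symmetric])
        (auto simp: measurable_nonneg_iff kernel_int_cmult[OF f(1)] mult.left_commute)
    also have "\<dots> \<le> Sf F (grid (j + 1))"
      unfolding Sf_def
    proof (rule N_mono)
      show "(\<lambda>y. indicator {0<..<grid (j + 1)} y * kernel_int k (\<lambda>z. \<alpha> j * f j z) y) \<in> measurable_nonneg"
        by (auto simp: measurable_nonneg_iff kernel_int_cmult[OF f(1)])
      show "indicator {0<..<grid (j + 1)} y * kernel_int k (\<lambda>z. \<alpha> j * f j z) y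
          \<le> indicator {0<..<grid (j + 1)} y * kernel_int k F y" for y
        using \<open>j \<in> J\<close> by (intro mult_left_mono kernel_int_mono_arg) (auto simp: F_def intro!: SUP_upper)
    qed
    finally show "\<alpha> j * Sf (f j) (grid (j + 1)) \<le> Sf F (grid (j + 1))" .
  qed (use r in auto)
  also have "\<dots> \<le> zsum (\<lambda>j. rho j * Sf F (grid (j + 1)) epowr r)"
    using \<open>finite J\<close> by (rule sum_le_zsum)
  \<comment> \<open>The shift is \<open>n = 1\<close> because \<open>grid (j + 1)\<close> is the
    left end of block \<open>j + 1\<close>, on which \<open>Sf F\<close> is at least its value
    there.\<close>
  also have "\<dots> \<le> ennreal (4 * 2 powr (1 / 2)) * (\<integral>\<^sup>+y. u y * Sf F y epowr r \<partial>hl)"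
  proof (rule order_trans[OF step_sum_le[of 1]])
    show "Sf F (grid (j + 1)) epowr r \<le> Sf F y epowr r" if "y \<in> block (j + 1)" for j y
      using that r by (intro epowr_mono Sf_mono F) (auto simp: block_def)
  qed (auto simp: Sf_zero)
  also have "\<dots> \<le> ennreal (4 * 2 powr (1 / 2)) * (CS * (\<Sum>j\<in>J. \<alpha> j epowr p) epowr (1 / p)) epowr r"
  proof (intro mult_left_mono)
    have "(\<integral>\<^sup>+y. u y * Sf F y epowr r \<partial>hl) = ((\<integral>\<^sup>+y. u y * Sf F y epowr r \<partial>hl) epowr (1 / r)) epowr r"
      using r by simp
    also have "\<dots> \<le> (CS * nrm F) epowr r"
      using r by (intro epowr_mono C_S_bound CS F fin) auto
    also have "\<dots> \<le> (CS * (\<Sum>j\<in>J. \<alpha> j epowr p) epowr (1 / p)) epowr r"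
      using r nF by (intro epowr_mono mult_left_mono) auto
    finally show "(\<integral>\<^sup>+y. u y * Sf F y epowr r \<partial>hl) \<le> (CS * (\<Sum>j\<in>J. \<alpha> j epowr p) epowr (1 / p)) epowr r" .
  qed simp
  finally show ?thesis .
qed

definition s :: real where "s = s_exp p r"

text \<open>Here \<open>s = p * r / (p - r)\<close>. The last identity says that
  \<open>s / r\<close> and \<open>p / r\<close> are conjugate exponents.\<close>

lemma s_facts:
  assumes "r < p"
  shows "0 < s" "1 / s = 1 / r - 1 / p" "s / r = p / (p - r)" "1 + s / p = s / r" "r / s = 1 - r / p"
proof -
  have "0 < 1 / r - 1 / p" using assms r by (simp add: field_simps)
  then have s: "s = p * r / (p - r)"
    using assms r p by (simp add: s_def s_exp_def field_simps)
  show "0 < s" "1 / s = 1 / r - 1 / p" "s / r = p / (p - r)" "1 + s / p = s / r" "r / s = 1 - r / p"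
    unfolding s using assms r p by (simp_all add: field_simps)
qed

definition K2 :: ennreal where
  "K2 = ennreal (2 powr r * (4 * 2 powr (1 / 2)))"

text \<open>Duality by testing: with extremal coefficients the finite sum \<open>T\<close>
  reproduces itself on the right with the smaller power \<open>r / p\<close>, and dividing leaves
  \<open>T epowr (r / s)\<close>. Bounds uniform in \<open>J\<close> pass to the series.\<close>

lemma zsum_opn_le:
  assumes CS: "CS < top" and "r < p"
  shows "zsum (\<lambda>j. rho j epowr (s / r) * opn (grid (j + 1)) epowr s) \<le> (K2 * CS epowr r) epowr (s / r)"
proof (rule zsum_least)
  fix J :: "int set" assume J: "finite J"
  note sf = s_facts[OF \<open>r < p\<close>]
  let ?h = "\<lambda>j. opn (grid (j + 1))"
  have h: "?h j < top" for j
    using CS grid_nonneg by (rule opn_finite)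
  have "\<forall>j. \<exists>f\<in>measurable_nonneg. nrm f \<le> 1 \<and> ?h j \<le> 2 * Sf f (grid (j + 1))"
    using near_extremal[OF CS grid_nonneg] by blast
  then obtain f where f: "\<And>j. f j \<in> measurable_nonneg" "\<And>j. nrm (f j) \<le> 1"
    "\<And>j. ?h j \<le> 2 * Sf (f j) (grid (j + 1))"
    by metis
  \<comment> \<open>The equality case of Hoelder's inequality for the exponents \<open>s / r\<close>
    and \<open>p / r\<close>: the power \<open>p\<close> of the coefficient is at once the summand
    in question and \<open>rho j * (\<alpha> j * ?h j) epowr r\<close>.\<close>
  define \<alpha> where "\<alpha> = (\<lambda>j. (rho j * ?h j epowr r) epowr (1 / (p - r)))"
  have \<alpha>_top: "\<alpha> j < top" for j
    using h[of j] by (simp add: \<alpha>_def ennreal_mult_less_top)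
  have \<alpha>1: "\<alpha> j epowr (p - r) = rho j * ?h j epowr r" for j
    using \<open>r < p\<close> by (simp add: \<alpha>_def)
  have \<alpha>2: "\<alpha> j epowr p = rho j epowr (s / r) * ?h j epowr s" for j
  proof -
    have "\<alpha> j epowr p = (rho j * ?h j epowr r) epowr (s / r)"
      by (simp add: \<alpha>_def epowr_epowr sf(3))
    then show ?thesis using r by (simp add: epowr_mult epowr_epowr)
  qed
  have \<alpha>3: "\<alpha> j epowr p = rho j * (\<alpha> j * ?h j) epowr r" for j
    using epowr_add[of "\<alpha> j" "p - r" r] by (simp add: \<alpha>1 epowr_mult mult_ac)
  define T where "T = (\<Sum>j\<in>J. \<alpha> j epowr p)"
  have T_top: "T < top" using \<alpha>_top by (simp add: T_def J)
  have "T \<le> (\<Sum>j\<in>J. ennreal (2 powr r) * (rho j * (\<alpha> j * Sf (f j) (grid (j + 1))) epowr r))"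
    unfolding T_def
  proof (rule sum_mono)
    fix j
    have "\<alpha> j epowr p \<le> rho j * (\<alpha> j * (2 * Sf (f j) (grid (j + 1)))) epowr r"
      unfolding \<alpha>3 using r by (intro mult_left_mono epowr_mono f(3)) auto
    also have "\<dots> = ennreal (2 powr r) * (rho j * (\<alpha> j * Sf (f j) (grid (j + 1))) epowr r)"
      by (simp add: epowr_mult epowr_ennreal mult_ac flip: ennreal_numeral)
    finally show "\<alpha> j epowr p \<le> ennreal (2 powr r) * (rho j * (\<alpha> j * Sf (f j) (grid (j + 1))) epowr r)" .
  qed
  also have "\<dots> = ennreal (2 powr r) * (\<Sum>j\<in>J. (rho j * (\<alpha> j * Sf (f j) (grid (j + 1))) epowr r))"
    by (rule sum_distrib_left[symmetric])
  also have "\<dots> \<le> ennreal (2 powr r) * (ennreal (4 * 2 powr (1 / 2)) * (CS * T epowr (1 / p)) epowr r)"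
    unfolding T_def by (intro mult_left_mono C_S_test_family CS J f \<alpha>_top) simp
  also have "\<dots> = T epowr (r / p) * (K2 * CS epowr r)"
    by (simp add: K2_def epowr_mult epowr_epowr ennreal_mult mult_ac)
  finally have T: "T \<le> T epowr (r / p) * (K2 * CS epowr r)" .
  \<comment> \<open>Cancelling \<open>T epowr (r / p)\<close> is legitimate because \<open>T\<close>
    is finite and the case \<open>T = 0\<close> is trivial.\<close>
  have "T = T epowr (r / p) * T epowr (r / s)"
    using sf(5) by (simp flip: epowr_add)
  then have "T epowr (r / p) * T epowr (r / s) \<le> T epowr (r / p) * (K2 * CS epowr r)"
    using T by simp
  then have "T = 0 \<or> T epowr (r / s) \<le> K2 * CS epowr r"
    using T_top ennreal_mult_le_mult_iff[of "T epowr (r / p)"] by (cases "T = 0") auto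
  then have "T \<le> (K2 * CS epowr r) epowr (s / r)"
  proof
    assume "T epowr (r / s) \<le> K2 * CS epowr r"
    then have "(T epowr (r / s)) epowr (s / r) \<le> (K2 * CS epowr r) epowr (s / r)"
      using sf(1) r by (intro epowr_mono) auto
    then show ?thesis using sf(1) r by (simp add: epowr_epowr)
  qed simp
  then show "(\<Sum>j\<in>J. rho j epowr (s / r) * ?h j epowr s) \<le> (K2 * CS epowr r) epowr (s / r)"
    by (simp add: T_def \<alpha>2)
qed

text \<open>The lower limit of integration becomes a cutoff of \<open>f\<close>, so the facts on
  \<open>kernel_int\<close> apply.\<close>

lemma H_star2_eq:
  assumes "0 \<le> x"
  shows "H_star2 u k c d f x = indicator {c<..d} x * kernel_int k (\<lambda>z. indicator {zeta_inv u c..} z * f z) x"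
proof -
  have "(\<integral>\<^sup>+z\<in>{zeta_inv u c..x}. k x z * f z \<partial>lebesgue) = (\<integral>\<^sup>+z. k x z * f z * indicator {zeta_inv u c..x} z \<partial>hl)"
    using zeta_inv_nonneg[of c] by (intro nn_set_integral_hl) auto
  also have "\<dots> = kernel_int k (\<lambda>z. indicator {zeta_inv u c..} z * f z) x"
    unfolding kernel_int_hl using zeta_inv_nonneg[of c]
    by (intro nn_integral_cong) (auto split: split_indicator)
  finally show ?thesis by (simp add: H_star2_def)
qed

lemma H_star2_measurable:
  assumes [measurable]: "f \<in> measurable_nonneg"
  shows "H_star2 u k c d f \<in> measurable_nonneg"
proof -
  have "(\<lambda>z. indicator {zeta_inv u c..} z * f z) \<in> measurable_nonneg"
    unfolding measurable_nonneg_iff by measurable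
  from kernel_int_meas[OF this]
  have "(\<lambda>x. indicator {c<..d} x * kernel_int k (\<lambda>z. indicator {zeta_inv u c..} z * f z) x) \<in> borel_measurable hl"
    by measurable
  then show ?thesis
    unfolding measurable_nonneg_iff
    by (rule measurable_cong[THEN iffD1, rotated]) (simp add: H_star2_eq)
qed

lemma op_norm_H_star2_le:
  assumes "0 \<le> c"
  shows "op_norm (ennreal p) v q w (H_star2 u k c d) \<le> opn d"
  unfolding opn_def op_norm_def
proof (intro least_const_mono N_mono H_star2_measurable)
  fix f :: "real \<Rightarrow> ennreal" and x :: real assume x: "0 \<le> x"
  have "kernel_int k (\<lambda>z. indicator {zeta_inv u c..} z * f z) x \<le> kernel_int k f x"
    by (intro kernel_int_mono_arg) (auto split: split_indicator)
  then show "H_star2 u k c d f x \<le> H_star k d f x"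
    unfolding H_star2_eq[OF x] H_star_def using assms by (auto split: split_indicator)
qed

lemma A_2_epowr:
  assumes "r < p"
  shows "A_2 p r q u v w k epowr s = (\<integral>\<^sup>+x. u x * (tail u x epowr (s / p) *
    op_norm (ennreal p) v q w (H_star2 u k (zeta_inv u x) (zeta u x)) epowr s) \<partial>hl)"
  using assms s_facts(1)[OF assms] unfolding A_2_def nn_set_integral_hl_0 s_def[symmetric]
  by (simp add: mult.assoc)

text \<open>For \<open>x\<close> in block \<open>j\<close> the operator only reaches up to
  \<open>zeta u x \<le> grid (j + 3)\<close>, and its norm is at most
  \<open>opn (grid (j + 3))\<close>. An index shift by two, paid for by
  \<open>rho j = 2 * rho (j + 2)\<close>, leads to \<open>zsum_opn_le\<close>.\<close>

lemma A_2_le_of_less: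
  assumes "r < p"
  shows "A_2 p r q u v w k \<le> (2 * K2) epowr (1 / r) * CS"
proof (cases "CS < top")
  case True
  note sf = s_facts[OF \<open>r < p\<close>]
  let ?c = "\<lambda>j. rho j epowr (s / p) * opn (grid (j + 3)) epowr s"
  have "A_2 p r q u v w k epowr s \<le> zsum (\<lambda>j. rho j * ?c j)"
    unfolding A_2_epowr[OF \<open>r < p\<close>]
  proof (rule step_sum_ge)
    fix j y assume y: "y \<in> block j"
    have "op_norm (ennreal p) v q w (H_star2 u k (zeta_inv u y) (zeta u y)) \<le> opn (zeta u y)"
      by (rule op_norm_H_star2_le) (rule zeta_inv_nonneg)
    also have "\<dots> \<le> opn (grid (j + 3))" by (rule opn_mono) (rule zeta_le[OF y])
    finally show "tail u y epowr (s / p) * op_norm (ennreal p) v q w (H_star2 u k (zeta_inv u y) (zeta u y)) epowr s \<le> ?c j"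
      using blockD[OF y] sf(1) p_pos by (intro mult_mono epowr_mono) auto
  qed
  also have "\<dots> = zsum (\<lambda>j. ennreal (2 powr (s / r)) * (rho (j + 2) epowr (s / r) * opn (grid (j + 2 + 1)) epowr s))"
  proof (intro nn_integral_cong)
    fix j
    have "rho j * rho j epowr (s / p) = rho j epowr (s / r)"
      using epowr_add[of "rho j" 1 "s / p"] sf(4) by simp
    moreover have "rho j = ennreal 2 * rho (j + 2)"
      using rho_numeral(1)[of "j + 2"] by simp
    then have "rho j epowr (s / r) = ennreal (2 powr (s / r)) * rho (j + 2) epowr (s / r)"
      by (simp add: epowr_mult epowr_ennreal del: ennreal_numeral)
    ultimately show "rho j * ?c j = ennreal (2 powr (s / r)) * (rho (j + 2) epowr (s / r) * opn (grid (j + 2 + 1)) epowr s)"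
      by (simp add: mult.assoc[symmetric] add.assoc)
  qed
  also have "\<dots> = ennreal (2 powr (s / r)) * zsum (\<lambda>j. rho (j + 2) epowr (s / r) * opn (grid (j + 2 + 1)) epowr s)"
    by (rule zsum_cmult)
  also have "zsum (\<lambda>j. rho (j + 2) epowr (s / r) * opn (grid (j + 2 + 1)) epowr s)
      = zsum (\<lambda>j. rho j epowr (s / r) * opn (grid (j + 1)) epowr s)"
    by (rule zsum_shift)
  also have "ennreal (2 powr (s / r)) * \<dots> \<le> ennreal (2 powr (s / r)) * (K2 * CS epowr r) epowr (s / r)"
    by (intro mult_left_mono zsum_opn_le True \<open>r < p\<close>) simp
  also have "\<dots> = ((2 * K2) epowr (1 / r) * CS) epowr s"
    using r by (simp add: epowr_mult epowr_epowr epowr_ennreal powr_powr mult.assoc flip: ennreal_numeral)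
  finally show ?thesis
    using sf(1) by (simp add: epowr_le_iff)
next
  case False
  have "(2 * K2) epowr (1 / r) \<noteq> 0" by (simp add: K2_def)
  with False show ?thesis by (simp add: less_top[symmetric] ennreal_mult_top)
qed

end

section \<open>Upper bound\<close>

text \<open>The embedding of sequence spaces: \<open>t - 1\<close> of the \<open>t\<close> powers of
  each term are bounded by those of the whole sum.\<close>

lemma zsum_epowr_le:
  assumes "1 \<le> t"
  shows "zsum (\<lambda>j. g j epowr t) \<le> zsum g epowr t"
proof -
  have *: "x epowr t = x epowr (t - 1) * x" for x
    using epowr_add[of x "t - 1" 1] by simp
  have "zsum (\<lambda>j. g j epowr t) \<le> zsum (\<lambda>j. zsum g epowr (t - 1) * g j)"
    unfolding * using assms by (intro zsum_mono mult_right_mono epowr_mono zsum_le) auto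
  also have "\<dots> = zsum g epowr t"
    unfolding zsum_cmult * ..
  finally show ?thesis .
qed

text \<open>Normalisation by \<open>A\<close> and \<open>B\<close> and Young's inequality term by
  term; the factor \<open>2\<close> stems from the missing weights in \<open>young_epowr\<close>. If
  \<open>A\<close> or \<open>B\<close> is zero, all products vanish.\<close>

lemma zsum_Hoelder:
  assumes ab: "0 < a" "0 < b" "1 / a + 1 / b = 1"
    and f: "zsum (\<lambda>j. f j epowr a) \<le> A epowr a" and g: "zsum (\<lambda>j. g j epowr b) \<le> B epowr b"
    and fin: "A < top" "B < top"
  shows "zsum (\<lambda>j. f j * g j) \<le> 2 * (A * B)"
proof -
  have fA: "f j \<le> A" for j
    using order_trans[OF zsum_le f, of j] ab by (simp add: epowr_le_iff)
  have gB: "g j \<le> B" for j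
    using order_trans[OF zsum_le g, of j] ab by (simp add: epowr_le_iff)
  show ?thesis
  proof (cases "A = 0 \<or> B = 0")
    case True
    then have "f j * g j = 0" for j using fA[of j] gB[of j] by auto
    then have "zsum (\<lambda>j. f j * g j) = zsum (\<lambda>j. 0)" by (simp only:)
    then show ?thesis by simp
  next
    case False
    define A' B' where "A' = inverse A" and "B' = inverse B"
    have inv: "A * A' = 1" "B * B' = 1"
      using False fin ennreal_divide_self[of A] ennreal_divide_self[of B]
      by (auto simp: A'_def B'_def divide_ennreal_def)
    have normalized: "zsum (\<lambda>j. (c * h j) epowr t) \<le> 1"
      if "zsum (\<lambda>j. h j epowr t) \<le> C epowr t" "C * c = 1" for h C c t
    proof -
      have "zsum (\<lambda>j. (c * h j) epowr t) = c epowr t * zsum (\<lambda>j. h j epowr t)"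
        by (simp only: epowr_mult zsum_cmult)
      also have "\<dots> \<le> c epowr t * C epowr t"
        using that(1) by (rule mult_left_mono) simp
      also have "\<dots> = (C * c) epowr t"
        by (simp only: epowr_mult mult.commute)
      also have "\<dots> = 1" by (simp only: that(2) epowr_one_left)
      finally show ?thesis .
    qed
    note le = normalized[OF f inv(1)] normalized[OF g inv(2)]
    have "zsum (\<lambda>j. f j * g j) \<le> zsum (\<lambda>j. A * B * ((A' * f j) epowr a + (B' * g j) epowr b))"
    proof (intro zsum_mono)
      fix j
      have "f j * g j = (A * A') * (B * B') * (f j * g j)" by (simp add: inv)
      also have "\<dots> = A * B * ((A' * f j) * (B' * g j))" by (simp only: mult_ac)
      also have "\<dots> \<le> A * B * ((A' * f j) epowr a + (B' * g j) epowr b)"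
        by (intro mult_left_mono young_epowr ab) simp
      finally show "f j * g j \<le> A * B * ((A' * f j) epowr a + (B' * g j) epowr b)" .
    qed
    also have "\<dots> \<le> A * B * (1 + 1)"
      unfolding zsum_cmult zsum_add by (intro mult_left_mono add_mono le) simp
    finally show ?thesis by (simp add: mult.commute)
  qed
qed

lemma epowr_add3_le:
  assumes "0 \<le> a"
  shows "(x + y + z) epowr a \<le> ennreal (4 powr a) * (x epowr a + y epowr a + z epowr a)"
proof -
  have "(x + y + z) epowr a \<le> ennreal (2 powr a) * ((x + y) epowr a + z epowr a)"
    by (rule epowr_add_le) fact
  also have "\<dots> \<le> ennreal (2 powr a) * (ennreal (2 powr a) * (x epowr a + y epowr a) + ennreal (2 powr a) * z epowr a)"
  proof (intro mult_left_mono add_mono epowr_add_le assms)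
    have "1 * z epowr a \<le> ennreal (2 powr a) * z epowr a"
      using assms by (intro mult_right_mono) (auto simp: ge_one_powr_ge_zero)
    then show "z epowr a \<le> ennreal (2 powr a) * z epowr a" by simp
  qed simp
  also have "\<dots> = ennreal (2 powr a * 2 powr a) * (x epowr a + y epowr a + z epowr a)"
    by (simp add: ennreal_mult distrib_left mult.assoc)
  also have "2 powr a * 2 powr a = 4 powr a"
    by (simp flip: powr_mult)
  finally show ?thesis .
qed

section \<open>Decoupling the blocks, and the decomposition on one block\<close>

context iterated_hardy
begin

text \<open>Hardy's inequality for geometric sums. For \<open>x\<close> in block \<open>j\<close>
  only the blocks \<open>j - i\<close> meet the range of the norm in \<open>Sf f x\<close>; a weight
  growing slower than \<open>rho\<close> decays makes both the norm over these blocks and the sum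
  over \<open>j\<close> geometric.\<close>

lemma zsum_block_hardy:
  assumes f [measurable]: "f \<in> measurable_nonneg"
  shows "(\<integral>\<^sup>+x. u x * Sf f x epowr r \<partial>hl)
    \<le> ennreal (((1 / (1 - 2 powr (- (1 / (4 * r)) * enn2real q))) powr (1 / enn2real q) + 1) powr r / (1 - 2 powr (- (1 / 4))))
      * zsum (\<lambda>j. rho j * N (\<lambda>y. indicator (block j) y * kernel_int k f y) epowr r)"
proof -
  define E where "E = (\<lambda>j. N (\<lambda>y. indicator (block j) y * kernel_int k f y) epowr r)"
  define K where "K = (1 / (1 - 2 powr (- (1 / (4 * r)) * enn2real q))) powr (1 / enn2real q) + 1"
  \<comment> \<open>The growth \<open>2 powr (i / 4)\<close> is half of what the decay
    \<open>2 powr (- i / 2)\<close> of \<open>rho\<close> allows. It bounds the contribution of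
    block \<open>j - i\<close> by \<open>2 powr (- (i / 4)) * B j\<close>, so
    \<open>lp_norm_UN_le\<close> applies with exponent \<open>1 / (4 * r)\<close> after taking
    \<open>r\<close>-th roots.\<close>
  define B where "B = (\<lambda>j. \<Sum>i. ennreal (2 powr (i / 4)) * E (j - int i))"
  have K: "0 \<le> K" by (simp add: K_def)
  have "(\<integral>\<^sup>+x. u x * Sf f x epowr r \<partial>hl) \<le> zsum (\<lambda>j. rho j * (ennreal (K powr r) * B j))"
  proof (rule step_sum_ge)
    fix j x assume x: "x \<in> block j"
    have "Sf f x \<le> N (\<lambda>y. indicator (\<Union>i. block (j - int i)) y * kernel_int k f y)"
      unfolding Sf_def
    proof (rule N_mono)
      show "(\<lambda>y. indicator {0<..<x} y * kernel_int k f y) \<in> measurable_nonneg"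
        unfolding measurable_nonneg_iff by measurable
      show "indicator {0<..<x} y * kernel_int k f y \<le> indicator (\<Union>i. block (j - int i)) y * kernel_int k f y" for y
      proof (cases "y \<in> {0<..<x}")
        case True
        then obtain m where m: "y \<in> block m" using block_ex[of y] by auto
        have "m \<le> j"
        proof (rule ccontr)
          assume "\<not> m \<le> j"
          then have "grid (j + 1) \<le> grid m" by (intro grid_mono) auto
          then show False using True m x by (auto simp: block_def)
        qed
        then have "y \<in> (\<Union>i. block (j - int i))"
          using m by (auto intro!: exI[of _ "nat (j - m)"])
        then show ?thesis
          by (simp only: indicator_simps(1) mult_1) (auto split: split_indicator)
      qed simp
    qed
    also have "\<dots> \<le> ennreal K * B j epowr (1 / r)"
      unfolding K_def
    proof (rule lp_norm_UN_le[OF q w])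
      fix i :: nat
      have "ennreal (2 powr (i / 4)) * E (j - int i) = (\<Sum>i\<in>{i}. ennreal (2 powr (i / 4)) * E (j - int i))" by simp
      also have "\<dots> \<le> B j" unfolding B_def by (rule sum_le_suminf) auto
      finally have "ennreal (2 powr (- (i / 4))) * (ennreal (2 powr (i / 4)) * E (j - int i)) \<le> ennreal (2 powr (- (i / 4))) * B j"
        by (rule mult_left_mono) simp
      then have "E (j - int i) \<le> ennreal (2 powr (- (i / 4))) * B j"
        by (simp add: mult.assoc[symmetric] powr_add[symmetric] flip: ennreal_mult)
      then have "E (j - int i) epowr (1 / r) \<le> (ennreal (2 powr (- (i / 4))) * B j) epowr (1 / r)"
        using r by (intro epowr_mono) auto
      then show "N (\<lambda>y. indicator (block (j - int i)) y * kernel_int k f y)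
          \<le> ennreal (2 powr (- (1 / (4 * r)) * i)) * B j epowr (1 / r)"
        using r by (simp add: E_def epowr_mult epowr_ennreal powr_powr)
    qed (use r in \<open>auto simp: measurable_nonneg_iff\<close>)
    finally have "Sf f x epowr r \<le> (ennreal K * B j epowr (1 / r)) epowr r"
      using r by (intro epowr_mono) auto
    then show "Sf f x epowr r \<le> ennreal (K powr r) * B j"
      using r K by (simp add: epowr_mult epowr_ennreal)
  qed
  also have "\<dots> = ennreal (K powr r) * zsum (\<lambda>j. \<Sum>i. rho j * (ennreal (2 powr (i / 4)) * E (j - int i)))"
    by (simp add: B_def zsum_cmult[symmetric] ennreal_suminf_cmult mult.left_commute)
  also have "zsum (\<lambda>j. \<Sum>i. rho j * (ennreal (2 powr (i / 4)) * E (j - int i)))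
      = (\<Sum>i. zsum (\<lambda>j. rho j * (ennreal (2 powr (i / 4)) * E (j - int i))))"
    by (rule nn_integral_suminf) simp
  \<comment> \<open>Since \<open>rho j = rho (j - int i) * rho (int i)\<close>, a shift of
    \<open>j\<close> leaves the same series for every \<open>i\<close>, times the surplus decay
    \<open>2 powr (- (i / 4))\<close>.\<close>
  also have "\<dots> = (\<Sum>i. ennreal ((2 powr (- (1 / 4))) ^ i) * zsum (\<lambda>j. rho j * E j))"
  proof (intro suminf_cong)
    fix i :: nat
    have "rho j * (ennreal (2 powr (i / 4)) * E (j - int i))
        = ennreal ((2 powr (- (1 / 4))) ^ i) * (rho (j + - int i) * E (j + - int i))" for j
    proof -
      have "rho j = rho (j + - int i) * rho (int i)"
        using rho_add[of "j + - int i" "int i"] by simp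
      moreover have "rho (int i) * ennreal (2 powr (i / 4)) = ennreal ((2 powr (- (1 / 4))) ^ i)"
      proof -
        have "rho (int i) * ennreal (2 powr (i / 4)) = ennreal (2 powr (- i / 2) * 2 powr (i / 4))"
          by (simp add: rho_def ennreal_mult)
        also have "2 powr (- i / 2) * 2 powr (i / 4) = (2 powr (- (i / 4)) :: real)"
          by (simp add: powr_add[symmetric])
        also have "\<dots> = (2 powr (- (1 / 4))) ^ i"
          by (simp add: powr_power)
        finally show ?thesis .
      qed
      ultimately have "rho j * (ennreal (2 powr (i / 4)) * E (j - int i))
          = rho (j + - int i) * E (j - int i) * ennreal ((2 powr (- (1 / 4))) ^ i)"
        by (metis mult.assoc mult.commute)
      then show ?thesis by (simp add: mult.commute)
    qed
    then have "zsum (\<lambda>j. rho j * (ennreal (2 powr (i / 4)) * E (j - int i)))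
        = ennreal ((2 powr (- (1 / 4))) ^ i) * zsum (\<lambda>j. rho (j + - int i) * E (j + - int i))"
      by (simp only: zsum_cmult)
    also have "zsum (\<lambda>j. rho (j + - int i) * E (j + - int i)) = zsum (\<lambda>j. rho j * E j)"
      by (rule zsum_shift)
    finally show "zsum (\<lambda>j. rho j * (ennreal (2 powr (i / 4)) * E (j - int i)))
        = ennreal ((2 powr (- (1 / 4))) ^ i) * zsum (\<lambda>j. rho j * E j)" .
  qed
  also have "\<dots> = (\<Sum>i. ennreal ((2 powr (- (1 / 4))) ^ i)) * zsum (\<lambda>j. rho j * E j)"
    by (rule ennreal_suminf_multc)
  also have "(\<Sum>i. ennreal ((2 powr (- (1 / 4))) ^ i)) = ennreal (1 / (1 - 2 powr (- (1 / 4))))"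
  proof (rule suminf_ennreal_eq)
    have "2 powr (- (1 / 4)) < (2::real) powr 0" by (rule powr_less_mono) auto
    then show "(\<lambda>i. (2 powr (- (1 / 4))) ^ i) sums (1 / (1 - 2 powr (- (1 / 4)) :: real))"
      by (intro geometric_sums) simp
  qed simp
  also have "ennreal (K powr r) * (ennreal (1 / (1 - 2 powr (- (1 / 4)))) * zsum (\<lambda>j. rho j * E j))
      = ennreal (K powr r / (1 - 2 powr (- (1 / 4)))) * zsum (\<lambda>j. rho j * E j)"
    by (simp add: mult.assoc[symmetric] flip: ennreal_mult')
  finally show ?thesis by (simp add: E_def K_def)
qed

definition piece :: "(real \<Rightarrow> ennreal) \<Rightarrow> int \<Rightarrow> real \<Rightarrow> ennreal" where
  "piece f j = (\<lambda>z. indicator {grid (j - 2)<..grid (j + 1)} z * f z)"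

text \<open>The cutoff is from below only; from above, the kernel integral at a point of block
  \<open>j\<close> sees nothing beyond \<open>grid (j + 1)\<close>, where \<open>piece\<close>
  ends.\<close>

definition B_op :: "int \<Rightarrow> (real \<Rightarrow> ennreal) \<Rightarrow> real \<Rightarrow> ennreal" where
  "B_op j f = (\<lambda>y. indicator (block j) y * kernel_int k (\<lambda>z. indicator {grid (j - 2)<..} z * f z) y)"

lemma piece_measurable:
  assumes [measurable]: "f \<in> measurable_nonneg"
  shows "piece f j \<in> measurable_nonneg"
  unfolding piece_def measurable_nonneg_iff by measurable

lemma B_op_measurable:
  assumes [measurable]: "f \<in> measurable_nonneg"
  shows "B_op j f \<in> measurable_nonneg"
proof -
  have "(\<lambda>z. indicator {grid (j - 2)<..} z * f z) \<in> measurable_nonneg"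
    unfolding measurable_nonneg_iff by measurable
  from kernel_int_meas[OF this] show ?thesis
    unfolding measurable_nonneg_iff B_op_def by measurable
qed

definition V0 :: "int \<Rightarrow> ennreal" where "V0 j = N (indicator (block j))"

definition V1 :: "int \<Rightarrow> ennreal" where
  "V1 j = N (\<lambda>y. indicator (block j) y * k y (grid (j - 1)))"

definition Cq :: real where "Cq = 2 * 2 powr (1 / enn2real q)"

text \<open>\<open>kernel_int_split_le\<close> with \<open>a = grid (j - 2)\<close> and
  \<open>b = grid (j - 1)\<close>, followed by two quasi-triangle inequalities with constant
  \<open>Cq\<close> each.\<close>

lemma block_decomposition:
  assumes f [measurable]: "f \<in> measurable_nonneg"
  shows "N (\<lambda>y. indicator (block j) y * kernel_int k f y)
    \<le> ennreal (Cq * Cq * D) * (V1 j * (\<integral>\<^sup>+z. f z * indicator {0..grid (j - 2)} z \<partial>hl)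
        + V0 j * kernel_int k f (grid (j - 1)) + N (B_op j (piece f j)))"
proof -
  let ?I = "\<integral>\<^sup>+z. f z * indicator {0..grid (j - 2)} z \<partial>hl"
  let ?b = "grid (j - 1)"
  let ?g1 = "\<lambda>y. ennreal D * ?I * (indicator (block j) y * k y ?b)"
  let ?g0 = "\<lambda>y. ennreal D * kernel_int k f ?b * indicator (block j) y"
  let ?g2 = "B_op j (piece f j)"
  note kernel_int_section[OF grid_nonneg[of "j - 1"], measurable]
  have m: "?g1 \<in> measurable_nonneg" "?g0 \<in> measurable_nonneg" "?g2 \<in> measurable_nonneg"
    "(\<lambda>y. ?g1 y + ?g0 y) \<in> measurable_nonneg"
    using B_op_measurable[OF piece_measurable[OF f]] unfolding measurable_nonneg_iff by auto
  have C1: "1 \<le> Cq" "0 \<le> Cq" 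
    unfolding Cq_def using ge_one_powr_ge_zero[of 2 "1 / enn2real q"] by auto
  have "N (\<lambda>y. indicator (block j) y * kernel_int k f y) \<le> N (\<lambda>y. (?g1 y + ?g0 y) + ?g2 y)"
  proof (rule N_mono)
    show "(\<lambda>y. indicator (block j) y * kernel_int k f y) \<in> measurable_nonneg"
      unfolding measurable_nonneg_iff by measurable
    fix y :: real
    show "indicator (block j) y * kernel_int k f y \<le> (?g1 y + ?g0 y) + ?g2 y"
    proof (cases "y \<in> block j")
      case True
      then have y: "grid j < y" "y \<le> grid (j + 1)" by (auto simp: block_def)
      have "kernel_int k f y \<le> ennreal D * (k y ?b * ?I + kernel_int k f ?b)
        + kernel_int k (\<lambda>z. indicator {grid (j - 2)<..y} z * f z) y"
        using y grid_mono[of "j - 2" "j - 1"] grid_mono[of "j - 1" j]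
        by (intro kernel_int_split_le f grid_nonneg) auto
      also have "kernel_int k (\<lambda>z. indicator {grid (j - 2)<..y} z * f z) y
          \<le> kernel_int k (\<lambda>z. indicator {grid (j - 2)<..} z * piece f j z) y"
        unfolding piece_def using y by (intro kernel_int_mono_arg) (auto split: split_indicator)
      finally show ?thesis
        using True by (simp add: B_op_def distrib_left mult_ac add_left_mono)
    qed simp
  qed
  also have "\<dots> \<le> ennreal Cq * (N (\<lambda>y. ?g1 y + ?g0 y) + N ?g2)"
    unfolding Cq_def by (intro lp_norm_add_le q w m)
  also have "\<dots> \<le> ennreal Cq * (ennreal Cq * (N ?g1 + N ?g0) + N ?g2)"
    unfolding Cq_def by (intro mult_left_mono add_right_mono lp_norm_add_le q w m) simp
  also have "N ?g1 = ennreal D * (V1 j * ?I)"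
    unfolding V1_def by (subst N_cmult) (auto simp: measurable_nonneg_iff mult_ac)
  also have "N ?g0 = ennreal D * (V0 j * kernel_int k f ?b)"
    unfolding V0_def by (subst N_cmult) (auto simp: measurable_nonneg_iff mult_ac)
  also have "ennreal Cq * (ennreal Cq * (ennreal D * (V1 j * ?I) + ennreal D * (V0 j * kernel_int k f ?b)) + N ?g2)
      \<le> ennreal Cq * (ennreal Cq * (ennreal D * (V1 j * ?I) + ennreal D * (V0 j * kernel_int k f ?b)) + ennreal (Cq * D) * N ?g2)"
  \<comment> \<open>The local term is enlarged by \<open>Cq * D \<ge> 1\<close> so that all three
    terms share one constant.\<close>
  proof (intro mult_left_mono add_left_mono)
    have "1 * 1 \<le> Cq * D" using C1 D_ge_1 by (intro mult_mono) auto
    then have "1 * N ?g2 \<le> ennreal (Cq * D) * N ?g2"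
      by (intro mult_right_mono) auto
    then show "N ?g2 \<le> ennreal (Cq * D) * N ?g2" by simp
  qed simp
  also have "\<dots> = ennreal (Cq * Cq * D) * (V1 j * ?I + V0 j * kernel_int k f ?b + N ?g2)"
    using C1 D_ge_1 by (simp add: ennreal_mult distrib_left mult.assoc)
  finally show ?thesis .
qed

section \<open>Summing the three parts over the blocks\<close>

lemma block_empty: "grid (j + 1) = 0 \<Longrightarrow> block j = {}"
  using grid_nonneg[of j] by (auto simp: block_def)

lemma V0_empty: "grid (j + 1) = 0 \<Longrightarrow> V0 j = 0"
  unfolding V0_def using lp_norm_cong_AE[OF q w, of "indicator {}" "\<lambda>x. 0"] lp_norm_zero[OF q w]
  by (simp add: block_empty measurable_nonneg_iff)

lemma V1_empty: "grid (j + 1) = 0 \<Longrightarrow> V1 j = 0"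
  unfolding V1_def using lp_norm_zero[OF q w] by (simp add: block_empty)

lemma B_op_empty: "grid (j + 1) = 0 \<Longrightarrow> N (B_op j f) = 0"
  unfolding B_op_def using lp_norm_zero[OF q w] by (simp add: block_empty)

text \<open>The factor \<open>D\<close> is divided out of \<open>c\<close> instead of being pulled
  out of the integral of \<open>g\<close>, since \<open>g\<close> may be non-measurable.\<close>

lemma step_sum_le_D:
  assumes "1 \<le> n" and le: "\<And>j y. y \<in> block (j + n) \<Longrightarrow> c j \<le> ennreal D * g y"
    and "\<And>j. grid (j + 1) = 0 \<Longrightarrow> c j = 0"
  shows "zsum (\<lambda>j. rho j * c j epowr r) \<le> ennreal (4 * 2 powr (n / 2) * D powr r) * (\<integral>\<^sup>+y. u y * g y epowr r \<partial>hl)"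
proof -
  have D1: "ennreal D * ennreal (1 / D) = 1"
    using D_ge_1 by (simp flip: ennreal_mult)
  have eq: "rho j * c j epowr r = ennreal (D powr r) * (rho j * (ennreal (1 / D) * c j) epowr r)" for j
  proof -
    have "c j = ennreal D * (ennreal (1 / D) * c j)" by (simp add: D1 flip: mult.assoc)
    then have "c j epowr r = ennreal D epowr r * (ennreal (1 / D) * c j) epowr r"
      by (metis epowr_mult)
    then show ?thesis using D_ge_1 by (simp add: epowr_ennreal mult_ac)
  qed
  have "zsum (\<lambda>j. rho j * (ennreal (1 / D) * c j) epowr r) \<le> ennreal (4 * 2 powr (n / 2)) * (\<integral>\<^sup>+y. u y * g y epowr r \<partial>hl)"
  proof (rule step_sum_le[OF \<open>1 \<le> n\<close>])
    fix j y assume "y \<in> block (j + n)"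
    from le[OF this] have "ennreal (1 / D) * c j \<le> ennreal (1 / D) * (ennreal D * g y)"
      by (rule mult_left_mono) simp
    also have "\<dots> = g y" using D1 by (simp add: mult.commute flip: mult.assoc)
    finally show "(ennreal (1 / D) * c j) epowr r \<le> g y epowr r" using r by (intro epowr_mono) auto
  qed (simp add: assms(3))
  then have "ennreal (D powr r) * zsum (\<lambda>j. rho j * (ennreal (1 / D) * c j) epowr r)
      \<le> ennreal (D powr r) * (ennreal (4 * 2 powr (n / 2)) * (\<integral>\<^sup>+y. u y * g y epowr r \<partial>hl))"
    by (rule mult_left_mono) simp
  moreover have "zsum (\<lambda>j. rho j * c j epowr r) = ennreal (D powr r) * zsum (\<lambda>j. rho j * (ennreal (1 / D) * c j) epowr r)"
    by (simp only: eq zsum_cmult)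
  ultimately show ?thesis
    by (simp add: ennreal_mult mult_ac)
qed

text \<open>The shift is two: for \<open>x\<close> in block \<open>j + 2\<close> the point
  \<open>Z x\<close> lies between \<open>grid (j - 2)\<close> and \<open>grid (j - 1)\<close>. The
  right bound compares the kernels, the left one the integrals of \<open>f\<close>, and block
  \<open>j\<close> lies between \<open>Z x\<close> and \<open>x\<close>.\<close>

lemma zsum_V1_le:
  assumes f [measurable]: "f \<in> measurable_nonneg" and "nrm f < top" "A_1 p r q u v w k < top"
  shows "zsum (\<lambda>j. rho j * (V1 j * (\<integral>\<^sup>+z. f z * indicator {0..grid (j - 2)} z \<partial>hl)) epowr r)
    \<le> ennreal (4 * 2 powr (2 / 2) * D powr r) * (A_1 p r q u v w k * nrm f) epowr r"
proof -
  let ?g = "\<lambda>x. W1 (Z x) x * (\<integral>\<^sup>+z. f z * indicator {0..Z x} z \<partial>hl)"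
  have "zsum (\<lambda>j. rho j * (V1 j * (\<integral>\<^sup>+z. f z * indicator {0..grid (j - 2)} z \<partial>hl)) epowr r)
    \<le> ennreal (4 * 2 powr (of_int 2 / 2) * D powr r) * (\<integral>\<^sup>+y. u y * ?g y epowr r \<partial>hl)"
  proof (rule step_sum_le_D)
    fix j x assume x: "x \<in> block (j + 2)"
    have Z: "grid (j - 2) \<le> Z x" "Z x \<le> grid (j - 1)"
      using zeta_inv2_le[OF x] zeta_inv2_ge[OF x] by simp_all
    note kernel_int_section[OF grid_nonneg[of "j - 1"], measurable]
      kernel_int_section[OF Z_nonneg[of x], measurable]
    have "V1 j \<le> N (\<lambda>y. ennreal D * (indicator {Z x<..<x} y * k y (Z x)))"
      unfolding V1_def
    proof (rule N_mono)
      show "indicator (block j) y * k y (grid (j - 1)) \<le> ennreal D * (indicator {Z x<..<x} y * k y (Z x))" for y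
      proof (cases "y \<in> block j")
        case True
        then have y: "grid j < y" "y < x"
          using x grid_mono[of "j + 1" "j + 2"] by (auto simp: block_def)
        have "k y (grid (j - 1)) \<le> ennreal D * k y (Z x)"
          using Z y grid_mono[of "j - 1" j] by (intro kernel_antimono_right Z_nonneg) auto
        then show ?thesis
          using True y Z grid_mono[of "j - 1" j] by simp
      qed simp
    qed (simp add: measurable_nonneg_iff)
    also have "\<dots> = ennreal D * W1 (Z x) x"
      unfolding W1_def by (rule N_cmult) (simp add: measurable_nonneg_iff)
    finally have "V1 j * (\<integral>\<^sup>+z. f z * indicator {0..grid (j - 2)} z \<partial>hl)
        \<le> (ennreal D * W1 (Z x) x) * (\<integral>\<^sup>+z. f z * indicator {0..Z x} z \<partial>hl)"
      using Z(1) by (intro mult_mono nn_integral_mono) (auto split: split_indicator)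
    then show "V1 j * (\<integral>\<^sup>+z. f z * indicator {0..grid (j - 2)} z \<partial>hl) \<le> ennreal D * ?g x"
      by (simp add: mult.assoc)
  qed (simp_all add: V1_empty)
  also have "(\<integral>\<^sup>+y. u y * ?g y epowr r \<partial>hl) = ((\<integral>\<^sup>+y. u y * ?g y epowr r \<partial>hl) epowr (1 / r)) epowr r"
    using r by simp
  also have "\<dots> \<le> (A_1 p r q u v w k * nrm f) epowr r"
    using r least_const_bound[OF assms(3)[unfolded A_1_eq] assms(1,2)] unfolding A_1_eq by (intro epowr_mono) auto
  finally show ?thesis by (simp add: mult_left_mono)
qed

text \<open>Here the shift is three, placing \<open>Z x\<close> between \<open>grid (j - 1)\<close>
  and \<open>grid j\<close>: the kernel integral at \<open>grid (j - 1)\<close> must be dominated by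
  that at \<open>Z x\<close>, while block \<open>j\<close> still lies to the right of
  \<open>Z x\<close>.\<close>

lemma zsum_V0_le:
  assumes f [measurable]: "f \<in> measurable_nonneg" and "nrm f < top" "A_0 p r q u v w k < top"
  shows "zsum (\<lambda>j. rho j * (V0 j * kernel_int k f (grid (j - 1))) epowr r)
    \<le> ennreal (4 * 2 powr (3 / 2) * D powr r) * (A_0 p r q u v w k * nrm f) epowr r"
proof -
  let ?g = "\<lambda>x. W0 (Z x) x * kernel_int k f (Z x)"
  have "zsum (\<lambda>j. rho j * (V0 j * kernel_int k f (grid (j - 1))) epowr r)
    \<le> ennreal (4 * 2 powr (of_int 3 / 2) * D powr r) * (\<integral>\<^sup>+y. u y * ?g y epowr r \<partial>hl)"
  proof (rule step_sum_le_D)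
    fix j x assume x: "x \<in> block (j + 3)"
    have Z: "grid (j - 1) \<le> Z x" "Z x \<le> grid j"
      using zeta_inv2_le[OF x] zeta_inv2_ge[OF x] by simp_all
    have "V0 j \<le> W0 (Z x) x"
      unfolding V0_def W0_def using x Z grid_mono[of "j + 1" "j + 3"]
      by (intro N_mono) (auto simp: measurable_nonneg_iff block_def split: split_indicator)
    moreover have "kernel_int k f (grid (j - 1)) \<le> ennreal D * kernel_int k f (Z x)"
      by (intro kernel_int_mono f grid_nonneg Z)
    ultimately have "V0 j * kernel_int k f (grid (j - 1)) \<le> W0 (Z x) x * (ennreal D * kernel_int k f (Z x))"
      by (intro mult_mono) auto
    then show "V0 j * kernel_int k f (grid (j - 1)) \<le> ennreal D * ?g x"
      by (simp add: mult.left_commute)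
  qed (simp_all add: V0_empty)
  also have "(\<integral>\<^sup>+y. u y * ?g y epowr r \<partial>hl) = ((\<integral>\<^sup>+y. u y * ?g y epowr r \<partial>hl) epowr (1 / r)) epowr r"
    using r by simp
  also have "\<dots> \<le> (A_0 p r q u v w k * nrm f) epowr r"
    using r least_const_bound[OF assms(3)[unfolded A_0_eq] assms(1,2)] unfolding A_0_eq by (intro epowr_mono) auto
  finally show ?thesis by (simp add: mult_left_mono)
qed

definition hb :: "int \<Rightarrow> ennreal" where
  "hb j = least_const (ennreal p) v (\<lambda>f. N (B_op j f))"

lemma hb_empty: "grid (j + 1) = 0 \<Longrightarrow> hb j = 0"
proof -
  assume "grid (j + 1) = 0"
  then have "hb j \<le> 0" unfolding hb_def by (intro least_const_le) (simp add: B_op_empty)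
  then show "hb j = 0" by simp
qed

lemma nrm_piece_finite:
  assumes "f \<in> measurable_nonneg" "nrm f < top"
  shows "nrm (piece f j) < top"
proof -
  have "nrm (piece f j) \<le> nrm f"
    by (rule lp_norm_mono[OF p_pos(2) v piece_measurable[OF assms(1)]])
       (auto simp: piece_def split: split_indicator)
  then show ?thesis using assms(2) by simp
qed

lemma N_B_op_piece_le:
  assumes "f \<in> measurable_nonneg" "nrm f < top" "hb j < top"
  shows "N (B_op j (piece f j)) \<le> hb j * nrm (piece f j)"
  using assms unfolding hb_def by (intro least_const_bound piece_measurable nrm_piece_finite) auto

lemma zsum_piece_le:
  assumes [measurable]: "f \<in> measurable_nonneg"
  shows "zsum (\<lambda>j. nrm (piece f j) epowr p) \<le> 3 * nrm f epowr p"
proof -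
  have "nrm (piece f j) epowr p = (\<integral>\<^sup>+y. (f y epowr p * v y) * indicator {grid (j - 2)<..grid (j + 1)} y \<partial>hl)" for j
    unfolding lp_norm_epowr[OF p_pos(1)] piece_def
    by (intro nn_integral_cong) (auto split: split_indicator)
  then show ?thesis
    unfolding lp_norm_epowr[OF p_pos(1)] by (simp add: zsum_wide_block_le)
qed

text \<open>\<open>A_2\<close> at \<open>t = grid (j + 1)\<close> controls \<open>hb j\<close>
  uniformly in \<open>j\<close>. As \<open>r / p \<ge> 1\<close>, the powers of the norms of the
  pieces are then summed by \<open>zsum_epowr_le\<close>, with overlap three.\<close>

lemma zsum_B_op_le_of_le:
  assumes f: "f \<in> measurable_nonneg" "nrm f < top" and A: "A_2 p r q u v w k < top" and "p \<le> r"
  shows "zsum (\<lambda>j. rho j * N (B_op j (piece f j)) epowr r)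
    \<le> ennreal (2 * 3 powr (r / p)) * (A_2 p r q u v w k * nrm f) epowr r"
proof -
  let ?A = "A_2 p r q u v w k"
  have h: "rho (j + 1) epowr (1 / r) * hb j \<le> ?A" for j
  proof (cases "grid (j + 1) = 0")
    case False
    then have pos: "0 < grid (j + 1)" using grid_nonneg[of "j + 1"] by simp
    have "hb j \<le> opn (grid (j + 1))"
      unfolding hb_def opn_def op_norm_def
    proof (intro least_const_mono N_mono B_op_measurable)
      fix f :: "real \<Rightarrow> ennreal" and y
      have "kernel_int k (\<lambda>z. indicator {grid (j - 2)<..} z * f z) y \<le> kernel_int k f y"
        by (intro kernel_int_mono_arg) (auto split: split_indicator)
      then show "B_op j f y \<le> H_star k (grid (j + 1)) f y"
        using grid_nonneg[of j] by (auto simp: B_op_def H_star_def block_def split: split_indicator)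
    qed
    then have "rho (j + 1) epowr (1 / r) * hb j \<le> tail u (grid (j + 1)) epowr (1 / r) * opn (grid (j + 1))"
      by (simp add: tail_grid[OF pos] mult_left_mono)
    also have "\<dots> \<le> ?A"
      using pos \<open>p \<le> r\<close> unfolding A_2_def opn_def by (auto intro: SUP_upper)
    finally show ?thesis .
  qed (simp add: hb_empty)
  have hfin: "hb j < top" for j
    using h[of j] A by (auto simp: less_top[symmetric] ennreal_mult_eq_top_iff top_unique)
  have "zsum (\<lambda>j. rho j * N (B_op j (piece f j)) epowr r) \<le> zsum (\<lambda>j. (2 * ?A epowr r) * (nrm (piece f j) epowr p) epowr (r / p))"
  proof (intro zsum_mono)
    fix j
    have "rho j \<le> 2 * rho (j + 1)"
      using rho_mono[of "j - 1" j] rho_numeral(1)[of "j + 1"] by (simp add: rho_mono)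
    moreover have "N (B_op j (piece f j)) epowr r \<le> (hb j * nrm (piece f j)) epowr r"
      using r by (intro epowr_mono N_B_op_piece_le f hfin) auto
    ultimately have "rho j * N (B_op j (piece f j)) epowr r \<le> (2 * rho (j + 1)) * (hb j * nrm (piece f j)) epowr r"
      by (intro mult_mono) auto
    also have "\<dots> = 2 * (rho (j + 1) epowr (1 / r) * hb j) epowr r * nrm (piece f j) epowr r"
      using r by (simp add: epowr_mult mult_ac)
    also have "\<dots> \<le> 2 * ?A epowr r * nrm (piece f j) epowr r"
      using r by (intro mult_right_mono mult_left_mono epowr_mono h) auto
    finally show "rho j * N (B_op j (piece f j)) epowr r \<le> (2 * ?A epowr r) * (nrm (piece f j) epowr p) epowr (r / p)"
      using p_pos by (simp add: epowr_epowr)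
  qed
  also have "\<dots> = (2 * ?A epowr r) * zsum (\<lambda>j. (nrm (piece f j) epowr p) epowr (r / p))"
    by (rule zsum_cmult)
  also have "\<dots> \<le> (2 * ?A epowr r) * (3 * nrm f epowr p) epowr (r / p)"
  proof (rule mult_left_mono)
    have "zsum (\<lambda>j. (nrm (piece f j) epowr p) epowr (r / p)) \<le> zsum (\<lambda>j. nrm (piece f j) epowr p) epowr (r / p)"
      using p_pos \<open>p \<le> r\<close> by (intro zsum_epowr_le) simp
    also have "\<dots> \<le> (3 * nrm f epowr p) epowr (r / p)"
      using p_pos r by (intro epowr_mono zsum_piece_le f) simp
    finally show "zsum (\<lambda>j. (nrm (piece f j) epowr p) epowr (r / p)) \<le> (3 * nrm f epowr p) epowr (r / p)" .
  qed simp
  also have "\<dots> = ennreal (2 * 3 powr (r / p)) * (?A * nrm f) epowr r"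
    using p_pos by (simp add: epowr_mult epowr_epowr ennreal_mult epowr_ennreal[of 3, simplified] mult_ac)
  finally show ?thesis .
qed

text \<open>\<open>A_2\<close> controls the weighted sum of the powers \<open>s\<close> of
  \<open>hb j\<close>. Hoelder's inequality with exponents \<open>s / r\<close> and
  \<open>p / r\<close> pairs it with the sum of the powers \<open>p\<close> of the norms of the
  pieces.\<close>

lemma zsum_B_op_le_of_less:
  assumes f: "f \<in> measurable_nonneg" "nrm f < top" and A: "A_2 p r q u v w k < top" and "r < p"
  shows "zsum (\<lambda>j. rho j * N (B_op j (piece f j)) epowr r)
    \<le> ennreal (2 * (2 powr (s / p) * (4 * 2 powr (1 / 2))) powr (r / s) * 3 powr (r / p))
      * (A_2 p r q u v w k * nrm f) epowr r"
proof -
  note sf = s_facts[OF \<open>r < p\<close>]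
  let ?A = "A_2 p r q u v w k"
  let ?K = "2 powr (s / p) * (4 * 2 powr (1 / 2)) :: real"
  let ?op = "\<lambda>x. op_norm (ennreal p) v q w (H_star2 u k (zeta_inv u x) (zeta u x))"
  have "zsum (\<lambda>j. rho j * (rho (j + 2) epowr (s / p) * hb j epowr s))
      \<le> ennreal (4 * 2 powr (of_int 1 / 2)) * (\<integral>\<^sup>+x. u x * (tail u x epowr (s / p) * ?op x epowr s) \<partial>hl)"
  proof (rule step_sum_le)
    fix j x assume x: "x \<in> block (j + 1)"
    \<comment> \<open>For \<open>x\<close> in block \<open>j + 1\<close>, block \<open>j\<close>
      lies between \<open>zeta_inv u x\<close> and \<open>zeta u x\<close>, and the lower limit of
      \<open>H_star2\<close> is at most \<open>grid (j - 2)\<close>. The pieces start at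
      \<open>grid (j - 2)\<close> for this reason.\<close>
    have zi: "zeta_inv u x \<le> grid j" using zeta_inv_le[OF x] by simp
    have zi2: "zeta_inv u (zeta_inv u x) \<le> grid (j - 2)" using zeta_inv2_le[OF x] by (simp add: zeta_inv2_def)
    have z: "grid (j + 1) \<le> zeta u x" using zeta_ge[OF block_pos[OF x]] x by (auto simp: block_def)
    have "hb j \<le> ?op x"
      unfolding hb_def op_norm_def
    proof (intro least_const_mono N_mono B_op_measurable)
      fix f :: "real \<Rightarrow> ennreal" and y :: real assume y: "0 \<le> y"
      have "kernel_int k (\<lambda>z. indicator {grid (j - 2)<..} z * f z) y
          \<le> kernel_int k (\<lambda>z. indicator {zeta_inv u (zeta_inv u x)..} z * f z) y"
        using zi2 by (intro kernel_int_mono_arg) (auto split: split_indicator)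
      then show "B_op j f y \<le> H_star2 u k (zeta_inv u x) (zeta u x) f y"
        using zi z unfolding H_star2_eq[OF y] by (auto simp: B_op_def block_def split: split_indicator)
    qed
    moreover have "rho (j + 2) \<le> tail u x" using blockD[OF x] by (simp add: add.assoc)
    ultimately show "rho (j + 2) epowr (s / p) * hb j epowr s \<le> tail u x epowr (s / p) * ?op x epowr s"
      using sf(1) p_pos by (intro mult_mono epowr_mono) auto
  qed (auto simp: hb_empty)
  then have le: "zsum (\<lambda>j. rho j * (rho (j + 2) epowr (s / p) * hb j epowr s)) \<le> ennreal (4 * 2 powr (1 / 2)) * ?A epowr s"
    by (simp add: A_2_epowr[OF \<open>r < p\<close>])
  \<comment> \<open>By \<open>s / r = 1 + s / p\<close> one factor \<open>rho j\<close> is split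
    off; the rest is moved to the level \<open>rho (j + 2)\<close>, the lower bound of the tail on
    block \<open>j + 1\<close>.\<close>
  have eq: "(rho j * hb j epowr r) epowr (s / r) = ennreal (2 powr (s / p)) * (rho j * (rho (j + 2) epowr (s / p) * hb j epowr s))" for j
  proof -
    have "rho j = ennreal 2 * rho (j + 2)"
      using rho_numeral(1)[of "j + 2"] by simp
    then have "rho j epowr (s / p) = ennreal (2 powr (s / p)) * rho (j + 2) epowr (s / p)"
      by (simp add: epowr_mult epowr_ennreal del: ennreal_numeral)
    moreover have "rho j epowr (s / r) = rho j * rho j epowr (s / p)"
      using epowr_add[of "rho j" 1 "s / p"] sf(4) by simp
    ultimately show ?thesis
      using r by (simp add: epowr_mult epowr_epowr mult_ac)
  qed
  have a: "zsum (\<lambda>j. (rho j * hb j epowr r) epowr (s / r)) \<le> ((ennreal ?K * ?A epowr s) epowr (r / s)) epowr (s / r)"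
  proof -
    have "zsum (\<lambda>j. (rho j * hb j epowr r) epowr (s / r)) \<le> ennreal (2 powr (s / p)) * (ennreal (4 * 2 powr (1 / 2)) * ?A epowr s)"
      unfolding eq zsum_cmult by (intro mult_left_mono le) simp
    also have "\<dots> = ennreal ?K * ?A epowr s"
      by (simp add: ennreal_mult mult.assoc)
    finally show ?thesis using sf(1) r by (simp add: epowr_epowr)
  qed
  have b: "zsum (\<lambda>j. (nrm (piece f j) epowr r) epowr (p / r)) \<le> ((3 * nrm f epowr p) epowr (r / p)) epowr (p / r)"
    using zsum_piece_le[OF f(1)] p_pos r by (simp add: epowr_epowr)
  have fin: "(ennreal ?K * ?A epowr s) epowr (r / s) < top" "(3 * nrm f epowr p) epowr (r / p) < top"
    using A f(2) by (auto simp: ennreal_mult_less_top)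
  have hfin: "hb j < top" for j
  proof -
    have "(rho j * hb j epowr r) epowr (s / r) \<le> ((ennreal ?K * ?A epowr s) epowr (r / s)) epowr (s / r)"
      using a by (rule order_trans[OF zsum_le])
    also have "\<dots> < top" using fin(1) by simp
    finally show ?thesis by (auto simp: less_top[symmetric] ennreal_mult_eq_top_iff)
  qed
  have "zsum (\<lambda>j. rho j * N (B_op j (piece f j)) epowr r) \<le> zsum (\<lambda>j. (rho j * hb j epowr r) * nrm (piece f j) epowr r)"
  proof (intro zsum_mono)
    fix j
    have "N (B_op j (piece f j)) epowr r \<le> (hb j * nrm (piece f j)) epowr r"
      using r by (intro epowr_mono N_B_op_piece_le f hfin) auto
    then show "rho j * N (B_op j (piece f j)) epowr r \<le> (rho j * hb j epowr r) * nrm (piece f j) epowr r"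
      by (simp add: epowr_mult mult.assoc mult_left_mono)
  qed
  also have "\<dots> \<le> 2 * ((ennreal ?K * ?A epowr s) epowr (r / s) * (3 * nrm f epowr p) epowr (r / p))"
    using sf(1,5) p_pos r by (intro zsum_Hoelder[OF _ _ _ a b fin]) auto
  also have "(ennreal ?K * ?A epowr s) epowr (r / s) = ennreal (?K powr (r / s)) * ?A epowr r"
    using sf(1) by (subst epowr_mult, subst epowr_ennreal) (simp_all add: epowr_epowr)
  also have "2 * (ennreal (?K powr (r / s)) * ?A epowr r * (3 * nrm f epowr p) epowr (r / p))
      = ennreal (2 * ?K powr (r / s) * 3 powr (r / p)) * (?A * nrm f) epowr r"
  proof -
    have "ennreal (2 * c * 3 powr (r / p)) * (?A * nrm f) epowr r
        = 2 * (ennreal c * ?A epowr r * (3 * nrm f epowr p) epowr (r / p))" if "0 \<le> c" for c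
      using that p_pos
      by (simp add: epowr_mult epowr_epowr ennreal_mult epowr_ennreal[of 3, simplified] mult_ac)
    then show ?thesis by simp
  qed
  finally show ?thesis .
qed

text \<open>The product of the constant of \<open>zsum_block_hardy\<close>, the one of
  \<open>block_decomposition\<close> and \<open>epowr_add3_le\<close>, and the sum of those of the
  three series; the maximum covers both \<open>p \<le> r\<close> and \<open>r < p\<close>.\<close>

definition K_suff :: real where
  "K_suff = ((1 / (1 - 2 powr (- (1 / (4 * r)) * enn2real q))) powr (1 / enn2real q) + 1) powr r / (1 - 2 powr (- (1 / 4)))
    * ((Cq * Cq * D) powr r * 4 powr r)
    * (4 * 2 powr (2 / 2) * D powr r + 4 * 2 powr (3 / 2) * D powr r
       + max (2 * 3 powr (r / p)) (2 * (2 powr (s / p) * (4 * 2 powr (1 / 2))) powr (r / s) * 3 powr (r / p)))"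

lemma Sf_le:
  assumes f: "f \<in> measurable_nonneg" "nrm f < top"
    and A: "A_0 p r q u v w k < top" "A_1 p r q u v w k < top" "A_2 p r q u v w k < top"
  shows "(\<integral>\<^sup>+x. u x * Sf f x epowr r \<partial>hl)
    \<le> ennreal K_suff * ((A_0 p r q u v w k + A_1 p r q u v w k + A_2 p r q u v w k) * nrm f) epowr r"
proof -
  let ?A0 = "A_0 p r q u v w k" and ?A1 = "A_1 p r q u v w k" and ?A2 = "A_2 p r q u v w k"
  let ?R = "((?A0 + ?A1 + ?A2) * nrm f) epowr r"
  define c1 c2 c3 where "c1 = ((1 / (1 - 2 powr (- (1 / (4 * r)) * enn2real q))) powr (1 / enn2real q) + 1) powr r / (1 - 2 powr (- (1 / 4)) :: real)"
    and "c2 = (Cq * Cq * D) powr r * 4 powr r"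
    and "c3 = max (2 * 3 powr (r / p)) (2 * (2 powr (s / p) * (4 * 2 powr (1 / 2))) powr (r / s) * 3 powr (r / p) :: real)"
  let ?e1 = "4 * 2 powr (2 / 2) * D powr r" and ?e0 = "4 * 2 powr (3 / 2) * D powr r"
  have "2 powr (- (1 / 4)) < (2::real) powr 0" by (rule powr_less_mono) auto
  then have c_nonneg: "0 \<le> c1" "0 \<le> c2" "0 \<le> c3" "0 \<le> ?e1" "0 \<le> ?e0"
    by (auto simp: c1_def c2_def c3_def le_max_iff_disj)
  let ?x1 = "\<lambda>j. V1 j * (\<integral>\<^sup>+z. f z * indicator {0..grid (j - 2)} z \<partial>hl)"
  let ?x0 = "\<lambda>j. V0 j * kernel_int k f (grid (j - 1))"
  let ?x2 = "\<lambda>j. N (B_op j (piece f j))"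
  have R: "(a * nrm f) epowr r \<le> ?R" if "a \<le> ?A0 + ?A1 + ?A2" for a
    using that r by (intro epowr_mono mult_right_mono) auto
  have "zsum (\<lambda>j. rho j * ?x1 j epowr r) \<le> ennreal ?e1 * (?A1 * nrm f) epowr r"
    by (rule zsum_V1_le) fact+
  also have "\<dots> \<le> ennreal ?e1 * ?R"
    by (intro mult_left_mono R) (auto simp: add.commute add.left_commute)
  finally have x1: "zsum (\<lambda>j. rho j * ?x1 j epowr r) \<le> ennreal ?e1 * ?R" .
  have "zsum (\<lambda>j. rho j * ?x0 j epowr r) \<le> ennreal ?e0 * (?A0 * nrm f) epowr r"
    by (rule zsum_V0_le) fact+
  also have "\<dots> \<le> ennreal ?e0 * ?R"
    by (intro mult_left_mono R) (auto simp: add.assoc)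
  finally have x0: "zsum (\<lambda>j. rho j * ?x0 j epowr r) \<le> ennreal ?e0 * ?R" .
  have "zsum (\<lambda>j. rho j * ?x2 j epowr r) \<le> ennreal c3 * (?A2 * nrm f) epowr r"
  proof (cases "p \<le> r")
    case True
    show ?thesis
      using zsum_B_op_le_of_le[OF f A(3) True]
      by (rule order_trans) (intro mult_right_mono ennreal_leI, auto simp: c3_def)
  next
    case False
    then have "r < p" by simp
    show ?thesis
      using zsum_B_op_le_of_less[OF f A(3) \<open>r < p\<close>]
      by (rule order_trans) (intro mult_right_mono ennreal_leI, auto simp: c3_def)
  qed
  also have "\<dots> \<le> ennreal c3 * ?R"
    by (intro mult_left_mono R) auto
  finally have x2: "zsum (\<lambda>j. rho j * ?x2 j epowr r) \<le> ennreal c3 * ?R" .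
  have "zsum (\<lambda>j. rho j * N (\<lambda>y. indicator (block j) y * kernel_int k f y) epowr r)
    \<le> zsum (\<lambda>j. ennreal c2 * (rho j * ?x1 j epowr r + rho j * ?x0 j epowr r + rho j * ?x2 j epowr r))"
  proof (intro zsum_mono)
    fix j
    have "N (\<lambda>y. indicator (block j) y * kernel_int k f y) epowr r
        \<le> (ennreal (Cq * Cq * D) * (?x1 j + ?x0 j + ?x2 j)) epowr r"
      using r by (intro epowr_mono block_decomposition f) auto
    also have "\<dots> = ennreal ((Cq * Cq * D) powr r) * (?x1 j + ?x0 j + ?x2 j) epowr r"
      using D_ge_1 by (simp add: epowr_mult epowr_ennreal Cq_def)
    also have "\<dots> \<le> ennreal ((Cq * Cq * D) powr r) * (ennreal (4 powr r) * (?x1 j epowr r + ?x0 j epowr r + ?x2 j epowr r))"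
      using r by (intro mult_left_mono epowr_add3_le) auto
    also have "\<dots> = ennreal c2 * (?x1 j epowr r + ?x0 j epowr r + ?x2 j epowr r)"
      by (simp add: c2_def ennreal_mult mult.assoc)
    finally have "rho j * N (\<lambda>y. indicator (block j) y * kernel_int k f y) epowr r
        \<le> rho j * (ennreal c2 * (?x1 j epowr r + ?x0 j epowr r + ?x2 j epowr r))"
      by (rule mult_left_mono) simp
    then show "rho j * N (\<lambda>y. indicator (block j) y * kernel_int k f y) epowr r
        \<le> ennreal c2 * (rho j * ?x1 j epowr r + rho j * ?x0 j epowr r + rho j * ?x2 j epowr r)"
      by (simp only: distrib_left mult.left_commute[of "rho j" "ennreal c2"])
  qed
  also have "\<dots> = ennreal c2 * (zsum (\<lambda>j. rho j * ?x1 j epowr r) + zsum (\<lambda>j. rho j * ?x0 j epowr r) + zsum (\<lambda>j. rho j * ?x2 j epowr r))"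
    by (simp only: zsum_cmult zsum_add)
  also have "\<dots> \<le> ennreal c2 * (ennreal ?e1 * ?R + ennreal ?e0 * ?R + ennreal c3 * ?R)"
    by (intro mult_left_mono add_mono x0 x1 x2) simp
  also have "\<dots> = ennreal (c2 * (?e1 + ?e0 + c3)) * ?R"
    using c_nonneg by (simp only: ennreal_mult ennreal_plus add_nonneg_nonneg distrib_right mult.assoc)
  finally have "zsum (\<lambda>j. rho j * N (\<lambda>y. indicator (block j) y * kernel_int k f y) epowr r)
    \<le> ennreal (c2 * (?e1 + ?e0 + c3)) * ?R" .
  then have "ennreal c1 * zsum (\<lambda>j. rho j * N (\<lambda>y. indicator (block j) y * kernel_int k f y) epowr r)
      \<le> ennreal c1 * (ennreal (c2 * (?e1 + ?e0 + c3)) * ?R)"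
    by (rule mult_left_mono) simp
  also have "\<dots> = ennreal K_suff * ?R"
    unfolding K_suff_def c1_def[symmetric] c2_def[symmetric] c3_def[symmetric]
    using c_nonneg by (simp only: mult.assoc ennreal_mult add_nonneg_nonneg mult_nonneg_nonneg)
  finally show ?thesis
    using order_trans[OF zsum_block_hardy[OF f(1)]] unfolding c1_def by blast
qed

lemma C_S_le:
  assumes A: "A_0 p r q u v w k < top" "A_1 p r q u v w k < top" "A_2 p r q u v w k < top"
  shows "CS \<le> ennreal (K_suff powr (1 / r)) * (A_0 p r q u v w k + A_1 p r q u v w k + A_2 p r q u v w k)"
  unfolding C_S_eq
proof (rule least_const_le)
  let ?A = "A_0 p r q u v w k + A_1 p r q u v w k + A_2 p r q u v w k"
  fix f assume f: "f \<in> measurable_nonneg" "nrm f < top"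
  have "(\<integral>\<^sup>+x. u x * Sf f x epowr r \<partial>hl) epowr (1 / r) \<le> (ennreal K_suff * (?A * nrm f) epowr r) epowr (1 / r)"
    using r by (intro epowr_mono Sf_le f A) auto
  \<comment> \<open>The sign of \<open>K_suff\<close> is settled by cases: a negative value would
    make the left-hand side \<open>0\<close>.\<close>
  also have "\<dots> \<le> ennreal (K_suff powr (1 / r)) * ?A * nrm f"
    using r by (cases "0 \<le> K_suff") (simp_all add: epowr_mult epowr_ennreal mult.assoc ennreal_neg)
  finally show "(\<integral>\<^sup>+x. u x * Sf f x epowr r \<partial>hl) epowr (1 / r) \<le> ennreal (K_suff powr (1 / r)) * ?A * nrm f" .
qed

text \<open>The added \<open>1\<close> in the first constant keeps it positive, so that the bound
  persists when the right-hand sum is infinite; in the second it covers the case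
  \<open>p \<le> r\<close>.\<close>

lemma two_sided:
  shows "CS \<le> ennreal (K_suff powr (1 / r) + 1) * (A_0 p r q u v w k + A_1 p r q u v w k + A_2 p r q u v w k)"
    and "A_0 p r q u v w k + A_1 p r q u v w k + A_2 p r q u v w k
      \<le> ennreal (D + D + (1 + (2 * (2 powr r * (4 * 2 powr (1 / 2)))) powr (1 / r))) * CS"
proof -
  let ?A = "A_0 p r q u v w k + A_1 p r q u v w k + A_2 p r q u v w k"
  show "CS \<le> ennreal (K_suff powr (1 / r) + 1) * ?A"
  proof (cases "?A < top")
    case True
    then have "CS \<le> ennreal (K_suff powr (1 / r)) * ?A" by (intro C_S_le) auto
    also have "\<dots> \<le> ennreal (K_suff powr (1 / r) + 1) * ?A"
      by (intro mult_right_mono ennreal_leI) auto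
    finally show ?thesis .
  next
    case False
    then have A: "?A = top" by (simp add: less_top[symmetric])
    have "0 < K_suff powr (1 / r) + 1" by (rule add_nonneg_pos) auto
    then have "ennreal (K_suff powr (1 / r) + 1) * top = top"
      by (simp add: ennreal_mult_top ennreal_eq_0_iff not_le del: ennreal_plus)
    then show ?thesis by (simp only: A top_greatest)
  qed
  let ?K = "(2 * (2 powr r * (4 * 2 powr (1 / 2)))) powr (1 / r) :: real"
  have "A_2 p r q u v w k \<le> ennreal (1 + ?K) * CS"
  proof (cases "p \<le> r")
    case True
    have "A_2 p r q u v w k \<le> 1 * CS" using A_2_le_of_le[OF True] by simp
    also have "\<dots> \<le> ennreal (1 + ?K) * CS" by (intro mult_right_mono) auto
    finally show ?thesis .
  next
    case False
    then have "A_2 p r q u v w k \<le> (2 * K2) epowr (1 / r) * CS" by (intro A_2_le_of_less) simp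
    also have "(2 * K2) epowr (1 / r) = ennreal ?K"
      by (simp add: K2_def epowr_ennreal flip: ennreal_numeral ennreal_mult)
    also have "ennreal ?K * CS \<le> ennreal (1 + ?K) * CS" by (intro mult_right_mono ennreal_leI) auto
    finally show ?thesis .
  qed
  then have "?A \<le> ennreal D * CS + ennreal D * CS + ennreal (1 + ?K) * CS"
    by (intro add_mono A_0_le A_1_le)
  also have "\<dots> = (ennreal D + ennreal D + ennreal (1 + ?K)) * CS"
    by (simp only: distrib_right)
  also have "ennreal D + ennreal D + ennreal (1 + ?K) = ennreal (D + D + (1 + ?K))"
  proof -
    have sum3: "ennreal a + ennreal b + ennreal c = ennreal (a + b + c)"
      if "0 \<le> a" "0 \<le> b" "0 \<le> c" for a b c
      using that by simp
    show ?thesis by (rule sum3) (use D_ge_1 in auto)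
  qed
  finally show "?A \<le> ennreal (D + D + (1 + ?K)) * CS" .
qed

end

theorem theorem3p2:
  fixes p r D :: real and q :: ennreal
  assumes "1 \<le> p" and "0 < r" and "0 < q" and "1 \<le> D"
  shows "\<exists>c1 c2 :: real. 0 < c1 \<and> 0 < c2 \<and>
    (\<forall>(u :: real \<Rightarrow> ennreal) (v :: real \<Rightarrow> ennreal) (w :: real \<Rightarrow> ennreal)
      (k :: real \<Rightarrow> real \<Rightarrow> ennreal).
      u \<in> measurable_nonneg \<longrightarrow> v \<in> measurable_nonneg \<longrightarrow> w \<in> measurable_nonneg \<longrightarrow>
      (\<forall>t>0. 0 < tail u t \<and> tail u t < \<infinity>) \<longrightarrow>
      oinarov_kernel D k \<longrightarrow>
      (C_S p r q u v w k < \<infinity> \<longleftrightarrow>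
         A_0 p r q u v w k < \<infinity> \<and> A_1 p r q u v w k < \<infinity> \<and> A_2 p r q u v w k < \<infinity>) \<and>
      C_S p r q u v w k \<le> ennreal c1 * (A_0 p r q u v w k + A_1 p r q u v w k + A_2 p r q u v w k) \<and>
      A_0 p r q u v w k + A_1 p r q u v w k + A_2 p r q u v w k \<le> ennreal c2 * C_S p r q u v w k)"
proof -
  \<comment> \<open>Outside the locale \<open>K_suff\<close> has the arguments \<open>D\<close>,
    \<open>p\<close>, \<open>r\<close> and \<open>q\<close> only, so both constants are fixed before
    the weights and the kernel.\<close>
  define c1 where "c1 = iterated_hardy.K_suff D p r q powr (1 / r) + 1"
  define c2 where "c2 = D + D + (1 + (2 * (2 powr r * (4 * 2 powr (1 / 2)))) powr (1 / r))"
  have main: "C_S p r q u v w k \<le> ennreal c1 * (A_0 p r q u v w k + A_1 p r q u v w k + A_2 p r q u v w k) \<and>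
      A_0 p r q u v w k + A_1 p r q u v w k + A_2 p r q u v w k \<le> ennreal c2 * C_S p r q u v w k"
    if "u \<in> measurable_nonneg" "v \<in> measurable_nonneg" "w \<in> measurable_nonneg"
      "\<forall>t>0. 0 < tail u t \<and> tail u t < \<infinity>" "oinarov_kernel D k" for u v w k
  proof -
    interpret iterated_hardy D k u p r q v w
      by unfold_locales (use that assms in auto)
    show ?thesis unfolding c1_def c2_def using two_sided by blast
  qed
  \<comment> \<open>The equivalence follows from the two inequalities alone, both constants being
    finite.\<close>
  have iff: "C < \<infinity> \<longleftrightarrow> a < \<infinity> \<and> b < \<infinity> \<and> c < \<infinity>"
    if "C \<le> ennreal c1 * (a + b + c)" "a + b + c \<le> ennreal c2 * C" for C a b c
  proof -
    have "C < \<infinity>" if "a < \<infinity>" "b < \<infinity>" "c < \<infinity>"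
      using that \<open>C \<le> ennreal c1 * (a + b + c)\<close>
      by (auto simp: ennreal_mult_less_top intro: le_less_trans)
    moreover have "a + b + c < \<infinity>" if "C < \<infinity>"
    proof (rule le_less_trans)
      show "ennreal c2 * C < \<infinity>" using that by (simp add: ennreal_mult_less_top)
    qed fact
    ultimately show ?thesis by auto
  qed
  have "0 < c1" unfolding c1_def by (rule add_nonneg_pos) simp_all
  moreover have "0 < c2" unfolding c2_def using assms(4) by (intro add_pos_pos add_pos_nonneg) simp_all
  ultimately show ?thesis
    using main iff[OF conjunct1[OF main] conjunct2[OF main]]
    by (intro exI[of _ c1] exI[of _ c2] conjI allI impI) (simp_all only:)
qed

end
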